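(* Let $p\ge 3$ and let $T$ be a triangle with a Clough–Tocher split $\mathcal R$. Let $A$ be the finite element system on the cellular complex formed by $T$, its edges and its vertices, of high order composite forms with double-trace restrictions described in the context. Then $A$ admits extensions from $\partial T$ to $T$, i.e. for each $k\in\{0,1,2\}$ the restriction map $A^k(T)\to A^k(\partial T)$ is surjective. Hence $A$ is compatible.
   Context: $T$ is a nondegenerate triangle in a two-dimensional real vector space $\mathbb V$; $W$ is an interior point of $T$, and $\mathcal R$ is the subdivision of $T$ into three triangles obtained by joining $W$ to the vertices. $\mathrm{Alt}^k(\mathbb V)$ is the space of alternating $k$-linear forms on $\mathbb V$; $\mathrm P^q(E)$ is the space of polynomials of degree at most $q$ on an edge $E$. Spaces on $T$: $A^0(T)$ is the space of functions of class $\mathrm C^1(T)$ that are polynomials of degree $\le p$ on each small triangle of $\mathcal R$; $A^1(T)$ is the space of continuous $1$-forms on $T$, with continuous exterior derivative, whose coefficients are polynomials of degree $\le p-1$ on each small triangle; $A^2(T)$ is the space of continuous $2$-forms on $T$ whose coefficient is polynomial of degree $\le p-2$ on each small triangle. The differential is the exterior derivative. For a cell $T'$, $\mathrm{tr}_{T'}$ denotes the restriction to $T'$ of a form, keeping its action on all vectors of $\mathbb V$, while $\mathrm{pu}_{T'}$ denotes the pullback, keeping only the action on vectors tangent to $T'$. A pair $(v_0,v_1)$ with $v_0$ a $\mathrm{Alt}^k(\mathbb V)$-valued and $v_1$ a $\mathrm{Alt}^{k+1}(\mathbb V)$-valued function on $T'$ is admissible if $\mathrm d\,\mathrm{pu}_{T'}v_0=\mathrm{pu}_{T'}v_1$.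 Spaces on an edge $E$: $A^0(E)$ is the space of admissible pairs in $\mathrm P^p(E)\oplus \mathrm P^{p-1}(E)\otimes\mathrm{Alt}^1(\mathbb V)$; $A^1(E)=\mathrm P^{p-1}(E)\otimes\mathrm{Alt}^1(\mathbb V)\oplus\mathrm P^{p-2}(E)\otimes\mathrm{Alt}^2(\mathbb V)$; $A^2(E)=\mathrm P^{p-2}(E)\otimes\mathrm{Alt}^2(\mathbb V)$. Spaces at a vertex $V$: $A^0(V)=\mathbb R\oplus\mathrm{Alt}^1(\mathbb V)$, $A^1(V)=\mathrm{Alt}^1(\mathbb V)\oplus\mathrm{Alt}^2(\mathbb V)$, $A^2(V)=\mathrm{Alt}^2(\mathbb V)$. On edges and vertices the differential is $(v_0,v_1)\mapsto(v_1,0)$ (for $k=1$, $(v_0,v_1)\mapsto v_1$). Restrictions are double traces: from $T$ to a cell $T'$ in its boundary, $u\mapsto(\mathrm{tr}_{T'}u,\mathrm{tr}_{T'}\mathrm d u)$ for $k=0,1$ and $u\mapsto\mathrm{tr}_{T'}u$ for $k=2$; from $E$ to a vertex $V$ of $E$, evaluation of all components at $V$. The maps $\mathbb R\to A^0$ are inclusion of constants ($c\mapsto (c,0)$ on edges and vertices). Evaluation on a $k$-cell is integration of the pullback of the $k$-form component ($v_0$ for pairs; the value of $v_0$ at a vertex). $A^k(\partial T)$ is the space of families $(u_{T'})$, indexed by the edges and vertices $T'$ of $T$, with $u_{T'}\in A^k(T')$, such that $u_V$ is the restriction of $u_E$ for each vertex $V$ of each edge $E$; similarly $A^k(\partial E)$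 is the direct sum of $A^k(V)$ over the two endpoints $V$ of $E$. $A$ is compatible if for each cell $T'$ (the triangle $T$, its edges, its vertices): (i) the restriction $A^k(T')\to A^k(\partial T')$ is surjective for each $k$, and (ii) the sequence $0\to\mathbb R\to A^0(T')\to A^1(T')\to A^2(T')\to0$ is exact. *)

theory Defs
  imports "HOL-Analysis.Analysis"
begin

section \<open>Alternating forms and fields of forms\<close>

text \<open>A \<open>k\<close>-linear form takes the list of its \<open>k\<close> arguments and is \<open>0\<close> on lists of any
  other length, so that the forms of all degrees share one type.\<close>

type_synonym 'v form = "'v list \<Rightarrow> real"
type_synonym 'v field = "'v \<Rightarrow> 'v form"

definition Alt :: "nat \<Rightarrow> 'v::real_vector form set" where
  "Alt k = {\<omega>. (\<forall>vs. length vs \<noteq> k \<longrightarrow> \<omega> vs = 0) \<and>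
               (\<forall>vs i. length vs = k \<longrightarrow> i < k \<longrightarrow> linear (\<lambda>x. \<omega> (vs[i := x]))) \<and>
               (\<forall>vs. \<not> distinct vs \<longrightarrow> \<omega> vs = 0)}"

definition zero_form :: "'v form" where
  "zero_form = (\<lambda>_. 0)"

definition zero_field :: "'v field" where
  "zero_field = (\<lambda>_. zero_form)"

definition scalar :: "real \<Rightarrow> 'v form" where
  "scalar c = (\<lambda>vs. if vs = [] then c else 0)"

text \<open>The trace keeps the action on all vectors. Fields on \<open>S\<close> are normalised to vanish off \<open>S\<close>,
  so that equality of fields on \<open>S\<close> is equality of functions.\<close>

definition tr :: "'v set \<Rightarrow> 'v field \<Rightarrow> 'v field" where
  "tr S u = (\<lambda>x. if x \<in> S then u x else zero_form)"

definition fields_on :: "'v::real_vector set \<Rightarrow> nat \<Rightarrow> 'v field set" where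
  "fields_on S k = {u. (\<forall>x\<in>S. u x \<in> Alt k) \<and> (\<forall>x. x \<notin> S \<longrightarrow> u x = zero_form)}"

definition continuous_field_on :: "'v::real_normed_vector set \<Rightarrow> 'v field \<Rightarrow> bool" where
  "continuous_field_on S u \<longleftrightarrow> (\<forall>vs. continuous_on S (\<lambda>x. u x vs))"

inductive poly_deg_le :: "nat \<Rightarrow> ('v::real_normed_vector \<Rightarrow> real) \<Rightarrow> bool" where
  const: "poly_deg_le q (\<lambda>_. c)"
| add: "poly_deg_le q f \<Longrightarrow> poly_deg_le q g \<Longrightarrow> poly_deg_le q (\<lambda>x. f x + g x)"
| mult: "bounded_linear l \<Longrightarrow> poly_deg_le q f \<Longrightarrow> poly_deg_le (Suc q) (\<lambda>x. l x * f x)"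

definition poly_field_on :: "nat \<Rightarrow> 'v::real_normed_vector set \<Rightarrow> 'v field \<Rightarrow> bool" where
  "poly_field_on q S u \<longleftrightarrow> (\<forall>vs. \<exists>g. poly_deg_le q g \<and> (\<forall>x\<in>S. u x vs = g x))"

text \<open>\<open>P\<^sup>q(S) \<otimes> Alt\<^sup>k(V)\<close>\<close>

definition poly_fields :: "nat \<Rightarrow> 'v::real_normed_vector set \<Rightarrow> nat \<Rightarrow> 'v field set" where
  "poly_fields q S k = {u \<in> fields_on S k. poly_field_on q S u}"


section \<open>Exterior derivative\<close>

definition tangent :: "'v::real_vector set \<Rightarrow> 'v set" where
  "tangent S = span {x - y | x y. x \<in> S \<and> y \<in> S}"

definition omit :: "nat \<Rightarrow> 'a list \<Rightarrow> 'a list" where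
  "omit i vs = take i vs @ drop (Suc i) vs"

text \<open>Admissibility on a cell \<open>S\<close>: \<open>d (pu\<^sub>S v\<^sub>0) = pu\<^sub>S v\<^sub>1\<close>, where
  \<open>(d u)(w\<^sub>0,\<dots>,w\<^sub>k) = \<Sum>\<^sub>i (-1)\<^sup>i D\<^bsub>w\<^sub>i\<^esub> (u(w\<^sub>0,\<dots>,w\<^sub>i omitted,\<dots>,w\<^sub>k))\<close>.
  Only vectors tangent to \<open>S\<close> are inserted; on those the derivative within a nondegenerate convex
  cell \<open>S\<close> is unique, although as a linear map on the whole space it need not be.
  For \<open>S\<close> of full dimension this says \<open>d v\<^sub>0 = v\<^sub>1\<close> on \<open>S\<close>.\<close>

definition admissible :: "'v::real_normed_vector set \<Rightarrow> 'v field \<Rightarrow> 'v field \<Rightarrow> bool" where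
  "admissible S v0 v1 \<longleftrightarrow>
     (\<forall>x\<in>S. \<exists>D.
        (\<forall>ws. set ws \<subseteq> tangent S \<longrightarrow> ((\<lambda>y. v0 y ws) has_derivative D ws) (at x within S)) \<and>
        (\<forall>vs. set vs \<subseteq> tangent S \<longrightarrow>
           v1 x vs = (\<Sum>i<length vs. (-1) ^ i * D (omit i vs) (vs ! i))))"


section \<open>The triangle and its split\<close>

text \<open>The triangle is given by the set \<open>V\<close> of its three vertices; an edge is given by the set of
  its two endpoints.\<close>

abbreviation cell :: "'v::real_vector set \<Rightarrow> 'v set" where
  "cell \<sigma> \<equiv> convex hull \<sigma>"

definition edges :: "'v set \<Rightarrow> 'v set set" where
  "edges V = {e. e \<subseteq> V \<and> card e = 2}"

definition split :: "'v::real_vector set \<Rightarrow> 'v \<Rightarrow> 'v set set" where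
  "split V W = {convex hull (insert W e) | e. e \<in> edges V}"

text \<open>The exterior derivative of a continuous piecewise polynomial form is taken on each small
  triangle; by the continuity of the form this is also its distributional exterior derivative.
  The following says that it is given by the continuous form \<open>w\<close>.\<close>

definition is_ext_deriv :: "'v::real_normed_vector set \<Rightarrow> 'v \<Rightarrow> 'v field \<Rightarrow> 'v field \<Rightarrow> bool" where
  "is_ext_deriv V W u w \<longleftrightarrow>
     continuous_field_on (cell V) w \<and> (\<forall>x. x \<notin> cell V \<longrightarrow> w x = zero_form) \<and>
     (\<forall>S\<in>split V W. admissible S u w)"

definition ext_deriv :: "'v::real_normed_vector set \<Rightarrow> 'v \<Rightarrow> 'v field \<Rightarrow> 'v field" where
  "ext_deriv V W u = (THE w. is_ext_deriv V W u w)"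

definition C1_on :: "'v::real_normed_vector set \<Rightarrow> ('v \<Rightarrow> real) \<Rightarrow> bool" where
  "C1_on S f \<longleftrightarrow>
     (\<exists>f' :: 'v \<Rightarrow> 'v \<Rightarrow>\<^sub>L real. continuous_on S f' \<and>
        (\<forall>x\<in>S. (f has_derivative blinfun_apply (f' x)) (at x within S)))"


section \<open>The finite element system\<close>

text \<open>The degree \<open>k\<close> is meant to be \<open>0\<close>, \<open>1\<close> or \<open>2\<close>. For \<open>k = 2\<close> the single component on an edge
  or a vertex is paired with \<open>0\<close>, the only \<open>3\<close>-form.\<close>

definition A_tri :: "nat \<Rightarrow> 'v::real_normed_vector set \<Rightarrow> 'v \<Rightarrow> nat \<Rightarrow> 'v field set" where
  "A_tri p V W k =
     {u \<in> fields_on (cell V) k.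
        (\<forall>S\<in>split V W. poly_field_on (p - k) S u) \<and>
        (if k = 0 then C1_on (cell V) (\<lambda>x. u x [])
         else if k = 1 then continuous_field_on (cell V) u \<and> (\<exists>w. is_ext_deriv V W u w)
         else continuous_field_on (cell V) u)}"

definition A_edge ::
    "nat \<Rightarrow> 'v::real_normed_vector set \<Rightarrow> nat \<Rightarrow> ('v field \<times> 'v field) set" where
  "A_edge p e k =
     (if k = 0 then {(v0, v1). v0 \<in> poly_fields p (cell e) 0 \<and>
                               v1 \<in> poly_fields (p - 1) (cell e) 1 \<and>
                               admissible (cell e) v0 v1}
      else if k = 1 then poly_fields (p - 1) (cell e) 1 \<times> poly_fields (p - 2) (cell e) 2
      else poly_fields (p - 2) (cell e) 2 \<times> {zero_field})"

definition A_vert :: "nat \<Rightarrow> ('v::real_vector form \<times> 'v form) set" where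
  "A_vert k = (if k = 0 then Alt 0 \<times> Alt 1
               else if k = 1 then Alt 1 \<times> Alt 2
               else Alt 2 \<times> {zero_form})"

definition d_edge :: "'v field \<times> 'v field \<Rightarrow> 'v field \<times> 'v field" where
  "d_edge = (\<lambda>(v0, v1). (v1, zero_field))"

definition d_vert :: "'v form \<times> 'v form \<Rightarrow> 'v form \<times> 'v form" where
  "d_vert = (\<lambda>(v0, v1). (v1, zero_form))"

definition incl_tri :: "'v::real_vector set \<Rightarrow> real \<Rightarrow> 'v field" where
  "incl_tri V c = tr (cell V) (\<lambda>_. scalar c)"

definition incl_edge :: "'v::real_vector set \<Rightarrow> real \<Rightarrow> 'v field \<times> 'v field" where
  "incl_edge e c = (tr (cell e) (\<lambda>_. scalar c), zero_field)"

definition incl_vert :: "real \<Rightarrow> 'v form \<times> 'v form" where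
  "incl_vert c = (scalar c, zero_form)"

definition res_tri_edge ::
    "'v::real_normed_vector set \<Rightarrow> 'v \<Rightarrow> nat \<Rightarrow> 'v set \<Rightarrow> 'v field \<Rightarrow> 'v field \<times> 'v field" where
  "res_tri_edge V W k e u =
     (tr (cell e) u, if k \<le> 1 then tr (cell e) (ext_deriv V W u) else zero_field)"

definition res_tri_vert ::
    "'v::real_normed_vector set \<Rightarrow> 'v \<Rightarrow> nat \<Rightarrow> 'v \<Rightarrow> 'v field \<Rightarrow> 'v form \<times> 'v form" where
  "res_tri_vert V W k v u = (u v, if k \<le> 1 then ext_deriv V W u v else zero_form)"

definition res_edge_vert :: "'v \<Rightarrow> 'v field \<times> 'v field \<Rightarrow> 'v form \<times> 'v form" where
  "res_edge_vert v = (\<lambda>(u0, u1). (u0 v, u1 v))"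

definition A_bd_tri ::
    "nat \<Rightarrow> 'v::real_normed_vector set \<Rightarrow> nat \<Rightarrow>
     (('v set \<Rightarrow> 'v field \<times> 'v field) \<times> ('v \<Rightarrow> 'v form \<times> 'v form)) set" where
  "A_bd_tri p V k =
     {(f, g). f \<in> (\<Pi>\<^sub>E e\<in>edges V. A_edge p e k) \<and> g \<in> (\<Pi>\<^sub>E v\<in>V. A_vert k) \<and>
              (\<forall>e\<in>edges V. \<forall>v\<in>e. g v = res_edge_vert v (f e))}"

definition res_bd_tri ::
    "'v::real_normed_vector set \<Rightarrow> 'v \<Rightarrow> nat \<Rightarrow> 'v field \<Rightarrow>
     ('v set \<Rightarrow> 'v field \<times> 'v field) \<times> ('v \<Rightarrow> 'v form \<times> 'v form)" where
  "res_bd_tri V W k u =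
     (\<lambda>e\<in>edges V. res_tri_edge V W k e u, \<lambda>v\<in>V. res_tri_vert V W k v u)"

definition A_bd_edge :: "'v::real_vector set \<Rightarrow> nat \<Rightarrow> ('v \<Rightarrow> 'v form \<times> 'v form) set" where
  "A_bd_edge e k = (\<Pi>\<^sub>E v\<in>e. A_vert k)"

definition res_bd_edge :: "'v set \<Rightarrow> 'v field \<times> 'v field \<Rightarrow> 'v \<Rightarrow> 'v form \<times> 'v form" where
  "res_bd_edge e u = (\<lambda>v\<in>e. res_edge_vert v u)"


section \<open>Extension and compatibility\<close>

definition admits_extensions :: "nat \<Rightarrow> 'v::real_normed_vector set \<Rightarrow> 'v \<Rightarrow> bool" where
  "admits_extensions p V W \<longleftrightarrow>
     (\<forall>k\<in>{0, 1, 2}. res_bd_tri V W k ` A_tri p V W k = A_bd_tri p V k)"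

text \<open>Exactness of \<open>0 \<rightarrow> \<real> \<rightarrow> A 0 \<rightarrow> A 1 \<rightarrow> A 2 \<rightarrow> 0\<close>, with zero element \<open>z\<close>.\<close>

definition exact_sequence ::
    "'x \<Rightarrow> (real \<Rightarrow> 'x) \<Rightarrow> ('x \<Rightarrow> 'x) \<Rightarrow> (nat \<Rightarrow> 'x set) \<Rightarrow> bool" where
  "exact_sequence z i d A \<longleftrightarrow>
     inj i \<and> range i = {u \<in> A 0. d u = z} \<and> d ` A 0 = {u \<in> A 1. d u = z} \<and> d ` A 1 = A 2"

text \<open>The boundary of a vertex is empty, so its boundary space is trivial.\<close>

definition compatible :: "nat \<Rightarrow> 'v::real_normed_vector set \<Rightarrow> 'v \<Rightarrow> bool" where
  "compatible p V W \<longleftrightarrow>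
     (\<forall>k\<in>{0, 1, 2}. res_bd_tri V W k ` A_tri p V W k = A_bd_tri p V k) \<and>
     exact_sequence zero_field (incl_tri V) (ext_deriv V W) (A_tri p V W) \<and>
     (\<forall>e\<in>edges V.
        (\<forall>k\<in>{0, 1, 2}. res_bd_edge e ` A_edge p e k = A_bd_edge e k) \<and>
        exact_sequence (zero_field, zero_field) (incl_edge e) d_edge (A_edge p e)) \<and>
     (\<forall>v\<in>V.
        (\<forall>k\<in>{0, 1, 2}. (\<lambda>u. \<lambda>_\<in>({} :: 'v set). u) ` (A_vert k :: ('v form \<times> 'v form) set)
                        = (\<Pi>\<^sub>E _\<in>{}. A_vert k)) \<and>
        exact_sequence (zero_form, zero_form) incl_vert d_vert
          (A_vert :: nat \<Rightarrow> ('v form \<times> 'v form) set))"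

end

theory Submission
  imports Defs
begin

text \<open>Exactness on the triangle comes from the Poincare homotopy centred at the split point \<open>W\<close>. A
  segment that starts at \<open>W\<close> never leaves its small triangle, so averaging along these segments maps
  piecewise polynomials to piecewise polynomials and keeps continuity across the interior edges. A
  closed \<open>1\<close>-form therefore has the potential \<open>potential\<close>, and every \<open>2\<close>-form is the derivative of its
  Koszul image \<open>koszul\<close>. On an edge the same average gives an antiderivative.

  Surjectivity onto the boundary data rests on the hat function \<open>\<ell>\<close> of \<open>W\<close>: it is continuous, affine
  on each small triangle (\<open>gam c\<close> on the one opposite the vertex \<open>c\<close>), \<open>1\<close> at \<open>W\<close> and \<open>0\<close> on the
  boundary. Boundary polynomials extend homogeneously about \<open>W\<close>, and such an extension is continuous
  as soon as the data agree at the vertices; this settles \<open>k = 2\<close>. For \<open>k = 0\<close> and \<open>k = 1\<close> a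
  homogeneous extension has the right trace but a derivative that jumps across the interior edges.
  The jump is removed by adding powers of \<open>\<ell>\<close> times lower order terms. Since
  \<open>d (\<ell>\<^sup>j z) = \<ell>\<^bsup>j-1\<^esup> (j d\<ell> \<and> z + \<ell> dz)\<close>, all that is required is to choose, for given piecewise
  polynomial \<open>S\<close> of degree \<open>m\<close>, a continuous \<open>z\<close> of degree \<open>m\<close> for which
  \<open>S - j d\<ell> \<and> z - \<ell> dz\<close> has no jump. One fixes \<open>z\<close> on the boundary, for functions only
  at the vertices, so that the remainder is, up to a continuous summand, divisible by \<open>\<ell>\<close>; the
  quotient has degree \<open>m - 1\<close> and faces the same problem with \<open>j + 1\<close>. The recursion ends with piecewise constants, where three numbers have to be matched:
  for \<open>2\<close>-forms a constant vector does it (\<open>div_correction\<close>); for gradients the jumps around \<open>W\<close>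
  add up to zero, which makes them multiples of the jumps of \<open>d\<ell>\<close> (\<open>grad_correction\<close>).
  \<open>curl_extension\<close> and \<open>grad_extension\<close> turn this into the two extension results.

  The bound \<open>p \<ge> 3\<close> enters for \<open>k = 1\<close>, where the correction must vanish on the boundary, which is
  possible when the coefficient of the \<open>2\<close>-form has degree \<open>p - 2 \<ge> 1\<close>, and on an edge, where a cubic
  interpolates values and gradients at both endpoints.\<close>


section \<open>Polynomial functions\<close>

lemma poly_deg_le_mono:
  assumes "poly_deg_le q f" "q \<le> r"
  shows "poly_deg_le r f"
proof -
  have *: "poly_deg_le (Suc q) f" if "poly_deg_le q f" for q and f :: "'a \<Rightarrow> real"
    using that by induction (auto intro: poly_deg_le.intros)
  show ?thesis
    using assms(2,1) by (induction rule: dec_induct) (auto intro: *)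
qed

lemma poly_deg_le_cmult:
  assumes "poly_deg_le q f"
  shows "poly_deg_le q (\<lambda>x. c * f x)"
  using assms
proof induction
  case (mult l q f)
  then show ?case
    using poly_deg_le.mult[OF mult(1,3)] by (simp add: mult.left_commute)
qed (auto intro: poly_deg_le.intros simp: distrib_left)

lemma poly_deg_le_mult:
  assumes "poly_deg_le q f" "poly_deg_le r g"
  shows "poly_deg_le (q + r) (\<lambda>x. f x * g x)"
  using assms(1)
proof induction
  case (const q c)
  then show ?case
    using poly_deg_le_mono[OF poly_deg_le_cmult[OF assms(2)]] by simp
next
  case (mult l q f)
  then show ?case
    using poly_deg_le.mult[OF mult(1,3)] by (simp add: mult.assoc)
qed (auto intro: poly_deg_le.intros simp: distrib_right)

lemma poly_deg_le_power:
  assumes "poly_deg_le q f"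
  shows "poly_deg_le (n * q) (\<lambda>x. f x ^ n)"
proof (induction n)
  case 0
  show ?case using poly_deg_le.const[of 0 1] by simp
next
  case (Suc n)
  show ?case
    using poly_deg_le_mult[OF assms Suc.IH] by simp
qed

lemma poly_deg_le_diff:
  assumes "poly_deg_le q f" "poly_deg_le q g"
  shows "poly_deg_le q (\<lambda>x. f x - g x)"
  using poly_deg_le.add[OF assms(1) poly_deg_le_cmult[OF assms(2), of "-1"]] by simp

lemma poly_deg_le_sum:
  assumes "\<And>i. i \<in> I \<Longrightarrow> poly_deg_le q (f i)"
  shows "poly_deg_le q (\<lambda>x. \<Sum>i\<in>I. f i x)"
proof (cases "finite I")
  case True
  then show ?thesis using assms
    by (induction rule: finite_induct) (auto intro: poly_deg_le.intros)
qed (auto intro: poly_deg_le.intros)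

lemma poly_deg_le_linear:
  assumes "bounded_linear l"
  shows "poly_deg_le (Suc q) l"
  using poly_deg_le.mult[OF assms poly_deg_le.const[of q 1]] by simp

lemma poly_deg_le_affine:
  fixes a :: "'v::euclidean_space"
  shows "poly_deg_le (Suc q) (\<lambda>x. c + a \<bullet> (x - b))"
proof -
  have "poly_deg_le (Suc q) (\<lambda>x. (c - a \<bullet> b) + a \<bullet> x)"
    by (intro poly_deg_le.add poly_deg_le.const poly_deg_le_linear bounded_linear_inner_right)
  then show ?thesis by (simp add: inner_diff_right algebra_simps)
qed

lemma poly_deg_le_0D:
  assumes "poly_deg_le 0 f"
  obtains c where "f = (\<lambda>_. c)"
proof -
  have "q = 0 \<Longrightarrow> \<exists>c. f = (\<lambda>_. c)" if "poly_deg_le q f" for q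
    using that by induction auto
  then show ?thesis using assms that by blast
qed

definition vpoly :: "nat \<Rightarrow> ('v::euclidean_space \<Rightarrow> 'b::euclidean_space) \<Rightarrow> bool" where
  "vpoly q f \<longleftrightarrow> (\<forall>i\<in>Basis. poly_deg_le q (\<lambda>x. f x \<bullet> i))"

lemma vpoly_real [simp]: "vpoly q f \<longleftrightarrow> poly_deg_le q f" for f :: "'v::euclidean_space \<Rightarrow> real"
  by (simp add: vpoly_def)

lemma vpoly_linear_image:
  fixes f :: "'v::euclidean_space \<Rightarrow> 'b::euclidean_space" and l :: "'b \<Rightarrow> 'c::euclidean_space"
  assumes f: "vpoly q f" and l: "linear l"
  shows "vpoly q (\<lambda>x. l (f x))"
proof -
  have "l (f x) = (\<Sum>i\<in>Basis. (f x \<bullet> i) *\<^sub>R l i)" for x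
    by (subst (1) euclidean_representation[of "f x", symmetric])
       (simp add: linear_sum[OF l] linear_scale[OF l])
  then have *: "l (f x) \<bullet> j = (\<Sum>i\<in>Basis. (l i \<bullet> j) * (f x \<bullet> i))" for x j
    by (simp add: inner_sum_left mult.commute)
  show ?thesis
    using f by (auto simp: vpoly_def * intro!: poly_deg_le_sum poly_deg_le_cmult)
qed

lemma vpoly_inner: "vpoly q f \<Longrightarrow> poly_deg_le q (\<lambda>x. f x \<bullet> v)"
  using vpoly_linear_image[of q f "\<lambda>y. y \<bullet> v"]
  by (simp add: bounded_linear.linear bounded_linear_inner_left)

lemma vpoly_inner': "vpoly q f \<Longrightarrow> poly_deg_le q (\<lambda>x. v \<bullet> f x)"
  using vpoly_inner[of q f v] by (simp add: inner_commute)

lemma vpoly_const: "vpoly q (\<lambda>_. c)"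
  by (simp add: vpoly_def poly_deg_le.const)

lemma vpoly_add: "vpoly q f \<Longrightarrow> vpoly q g \<Longrightarrow> vpoly q (\<lambda>x. f x + g x)"
  by (simp add: vpoly_def inner_add_left poly_deg_le.add)

lemma vpoly_diff: "vpoly q f \<Longrightarrow> vpoly q g \<Longrightarrow> vpoly q (\<lambda>x. f x - g x)"
  by (simp add: vpoly_def inner_diff_left poly_deg_le_diff)

lemma vpoly_scaleR:
  "poly_deg_le q f \<Longrightarrow> vpoly r g \<Longrightarrow> vpoly (q + r) (\<lambda>x. f x *\<^sub>R g x)"
  by (simp add: vpoly_def poly_deg_le_mult)

lemma vpoly_scaleR_const: "poly_deg_le q f \<Longrightarrow> vpoly q (\<lambda>x. f x *\<^sub>R c)"
  using vpoly_scaleR[of q f 0] vpoly_const[of 0 c] by simp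

lemma vpoly_sum: "(\<And>i. i \<in> I \<Longrightarrow> vpoly q (f i)) \<Longrightarrow> vpoly q (\<lambda>x. \<Sum>i\<in>I. f i x)"
  by (simp add: vpoly_def inner_sum_left poly_deg_le_sum)

lemma vpoly_mono: "vpoly q f \<Longrightarrow> q \<le> r \<Longrightarrow> vpoly r f"
  using poly_deg_le_mono by (auto simp: vpoly_def)

lemma vpoly_0D:
  assumes "vpoly 0 f"
  shows "f x = f y"
proof (rule euclidean_eqI)
  fix i :: 'b assume "i \<in> Basis"
  then show "f x \<bullet> i = f y \<bullet> i"
    using assms poly_deg_le_0D[of "\<lambda>x. f x \<bullet> i"] unfolding vpoly_def by metis
qed


section \<open>Gradient, divergence and the radial average\<close>

lemma bounded_linear_eq_inner:
  fixes l :: "'v::euclidean_space \<Rightarrow> real"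
  assumes "bounded_linear l"
  shows "\<exists>a. l = (\<lambda>x. a \<bullet> x)"
proof
  have "l x = (\<Sum>i\<in>Basis. l i *\<^sub>R i) \<bullet> x" for x
    unfolding inner_sum_left
    by (subst (1) euclidean_representation[of x, symmetric])
       (simp add: linear_sum[OF bounded_linear.linear[OF assms]]
          linear_scale[OF bounded_linear.linear[OF assms]] inner_commute mult.commute)
  then show "l = (\<lambda>x. (\<Sum>i\<in>Basis. l i *\<^sub>R i) \<bullet> x)" ..
qed

definition grad :: "('v::euclidean_space \<Rightarrow> real) \<Rightarrow> 'v \<Rightarrow> 'v" where
  "grad f x = (\<Sum>i\<in>Basis. frechet_derivative f (at x) i *\<^sub>R i)"

lemma grad_eqI:
  assumes "(f has_derivative (\<lambda>v. y \<bullet> v)) (at x)"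
  shows "grad f x = y"
proof -
  have "frechet_derivative f (at x) = (\<lambda>v. y \<bullet> v)"
    using assms frechet_derivative_at by metis
  then show ?thesis
    by (simp add: grad_def euclidean_representation)
qed

lemma has_derivative_grad:
  assumes "f differentiable (at x)"
  shows "(f has_derivative (\<lambda>v. grad f x \<bullet> v)) (at x)"
proof -
  let ?D = "frechet_derivative f (at x)"
  have D: "(f has_derivative ?D) (at x)"
    using assms by (simp add: frechet_derivative_works)
  then have "linear ?D" by (rule has_derivative_linear)
  then have "?D v = grad f x \<bullet> v" for v
    unfolding grad_def inner_sum_left
    by (subst (1) euclidean_representation[of v, symmetric])
       (simp add: linear_sum linear_scale inner_commute mult.commute)
  then have "?D = (\<lambda>v. grad f x \<bullet> v)" by auto
  with D show ?thesis by metis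
qed

lemma poly_differentiable:
  assumes "poly_deg_le q f"
  shows "f differentiable (at x)"
  using assms
  by induction (auto intro!: differentiable_mult simp: bounded_linear_imp_differentiable)

lemmas poly_has_derivative = has_derivative_grad[OF poly_differentiable]

lemma poly_continuous_on: "poly_deg_le q f \<Longrightarrow> continuous_on S f"
  by (meson continuous_at_imp_continuous_on differentiable_imp_continuous_within
      poly_differentiable)

lemma vpoly_continuous_on: "vpoly q f \<Longrightarrow> continuous_on S f"
  unfolding vpoly_def
  by (subst continuous_on_componentwise) (auto intro: poly_continuous_on)

lemma grad_const: "grad (\<lambda>_. c) x = 0"
  by (rule grad_eqI) simp

lemma grad_affine: "grad (\<lambda>x. c + a \<bullet> (x - b)) x = a"
  by (rule grad_eqI) (auto intro!: derivative_eq_intros)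

lemma grad_inner: "grad (\<lambda>x. a \<bullet> x) x = a"
  by (rule grad_eqI) (auto intro!: derivative_eq_intros)

lemma grad_add:
  assumes "poly_deg_le q f" "poly_deg_le r g"
  shows "grad (\<lambda>x. f x + g x) x = grad f x + grad g x"
  by (rule grad_eqI)
     (auto intro!: derivative_eq_intros poly_has_derivative assms simp: inner_add_left)

lemma grad_diff:
  assumes "poly_deg_le q f" "poly_deg_le r g"
  shows "grad (\<lambda>x. f x - g x) x = grad f x - grad g x"
  by (rule grad_eqI)
     (auto intro!: derivative_eq_intros poly_has_derivative assms simp: inner_diff_left)

lemma grad_mult:
  assumes "poly_deg_le q f" "poly_deg_le r g"
  shows "grad (\<lambda>x. f x * g x) x = f x *\<^sub>R grad g x + g x *\<^sub>R grad f x"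
  by (rule grad_eqI)
     (auto intro!: derivative_eq_intros poly_has_derivative assms simp: inner_add_left)

lemma grad_cmult:
  assumes "poly_deg_le q f"
  shows "grad (\<lambda>x. c * f x) x = c *\<^sub>R grad f x"
  using grad_mult[OF poly_deg_le.const[of 0 c] assms] by (simp add: grad_const)

lemma vpoly_grad:
  assumes "poly_deg_le q f"
  shows "vpoly (q - 1) (grad f)"
  using assms
proof induction
  case (const q c)
  then show ?case by (simp add: grad_const[abs_def] vpoly_const)
next
  case (add q f g)
  then show ?case by (simp add: grad_add[OF add(1,2), abs_def] vpoly_add)
next
  case (mult l q f)
  obtain a where l: "l = (\<lambda>x. a \<bullet> x)"
    using bounded_linear_eq_inner[OF mult(1)] by blast
  have "vpoly q (\<lambda>x. l x *\<^sub>R grad f x)"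
  proof (cases q)
    case 0
    then have "grad f = (\<lambda>_. 0)"
      using mult(2) poly_deg_le_0D[of f] by (metis grad_const ext)
    then show ?thesis by (simp add: vpoly_const)
  next
    case (Suc r)
    then show ?thesis
      using vpoly_scaleR[OF poly_deg_le_linear[OF mult(1), of 0] mult(3)] by simp
  qed
  moreover have "vpoly q (\<lambda>x. f x *\<^sub>R grad l x)"
    unfolding l grad_inner using mult(2) by (rule vpoly_scaleR_const)
  ultimately show ?case
    using vpoly_add
    by (simp add: grad_mult[OF poly_deg_le_linear[OF mult(1), of 0] mult(2), abs_def])
qed

lemma poly_grad: "poly_deg_le q f \<Longrightarrow> poly_deg_le (q - 1) (\<lambda>x. grad f x \<bullet> v)"
  by (intro vpoly_inner vpoly_grad)

lemma grad_grad_commute: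
  assumes "poly_deg_le q f"
  shows "grad (\<lambda>x. grad f x \<bullet> v) x \<bullet> u = grad (\<lambda>x. grad f x \<bullet> u) x \<bullet> v"
  using assms
proof induction
  case (const q c)
  then show ?case by (simp add: grad_const)
next
  case (add q f g)
  then show ?case
    by (simp add: grad_add[OF add(1,2)] inner_add_left grad_add[OF poly_grad poly_grad])
next
  case (mult l q f)
  obtain a where l: "l = (\<lambda>x. a \<bullet> x)"
    using bounded_linear_eq_inner[OF mult(1)] by blast
  note pl = poly_deg_le_linear[OF mult(1), of 0]
  have gl: "grad l x = a" for x
    by (simp add: l grad_inner)
  have g: "grad (\<lambda>x. grad (\<lambda>x. l x * f x) x \<bullet> v) x
     = l x *\<^sub>R grad (\<lambda>x. grad f x \<bullet> v) x + (grad f x \<bullet> v) *\<^sub>R a + (a \<bullet> v) *\<^sub>R grad f x" for v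
  proof -
    have e: "(\<lambda>x. grad (\<lambda>x. l x * f x) x \<bullet> v) = (\<lambda>x. l x * (grad f x \<bullet> v) + (a \<bullet> v) * f x)"
      by (simp add: grad_mult[OF pl mult(2)] inner_add_left gl, simp add: mult.commute)
    show ?thesis
      unfolding e
      by (subst grad_add[OF poly_deg_le_mult[OF pl poly_grad] poly_deg_le_cmult])
         (auto simp: grad_mult[OF pl poly_grad[OF mult(2)]] grad_cmult[OF mult(2)] gl
            intro: mult(2))
  qed
  show ?case unfolding g by (simp add: inner_add_left mult.IH)
qed

definition divergence :: "('v::euclidean_space \<Rightarrow> 'v) \<Rightarrow> 'v \<Rightarrow> real" where
  "divergence Z x = (\<Sum>i\<in>Basis. grad (\<lambda>x. Z x \<bullet> i) x \<bullet> i)"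

lemma poly_divergence: "vpoly q Z \<Longrightarrow> poly_deg_le (q - 1) (divergence Z)"
  unfolding divergence_def[abs_def] by (intro poly_deg_le_sum poly_grad vpoly_inner)

lemma divergence_const: "divergence (\<lambda>_. c) x = 0"
  by (simp add: divergence_def grad_const)

lemma divergence_add:
  assumes "vpoly q Y" "vpoly r Z"
  shows "divergence (\<lambda>x. Y x + Z x) x = divergence Y x + divergence Z x"
  by (simp add: divergence_def inner_add_left grad_add[OF vpoly_inner[OF assms(1)] vpoly_inner[OF assms(2)]]
      sum.distrib)

lemma divergence_scaleR:
  assumes "poly_deg_le q f" "vpoly r Z"
  shows "divergence (\<lambda>x. f x *\<^sub>R Z x) x = f x * divergence Z x + grad f x \<bullet> Z x"
proof -
  have "(\<Sum>i\<in>Basis. (Z x \<bullet> i) * (grad f x \<bullet> i)) = grad f x \<bullet> Z x"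
    by (subst euclidean_inner) (simp add: mult.commute)
  then show ?thesis
    by (simp add: divergence_def grad_mult[OF assms(1) vpoly_inner[OF assms(2)]] inner_add_left
        sum.distrib sum_distrib_left)
qed

text \<open>The building block of the Poincare homotopy with centre \<open>W\<close>.\<close>

definition radial_mean :: "'v::euclidean_space \<Rightarrow> nat \<Rightarrow> ('v \<Rightarrow> real) \<Rightarrow> 'v \<Rightarrow> real" where
  "radial_mean W k f x = integral {0..1} (\<lambda>t. t ^ k * f (W + t *\<^sub>R (x - W)))"

lemma radial_mean_cong:
  assumes "\<And>t. 0 \<le> t \<Longrightarrow> t \<le> 1 \<Longrightarrow> f (W + t *\<^sub>R (x - W)) = g (W + t *\<^sub>R (y - W))"
  shows "radial_mean W k f x = radial_mean W k g y"
  unfolding radial_mean_def by (rule integral_cong) (use assms in auto)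

lemma radial_mean_integrable:
  assumes "poly_deg_le q f"
  shows "(\<lambda>t. t ^ k * f (W + t *\<^sub>R (x - W))) integrable_on {0..1::real}"
proof (rule integrable_continuous_real)
  have "continuous_on {0..1::real} (\<lambda>t. f (W + t *\<^sub>R (x - W)))"
    by (rule continuous_on_compose2[OF poly_continuous_on[OF assms, of UNIV]])
       (auto intro!: continuous_intros)
  then show "continuous_on {0..1} (\<lambda>t. t ^ k * f (W + t *\<^sub>R (x - W)))"
    by (intro continuous_intros)
qed

lemma radial_mean_const: "radial_mean W k (\<lambda>_. c) x = c / (real k + 1)"
proof -
  have "((\<lambda>t. t ^ k * c) has_integral
          (1 ^ Suc k / real (Suc k) * c - 0 ^ Suc k / real (Suc k) * c)) {0..1::real}"
    by (rule fundamental_theorem_of_calculus)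
       (auto intro!: derivative_eq_intros simp: has_real_derivative_iff_has_vector_derivative[symmetric]
          divide_simps simp del: power_Suc)
  then have "integral {0..1} (\<lambda>t. t ^ k * c) = c / (real k + 1)"
    by (intro integral_unique) (simp add: add.commute)
  then show ?thesis
    by (simp only: radial_mean_def)
qed

lemma radial_mean_add:
  assumes "poly_deg_le q f" "poly_deg_le r g"
  shows "radial_mean W k (\<lambda>x. f x + g x) x = radial_mean W k f x + radial_mean W k g x"
  unfolding radial_mean_def distrib_left
  by (rule Henstock_Kurzweil_Integration.integral_add) (auto intro: radial_mean_integrable assms)

text \<open>Along the segment a linear \<open>l\<close> is \<open>l W + t l (x - W)\<close>, and the factor \<open>t\<close> raises the weight. With
  this recursion the facts below follow by induction over polynomials, for all weights at once and
  without differentiation under the integral.\<close>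

lemma radial_mean_mult:
  assumes "bounded_linear l" "poly_deg_le q f"
  shows "radial_mean W k (\<lambda>x. l x * f x) x = l W * radial_mean W k f x + l (x - W) * radial_mean W (Suc k) f x"
proof -
  interpret l: bounded_linear l by fact
  have "radial_mean W k (\<lambda>x. l x * f x) x =
     integral {0..1} (\<lambda>t. l W * (t ^ k * f (W + t *\<^sub>R (x - W)))
        + l (x - W) * (t ^ Suc k * f (W + t *\<^sub>R (x - W))))"
    unfolding radial_mean_def
    by (rule integral_cong) (simp only: l.add l.scaleR, simp add: distrib_left mult_ac)
  also have "\<dots> = l W * radial_mean W k f x + l (x - W) * radial_mean W (Suc k) f x"
    unfolding radial_mean_def
    by (subst Henstock_Kurzweil_Integration.integral_add)
       (auto intro!: integrable_on_mult_right radial_mean_integrable assms(2) simp del: power_Suc)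
  finally show ?thesis .
qed

lemma poly_radial_mean:
  assumes "poly_deg_le q f"
  shows "poly_deg_le q (radial_mean W k f)"
  using assms
proof (induction arbitrary: k)
  case (const q c)
  then show ?case by (simp add: radial_mean_const[abs_def] poly_deg_le.const)
next
  case (add q f g)
  then show ?case by (simp add: radial_mean_add[OF add(1,2), abs_def] poly_deg_le.add)
next
  case (mult l q f)
  interpret l: bounded_linear l by fact
  have "poly_deg_le (Suc q) (\<lambda>x. l W * radial_mean W k f x + (l x * radial_mean W (Suc k) f x
     - l W * radial_mean W (Suc k) f x))"
    by (intro poly_deg_le.add poly_deg_le_diff poly_deg_le.mult[OF mult(1)] mult.IH
         poly_deg_le_cmult poly_deg_le_mono[OF mult.IH]) auto
  then show ?case
    unfolding radial_mean_mult[OF mult(1,2), abs_def] by (simp add: l.diff right_diff_distrib' left_diff_distrib')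
qed

lemma grad_radial_mean:
  assumes "poly_deg_le q f"
  shows "grad (radial_mean W k f) x \<bullet> v = radial_mean W (Suc k) (\<lambda>x. grad f x \<bullet> v) x"
  using assms
proof (induction arbitrary: k)
  case (const q c)
  then show ?case by (simp add: radial_mean_const[abs_def] grad_const radial_mean_const)
next
  case (add q f g)
  show ?case
    by (simp add: radial_mean_add[OF add(1,2), abs_def] grad_add[OF add(1,2)] inner_add_left add.IH
       grad_add[OF poly_radial_mean[OF add(1)] poly_radial_mean[OF add(2)]]
       radial_mean_add[OF poly_grad[OF add(1)] poly_grad[OF add(2)]])
next
  case (mult l q f)
  obtain a where l: "l = (\<lambda>x. a \<bullet> x)"
    using bounded_linear_eq_inner[OF mult(1)] by blast
  note pl = poly_deg_le_linear[OF mult(1), of 0]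
  have gl: "grad l x = a" for x
    by (simp add: l grad_inner)
  have "(\<lambda>x. grad (\<lambda>x. l x * f x) x \<bullet> v) = (\<lambda>x. l x * (grad f x \<bullet> v) + (a \<bullet> v) * f x)"
    by (simp add: grad_mult[OF pl mult(2)] inner_add_left gl, simp add: mult.commute)
  moreover have cm: "radial_mean W k (\<lambda>x. c * f x) x = c * radial_mean W k f x" for c k
    unfolding radial_mean_def by (subst integral_mult_right[symmetric]) (simp add: mult.left_commute)
  ultimately have R: "radial_mean W (Suc k) (\<lambda>x. grad (\<lambda>x. l x * f x) x \<bullet> v) x =
     l W * radial_mean W (Suc k) (\<lambda>x. grad f x \<bullet> v) x
     + l (x - W) * radial_mean W (Suc (Suc k)) (\<lambda>x. grad f x \<bullet> v) x + (a \<bullet> v) * radial_mean W (Suc k) f x"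
    by (simp add: radial_mean_add[OF poly_deg_le.mult[OF mult(1) poly_grad[OF mult(2)]]
         poly_deg_le_cmult[OF mult(2)]] radial_mean_mult[OF mult(1) poly_grad[OF mult(2)]] cm)
  have pa: "poly_deg_le (Suc 0) (\<lambda>x. l (x - W))"
    using poly_deg_le_affine[of 0 0 a W] by (simp add: l)
  have ga: "grad (\<lambda>x. l (x - W)) x = a" for x
    using grad_affine[of 0 a W] by (simp add: l)
  have "grad (radial_mean W k (\<lambda>x. l x * f x)) x
      = l W *\<^sub>R grad (radial_mean W k f) x
        + (l (x - W) *\<^sub>R grad (radial_mean W (Suc k) f) x + radial_mean W (Suc k) f x *\<^sub>R a)"
    unfolding radial_mean_mult[OF mult(1,2), abs_def]
    by (simp add: grad_add[OF poly_deg_le_cmult[OF poly_radial_mean[OF mult(2)]]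
          poly_deg_le_mult[OF pa poly_radial_mean[OF mult(2)]]]
          grad_cmult[OF poly_radial_mean[OF mult(2)]] grad_mult[OF pa poly_radial_mean[OF mult(2)]] ga)
  then show ?case unfolding R by (simp add: inner_add_left mult.IH algebra_simps)
qed

text \<open>The integral of the derivative of \<open>t\<^bsup>k+1\<^esup> f (W + t (x - W))\<close> over \<open>t \<in> [0,1]\<close>.\<close>

lemma radial_mean_Euler:
  assumes "poly_deg_le q f"
  shows "(real k + 1) * radial_mean W k f x + grad (radial_mean W k f) x \<bullet> (x - W) = f x"
  using assms
proof (induction arbitrary: k)
  case (const q c)
  then show ?case by (simp add: radial_mean_const[abs_def] grad_const)
next
  case (add q f g)
  have "(real k + 1) * radial_mean W k f x + grad (radial_mean W k f) x \<bullet> (x - W)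
      + ((real k + 1) * radial_mean W k g x + grad (radial_mean W k g) x \<bullet> (x - W)) = f x + g x"
    by (simp add: add.IH)
  then show ?case
    by (simp add: radial_mean_add[OF add(1,2), abs_def] inner_add_left 
       grad_add[OF poly_radial_mean[OF add(1)] poly_radial_mean[OF add(2)]] algebra_simps)
next
  case (mult l q f)
  obtain a where l: "l = (\<lambda>x. a \<bullet> x)"
    using bounded_linear_eq_inner[OF mult(1)] by blast
  have pa: "poly_deg_le (Suc 0) (\<lambda>x. l (x - W))"
    using poly_deg_le_affine[of 0 0 a W] by (simp add: l)
  have ga: "grad (\<lambda>x. l (x - W)) x = a" for x
    using grad_affine[of 0 a W] by (simp add: l)
  have g: "grad (radial_mean W k (\<lambda>x. l x * f x)) x
      = l W *\<^sub>R grad (radial_mean W k f) x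
        + (l (x - W) *\<^sub>R grad (radial_mean W (Suc k) f) x + radial_mean W (Suc k) f x *\<^sub>R a)"
    unfolding radial_mean_mult[OF mult(1,2), abs_def]
    by (simp add: grad_add[OF poly_deg_le_cmult[OF poly_radial_mean[OF mult(2)]]
          poly_deg_le_mult[OF pa poly_radial_mean[OF mult(2)]]]
          grad_cmult[OF poly_radial_mean[OF mult(2)]] grad_mult[OF pa poly_radial_mean[OF mult(2)]] ga)
  have e1: "grad (radial_mean W k f) x \<bullet> (x - W) = f x - (real k + 1) * radial_mean W k f x"
    using mult.IH[of k] by simp
  have e2: "grad (radial_mean W (Suc k) f) x \<bullet> (x - W) = f x - (real k + 2) * radial_mean W (Suc k) f x"
    using mult.IH[of "Suc k"] by (simp add: algebra_simps)
  have e3: "a \<bullet> (x - W) = l (x - W)" "l x = l W + l (x - W)"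
    by (auto simp: l inner_diff_right)
  show ?case
    unfolding g unfolding radial_mean_mult[OF mult(1,2)] inner_add_left inner_scaleR_left e1 e2 e3
    by (simp add: algebra_simps)
qed


section \<open>Admissible pairs of polynomial forms\<close>

lemma derivative_within_segment_unique:
  fixes f :: "'v::real_normed_vector \<Rightarrow> real"
  assumes "convex S" "x \<in> S" "y \<in> S"
    and D: "(f has_derivative D) (at x within S)"
    and D': "(f has_derivative D') (at x within S)"
  shows "D (y - x) = D' (y - x)"
proof -
  let ?h = "\<lambda>t::real. x + t *\<^sub>R (y - x)"
  have im: "?h ` {0..1} \<subseteq> S"
  proof
    fix z assume "z \<in> ?h ` {0..1}"
    then obtain t where "t \<in> {0..1}" "z = (1 - t) *\<^sub>R x + t *\<^sub>R y"
      by (auto simp: algebra_simps)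
    then show "z \<in> S" using assms(1-3) by (auto simp: convex_alt)
  qed
  have h: "(?h has_derivative (\<lambda>t. t *\<^sub>R (y - x))) (at 0 within {0..1})"
    by (auto intro!: derivative_eq_intros)
  have *: "((\<lambda>t. f (?h t)) has_vector_derivative E (y - x)) (at 0 within {0..1})"
    if E: "(f has_derivative E) (at x within S)" for E
  proof -
    have "(f has_derivative E) (at (?h 0) within ?h ` {0..1})"
      using has_derivative_subset[OF E im] by simp
    from has_derivative_in_compose[OF h this]
    show ?thesis
      using linear_scale[OF has_derivative_linear[OF E]]
      by (simp add: has_vector_derivative_def)
  qed
  show ?thesis
    by (rule vector_derivative_unique_within_closed_interval[of 0 1 0])
       (use *[OF D] *[OF D'] in auto)
qed

text \<open>Inside a convex set one can move from \<open>x\<close> towards every other point, and this fixes the derivative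
  on the span of these directions, which is the tangent space; on an edge it fixes nothing more.\<close>

lemma derivative_within_tangent_unique:
  fixes f :: "'v::real_normed_vector \<Rightarrow> real"
  assumes "convex S" "x \<in> S" "v \<in> tangent S"
    and D: "(f has_derivative D) (at x within S)"
    and D': "(f has_derivative D') (at x within S)"
  shows "D v = D' v"
proof -
  have lin: "linear D" "linear D'"
    using D D' by (auto intro: has_derivative_linear)
  show ?thesis
    using assms(3) unfolding tangent_def
  proof (rule linear_eq_on_span[OF lin, rotated])
    fix u assume "u \<in> {x - y |x y. x \<in> S \<and> y \<in> S}"
    then obtain y z where u: "u = y - z" "y \<in> S" "z \<in> S" by blast
    have "D (y - x) = D' (y - x)" "D (z - x) = D' (z - x)"
      using derivative_within_segment_unique[OF assms(1,2) _ D D'] u by auto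
    moreover have "u = (y - x) - (z - x)" using u by simp
    ultimately show "D u = D' u"
      using linear_diff[OF lin(1)] linear_diff[OF lin(2)] by metis
  qed
qed

text \<open>Two polynomials that agree on an edge may differ off it, so only their tangential derivatives agree.\<close>

lemma grad_eq_along:
  assumes "poly_deg_le q f" "poly_deg_le r g" "convex S" "x \<in> S" "v \<in> tangent S"
    and eq: "\<And>y. y \<in> S \<Longrightarrow> f y = g y"
  shows "grad f x \<bullet> v = grad g x \<bullet> v"
proof (rule derivative_within_tangent_unique[OF assms(3-5)])
  show "(f has_derivative (\<bullet>) (grad f x)) (at x within S)"
    using poly_has_derivative[OF assms(1)] has_derivative_at_withinI by blast
  have "(g has_derivative (\<bullet>) (grad g x)) (at x within S)"
    using poly_has_derivative[OF assms(2)] has_derivative_at_withinI by blast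
  then show "(f has_derivative (\<bullet>) (grad g x)) (at x within S)"
    by (rule has_derivative_transform[OF assms(4), rotated]) (use eq in auto)
qed

lemma tangentI: "x \<in> S \<Longrightarrow> y \<in> S \<Longrightarrow> x - y \<in> tangent S"
  unfolding tangent_def by (rule span_base) blast

text \<open>The derivatives \<open>D\<close> in the definition of admissibility are only evaluated at tangent vectors. There
  they are unique, so they can be read off from any polynomials that represent the form.\<close>

lemma admissible_poly_iff:
  fixes G :: "'v::euclidean_space list \<Rightarrow> 'v \<Rightarrow> real"
  assumes S: "convex S"
    and G: "\<And>vs. \<exists>q. poly_deg_le q (G vs)"
    and u: "\<And>x vs. x \<in> S \<Longrightarrow> u x vs = G vs x"
  shows "admissible S u w \<longleftrightarrow> (\<forall>x\<in>S. \<forall>vs. set vs \<subseteq> tangent S \<longrightarrow>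
     w x vs = (\<Sum>i<length vs. (-1) ^ i * (grad (G (omit i vs)) x \<bullet> (vs ! i))))"
    (is "_ \<longleftrightarrow> ?R")
proof
  have gd: "((\<lambda>y. u y ws) has_derivative (\<bullet>) (grad (G ws) x)) (at x within S)" if "x \<in> S" for x ws
  proof -
    obtain q where "poly_deg_le q (G ws)" using G by blast
    then have "(G ws has_derivative (\<bullet>) (grad (G ws) x)) (at x within S)"
      using poly_has_derivative has_derivative_at_withinI by blast
    then show ?thesis
      by (rule has_derivative_transform[OF that, rotated]) (use u in auto)
  qed
  have om: "set (omit i vs) \<subseteq> set vs" for i :: nat and vs :: "'v list"
    unfolding omit_def using set_take_subset set_drop_subset by fastforce
  show ?R if adm: "admissible S u w"
  proof (intro ballI allI impI)
    fix x vs assume x: "x \<in> S" and vs: "set vs \<subseteq> tangent S"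
    obtain D where
      D: "\<And>ws. set ws \<subseteq> tangent S \<Longrightarrow> ((\<lambda>y. u y ws) has_derivative D ws) (at x within S)"
      and w: "w x vs = (\<Sum>i<length vs. (-1) ^ i * D (omit i vs) (vs ! i))"
      using adm x vs unfolding admissible_def by blast
    have "D (omit i vs) (vs ! i) = grad (G (omit i vs)) x \<bullet> (vs ! i)" if "i < length vs" for i
    proof (rule derivative_within_tangent_unique[OF S x _ D gd[OF x]])
      show "vs ! i \<in> tangent S" using vs that by auto
      show "set (omit i vs) \<subseteq> tangent S" using om vs by blast
    qed
    then show "w x vs = (\<Sum>i<length vs. (-1) ^ i * (grad (G (omit i vs)) x \<bullet> (vs ! i)))"
      unfolding w by (intro sum.cong) auto
  qed
  show "admissible S u w" if R: ?R
    unfolding admissible_def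
  proof
    fix x assume x: "x \<in> S"
    show "\<exists>D. (\<forall>ws. set ws \<subseteq> tangent S \<longrightarrow> ((\<lambda>y. u y ws) has_derivative D ws) (at x within S)) \<and>
      (\<forall>vs. set vs \<subseteq> tangent S \<longrightarrow> w x vs = (\<Sum>i<length vs. (-1) ^ i * D (omit i vs) (vs ! i)))"
      by (rule exI[of _ "\<lambda>ws v. grad (G ws) x \<bullet> v"]) (use gd R x in auto)
  qed
qed


section \<open>Forms in the plane\<close>

definition E1 :: "'v::euclidean_space" where "E1 = (SOME b. b \<in> Basis)"
definition E2 :: "'v::euclidean_space" where "E2 = (SOME b. b \<in> Basis - {E1})"

lemma plane_basis:
  assumes "DIM('v::euclidean_space) = 2"
  shows "Basis = {E1, E2 :: 'v}" "E1 \<noteq> (E2 :: 'v)"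
proof -
  have 1: "(E1 :: 'v) \<in> Basis"
    unfolding E1_def by (rule someI_ex) (use nonempty_Basis in blast)
  have "card (Basis - {E1 :: 'v}) = 1" using assms 1 by simp
  then have "\<exists>b. b \<in> Basis - {E1 :: 'v}" by (metis card.empty ex_in_conv zero_neq_one)
  then have 2: "(E2 :: 'v) \<in> Basis - {E1}"
    unfolding E2_def by (rule someI_ex)
  then show "E1 \<noteq> (E2 :: 'v)" by auto
  have "{E1, E2 :: 'v} = Basis"
    by (rule card_subset_eq) (use 1 2 assms in auto)
  then show "Basis = {E1, E2 :: 'v}" by simp
qed

lemma plane_basis_inner:
  assumes "DIM('v::euclidean_space) = 2"
  shows "E1 \<bullet> (E1::'v) = 1" "E2 \<bullet> (E2::'v) = 1" "E1 \<bullet> (E2::'v) = 0" "E2 \<bullet> (E1::'v) = 0"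
proof -
  have b: "(E1 :: 'v) \<in> Basis" "(E2 :: 'v) \<in> Basis" "E1 \<noteq> (E2 :: 'v)"
    using plane_basis[OF assms] by auto
  show "E1 \<bullet> (E1::'v) = 1" "E2 \<bullet> (E2::'v) = 1" "E1 \<bullet> (E2::'v) = 0" "E2 \<bullet> (E1::'v) = 0"
    using inner_Basis[OF b(1) b(2)] inner_Basis[OF b(2) b(1)] b by simp_all
qed

lemma plane_representation:
  assumes "DIM('v::euclidean_space) = 2"
  shows "v = (v \<bullet> E1) *\<^sub>R E1 + (v \<bullet> E2) *\<^sub>R (E2 :: 'v)"
proof -
  have "v = (\<Sum>b\<in>Basis. (v \<bullet> b) *\<^sub>R b)" by (simp add: euclidean_representation)
  also have "\<dots> = (v \<bullet> E1) *\<^sub>R E1 + (v \<bullet> E2) *\<^sub>R E2"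
    using plane_basis(2)[OF assms] by (simp add: plane_basis(1)[OF assms])
  finally show ?thesis .
qed

definition area :: "'v::euclidean_space \<Rightarrow> 'v \<Rightarrow> real" where
  "area v w = (v \<bullet> E1) * (w \<bullet> E2) - (v \<bullet> E2) * (w \<bullet> E1)"

definition curl :: "('v::euclidean_space \<Rightarrow> 'v) \<Rightarrow> 'v \<Rightarrow> real" where
  "curl U x = grad (\<lambda>x. U x \<bullet> E2) x \<bullet> E1 - grad (\<lambda>x. U x \<bullet> E1) x \<bullet> E2"

definition form1 :: "'v::euclidean_space \<Rightarrow> 'v form" where
  "form1 y = (\<lambda>vs. case vs of [v] \<Rightarrow> y \<bullet> v | _ \<Rightarrow> 0)"

definition form2 :: "real \<Rightarrow> 'v::euclidean_space form" where
  "form2 r = (\<lambda>vs. case vs of [v, w] \<Rightarrow> r * area v w | _ \<Rightarrow> 0)"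

lemma form1_simps [simp]:
  "form1 y [] = 0" "form1 y [v] = y \<bullet> v" "form1 y (v # w # vs) = 0"
  by (simp_all add: form1_def)

lemma form2_simps [simp]:
  "form2 y [] = 0" "form2 r [v] = 0" "form2 r [v, w] = r * area v w" "form2 y (v # w # z # vs) = 0"
  by (simp_all add: form2_def)

lemma scalar_simps [simp]: "scalar c [] = c" "scalar c (v # vs) = 0"
  by (simp_all add: scalar_def)

text \<open>A linear parametrisation of the \<open>k\<close>-forms by a Euclidean space: by numbers for \<open>k = 0\<close> and \<open>k = 2\<close>,
  by vectors for \<open>k = 1\<close>. Polynomiality and continuity of a field are stated value by value; because
  the coordinates of the parameter are themselves values of the form, they pass to the parameter,
  and the three degrees can be treated together.\<close>

definition form_model :: "nat \<Rightarrow> ('b::euclidean_space \<Rightarrow> 'v::euclidean_space form) \<Rightarrow> bool" where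
  "form_model k \<iota> \<longleftrightarrow> (\<forall>vs. linear (\<lambda>y. \<iota> y vs)) \<and> range \<iota> = Alt k \<and>
     (\<forall>i\<in>Basis. \<exists>vs. \<forall>y. \<iota> y vs = y \<bullet> i)"

lemma form_model_scalar: "form_model 0 (scalar :: real \<Rightarrow> 'v::euclidean_space form)"
  unfolding form_model_def
proof (intro conjI allI)
  show "linear (\<lambda>y. scalar y vs)" for vs :: "'v list"
    by (cases vs) (simp_all add: linear_iff)
  show "range scalar = (Alt 0 :: 'v form set)"
  proof
    show "range scalar \<subseteq> (Alt 0 :: 'v form set)"
      by (auto simp: Alt_def scalar_def)
    show "(Alt 0 :: 'v form set) \<subseteq> range scalar"
    proof
      fix \<omega> :: "'v form" assume "\<omega> \<in> Alt 0"
      then have "\<omega> = scalar (\<omega> [])" by (auto simp: Alt_def scalar_def fun_eq_iff)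
      then show "\<omega> \<in> range scalar" by blast
    qed
  qed
  show "\<forall>i\<in>Basis. \<exists>vs::'v list. \<forall>y. scalar y vs = y \<bullet> i"
    by (auto intro: exI[of _ "[]"])
qed

lemma form_model_form1: "form_model 1 (form1 :: 'v::euclidean_space \<Rightarrow> 'v form)"
  unfolding form_model_def
proof (intro conjI allI)
  show "linear (\<lambda>y. form1 y vs)" for vs :: "'v list"
    by (cases vs rule: remdups_adj.cases) (auto simp: linear_iff inner_add_left)
  show "range form1 = (Alt 1 :: 'v form set)"
  proof
    show "range form1 \<subseteq> (Alt 1 :: 'v form set)"
    proof safe
      fix y :: 'v
      have "form1 y vs = 0" if "length vs \<noteq> 1" for vs
        using that by (cases vs rule: remdups_adj.cases) auto
      moreover have "linear (\<lambda>x. form1 y (vs[i := x]))" if l: "length vs = 1" "i < 1" for vs i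
      proof -
        obtain v where "vs = [v]" using l by (auto simp: length_Suc_conv)
        then show ?thesis using l by (simp add: linear_iff inner_add_right)
      qed
      moreover have "form1 y vs = 0" if "\<not> distinct vs" for vs
        using that by (cases vs rule: remdups_adj.cases) auto
      ultimately show "form1 y \<in> Alt 1" by (auto simp: Alt_def)
    qed
    show "(Alt 1 :: 'v form set) \<subseteq> range form1"
    proof
      fix \<omega> :: "'v form" assume \<omega>: "\<omega> \<in> Alt 1"
      have "\<forall>vs i. length vs = 1 \<longrightarrow> i < 1 \<longrightarrow> linear (\<lambda>x. \<omega> (vs[i := x]))"
        using \<omega> unfolding Alt_def by blast
      from this[rule_format, of "[0]" 0] have "linear (\<lambda>x. \<omega> ([0][0 := x]))"
        by simp
      then have "bounded_linear (\<lambda>x. \<omega> [x])"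
        by (simp add: linear_conv_bounded_linear)
      then obtain y where y: "(\<lambda>x. \<omega> [x]) = (\<lambda>x. y \<bullet> x)"
        using bounded_linear_eq_inner by blast
      have "\<omega> vs = form1 y vs" for vs
      proof (cases vs rule: remdups_adj.cases)
        case (2 x)
        then show ?thesis using y by (simp add: fun_eq_iff)
      qed (use \<omega> in \<open>auto simp: Alt_def\<close>)
      then show "\<omega> \<in> range form1" by blast
    qed
  qed
  have "\<forall>y. form1 y [i] = y \<bullet> i" for i :: 'v by simp
  then show "\<forall>i\<in>Basis. \<exists>vs::'v list. \<forall>y. form1 y vs = y \<bullet> i" by blast
qed

lemma list_cases3:
  obtains "vs = []" | v where "vs = [v]" | v w where "vs = [v, w]"
    | v w z us where "vs = v # w # z # us"
  by (cases vs rule: remdups_adj.cases; metis list.exhaust)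

lemma form_model_form2:
  assumes dim: "DIM('v::euclidean_space) = 2"
  shows "form_model 2 (form2 :: real \<Rightarrow> 'v form)"
  unfolding form_model_def
proof (intro conjI allI)
  note e = plane_basis_inner[OF dim]
  show "linear (\<lambda>y. form2 y vs)" for vs :: "'v list"
    by (cases vs rule: list_cases3) (auto simp: linear_iff distrib_right)
  show "range form2 = (Alt 2 :: 'v form set)"
  proof
    show "range form2 \<subseteq> (Alt 2 :: 'v form set)"
    proof safe
      fix y :: real
      have "form2 y vs = 0" if "length vs \<noteq> 2" for vs :: "'v list"
        using that by (cases vs rule: list_cases3) auto
      moreover have "linear (\<lambda>x. form2 y (vs[i := x]))" if l: "length vs = 2" "i < 2"
        for vs :: "'v list" and i
      proof -
        obtain v w where "vs = [v, w]" using l by (auto simp: length_Suc_conv numeral_2_eq_2)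
        then show ?thesis using l
          by (auto simp: linear_iff area_def inner_add_left algebra_simps less_2_cases_iff)
      qed
      moreover have "form2 y vs = 0" if "\<not> distinct vs" for vs :: "'v list"
        using that by (cases vs rule: list_cases3) (auto simp: area_def)
      ultimately show "(form2 y :: 'v form) \<in> Alt 2" by (auto simp: Alt_def)
    qed
    show "(Alt 2 :: 'v form set) \<subseteq> range form2"
    proof
      fix \<omega> :: "'v form" assume \<omega>: "\<omega> \<in> Alt 2"
      have lin: "linear (\<lambda>x. \<omega> ([v, w][i := x]))" if "i < 2" for v w i
      proof -
        have "\<forall>vs i. length vs = 2 \<longrightarrow> i < 2 \<longrightarrow> linear (\<lambda>x. \<omega> (vs[i := x]))"
          using \<omega> unfolding Alt_def by blast
        from this[rule_format, of "[v, w]" i] show ?thesis using that by simp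
      qed
      have l1: "linear (\<lambda>x. \<omega> [x, w])" and l2: "linear (\<lambda>x. \<omega> [v, x])" for v w
        using lin[of 0 0 w] lin[of 1 v 0] by auto
      have alt: "\<omega> [v, v] = 0" for v
        using \<omega> by (auto simp: Alt_def)
      have "\<omega> [E1, E2] + \<omega> [E2, E1] = 0"
        using alt[of "E1 + E2"] unfolding linear_add[OF l1] linear_add[OF l2] by (simp add: alt)
      then have sw: "\<omega> [E2, E1] = - \<omega> [E1, E2]" by simp
      note rep = plane_representation[OF dim]
      have two: "\<omega> [v, w] = \<omega> [E1, E2] * area v w" for v w
      proof -
        have v: "\<omega> [v, w] = (v \<bullet> E1) * \<omega> [E1, w] + (v \<bullet> E2) * \<omega> [E2, w]"
          by (subst rep[of v]) (simp add: linear_add[OF l1] linear_scale[OF l1])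
        have z: "\<omega> [z, w] = (w \<bullet> E1) * \<omega> [z, E1] + (w \<bullet> E2) * \<omega> [z, E2]" for z
          by (subst rep[of w]) (simp add: linear_add[OF l2] linear_scale[OF l2])
        show ?thesis
          unfolding v z[of E1] z[of E2] by (simp add: alt sw area_def algebra_simps)
      qed
      have "\<omega> vs = form2 (\<omega> [E1, E2]) vs" for vs
      proof (cases vs rule: list_cases3)
        case (3 v w)
        then show ?thesis using two[of v w] by simp
      qed (use \<omega> in \<open>auto simp: Alt_def\<close>)
      then show "\<omega> \<in> range form2" by blast
    qed
  qed
  have "\<forall>y. form2 y [E1, E2 :: 'v] = y \<bullet> 1" by (simp add: area_def e)
  then show "\<forall>i\<in>Basis. \<exists>vs::'v list. \<forall>y. form2 y vs = y \<bullet> i"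
    by (metis Basis_real_def singletonD)
qed

lemma form_model_0: "form_model k \<iota> \<Longrightarrow> \<iota> 0 = zero_form"
  by (auto simp: form_model_def zero_form_def fun_eq_iff intro: linear_0)

lemma form_model_inj:
  assumes "form_model k \<iota>" "\<iota> y = \<iota> z"
  shows "y = z"
  using assms unfolding form_model_def by (metis euclidean_eqI)

lemma form_model_Alt: "form_model k \<iota> \<Longrightarrow> \<iota> y \<in> Alt k"
  unfolding form_model_def by blast

lemma form_model_fieldE:
  assumes "form_model k \<iota>" and "\<And>x. x \<in> S \<Longrightarrow> u x \<in> Alt k"
  obtains U where "\<And>x. x \<in> S \<Longrightarrow> u x = \<iota> (U x)"
proof
  fix x assume "x \<in> S"
  then have "u x \<in> range \<iota>" using assms by (simp add: form_model_def)
  then have "\<exists>y. u x = \<iota> y" by blast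
  then show "u x = \<iota> (SOME y. u x = \<iota> y)" by (rule someI_ex)
qed

lemma form_model_poly:
  assumes m: "form_model k \<iota>" and p: "vpoly q U"
  shows "poly_deg_le q (\<lambda>x. \<iota> (U x) vs)"
  using vpoly_linear_image[OF p, of "\<lambda>y. \<iota> y vs"] m by (simp add: form_model_def)

lemma form_model_poly_fieldE:
  assumes m: "form_model k \<iota>" and u: "\<And>x. x \<in> S \<Longrightarrow> u x \<in> Alt k" and p: "poly_field_on q S u"
  obtains U where "vpoly q U" "\<And>x. x \<in> S \<Longrightarrow> u x = \<iota> (U x)"
proof -
  obtain U0 where U0: "\<And>x. x \<in> S \<Longrightarrow> u x = \<iota> (U0 x)"
    using form_model_fieldE[OF m, of S u] u by blast
  have "\<exists>g. poly_deg_le q g \<and> (\<forall>x\<in>S. U0 x \<bullet> i = g x)" if "i \<in> Basis" for i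
    using p m U0 that unfolding poly_field_on_def form_model_def by metis
  then obtain g where g: "\<And>i. i \<in> Basis \<Longrightarrow> poly_deg_le q (g i) \<and> (\<forall>x\<in>S. U0 x \<bullet> i = g i x)"
    by metis
  show thesis
  proof
    show "vpoly q (\<lambda>x. \<Sum>i\<in>Basis. g i x *\<^sub>R i)"
      by (intro vpoly_sum vpoly_scaleR_const) (use g in auto)
    fix x assume x: "x \<in> S"
    have "(\<Sum>i\<in>Basis. g i x *\<^sub>R i) = (\<Sum>i\<in>Basis. (U0 x \<bullet> i) *\<^sub>R i)"
      by (intro sum.cong) (use g x in auto)
    then show "u x = \<iota> (\<Sum>i\<in>Basis. g i x *\<^sub>R i)"
      using U0[OF x] by (simp add: euclidean_representation)
  qed
qed

lemma form_model_poly_field_on: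
  assumes "form_model k \<iota>" "vpoly q U" "\<And>x. x \<in> S \<Longrightarrow> u x = \<iota> (U x)"
  shows "poly_field_on q S u"
  unfolding poly_field_on_def using form_model_poly[OF assms(1,2)] assms(3) by metis

lemma poly_fields_iff:
  assumes m: "form_model k \<iota>"
  shows "u \<in> poly_fields q S k \<longleftrightarrow> (\<exists>U. vpoly q U \<and> u = tr S (\<lambda>x. \<iota> (U x)))"
proof
  assume "u \<in> poly_fields q S k"
  then have u: "\<And>x. x \<in> S \<Longrightarrow> u x \<in> Alt k" "\<And>x. x \<notin> S \<Longrightarrow> u x = zero_form" "poly_field_on q S u"
    by (auto simp: poly_fields_def fields_on_def)
  obtain U where "vpoly q U" "\<And>x. x \<in> S \<Longrightarrow> u x = \<iota> (U x)"
    using form_model_poly_fieldE[OF m u(1,3)] by blast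
  moreover from this have "u = tr S (\<lambda>x. \<iota> (U x))"
    using u(2) by (auto simp: tr_def)
  ultimately show "\<exists>U. vpoly q U \<and> u = tr S (\<lambda>x. \<iota> (U x))" by blast
next
  assume "\<exists>U. vpoly q U \<and> u = tr S (\<lambda>x. \<iota> (U x))"
  then show "u \<in> poly_fields q S k"
    using form_model_Alt[OF m] form_model_poly_field_on[OF m]
    by (auto simp: poly_fields_def fields_on_def tr_def)
qed

lemma form_model_continuous_iff:
  assumes m: "form_model k \<iota>" and u: "\<And>x. x \<in> S \<Longrightarrow> u x = \<iota> (U x)"
  shows "continuous_field_on S u \<longleftrightarrow> continuous_on S U"
proof
  assume c: "continuous_field_on S u"
  have "continuous_on S (\<lambda>x. U x \<bullet> i)" if "i \<in> Basis" for i
  proof -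
    obtain vs where "\<And>y. \<iota> y vs = y \<bullet> i" using m \<open>i \<in> Basis\<close> unfolding form_model_def by blast
    then show ?thesis
      using c u unfolding continuous_field_on_def by (metis (no_types, lifting) continuous_on_cong)
  qed
  then show "continuous_on S U" by (subst continuous_on_componentwise) auto
next
  assume c: "continuous_on S U"
  show "continuous_field_on S u"
    unfolding continuous_field_on_def
  proof
    fix vs
    have "linear (\<lambda>y. \<iota> y vs)" using m by (simp add: form_model_def)
    then have "continuous_on S (\<lambda>x. \<iota> (U x) vs)"
      using continuous_on_compose2[OF linear_continuous_on[of "\<lambda>y. \<iota> y vs" UNIV] c]
      by (simp add: linear_conv_bounded_linear)
    then show "continuous_on S (\<lambda>x. u x vs)"
      using u by (simp cong: continuous_on_cong)
  qed
qed

lemma admissible_scalar_iff: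
  assumes S: "convex S" and f: "poly_deg_le q f" and u: "\<And>x. x \<in> S \<Longrightarrow> u x = scalar (f x)"
  shows "admissible S u w \<longleftrightarrow>
    (\<forall>x\<in>S. \<forall>vs. set vs \<subseteq> tangent S \<longrightarrow> w x vs = form1 (grad f x) vs)"
proof -
  let ?G = "\<lambda>vs x. scalar (f x) vs"
  have "(\<Sum>i<length vs. (-1) ^ i * (grad (?G (omit i vs)) x \<bullet> (vs ! i))) = form1 (grad f x) vs"
    for vs x
    by (cases vs rule: list_cases3)
       (auto simp: omit_def grad_const lessThan_Suc take_Cons' scalar_def intro!: sum.neutral)
  moreover have "\<exists>q. poly_deg_le q (?G vs)" for vs :: "'a list"
    using f by (cases vs) (auto intro: poly_deg_le.const)
  ultimately show ?thesis
    using admissible_poly_iff[OF S, of ?G u w] u by simp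
qed

lemma admissible_form1_iff:
  fixes U :: "'v::euclidean_space \<Rightarrow> 'v"
  assumes dim: "DIM('v) = 2"
    and S: "convex S" and U: "vpoly q U" and u: "\<And>x. x \<in> S \<Longrightarrow> u x = form1 (U x)"
  shows "admissible S u w \<longleftrightarrow>
    (\<forall>x\<in>S. \<forall>vs. set vs \<subseteq> tangent S \<longrightarrow> w x vs = form2 (curl U x) vs)"
proof -
  let ?G = "\<lambda>vs x. form1 (U x) vs"
  have 2: "grad (\<lambda>x. U x \<bullet> w) x \<bullet> v - grad (\<lambda>x. U x \<bullet> v) x \<bullet> w = curl U x * area v w" for v w x
  proof -
    note rep = plane_representation[OF dim]
    have *: "grad (\<lambda>x. U x \<bullet> v) x
       = (v \<bullet> E1) *\<^sub>R grad (\<lambda>x. U x \<bullet> E1) x + (v \<bullet> E2) *\<^sub>R grad (\<lambda>x. U x \<bullet> E2) x" for v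
    proof -
      have "(\<lambda>x. U x \<bullet> v) = (\<lambda>x. (v \<bullet> E1) * (U x \<bullet> E1) + (v \<bullet> E2) * (U x \<bullet> E2))"
        by (subst (1) rep) (simp add: inner_add_right)
      then show ?thesis
        by (simp add: grad_add[OF poly_deg_le_cmult[OF vpoly_inner[OF U]]
               poly_deg_le_cmult[OF vpoly_inner[OF U]]] grad_cmult[OF vpoly_inner[OF U]])
    qed
    have **: "y \<bullet> v = (v \<bullet> E1) * (y \<bullet> E1) + (v \<bullet> E2) * (y \<bullet> E2)" for y v :: 'v
      by (subst (1) rep[of v]) (simp add: inner_add_right)
    show ?thesis
      unfolding **[of "grad (\<lambda>x. U x \<bullet> w) x" v] **[of "grad (\<lambda>x. U x \<bullet> v) x" w]
      unfolding *[of v] *[of w] curl_def area_def inner_add_left inner_scaleR_left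
      by (simp add: algebra_simps)
  qed
  have z: "form1 (U y) (omit i (a # b # c # us)) = 0" if "i < Suc (Suc (Suc (length us)))" for a b c us i y
  proof -
    have "length (omit i (a # b # c # us)) = Suc (Suc (length us))"
      using that by (simp add: omit_def)
    then show ?thesis
      by (cases "omit i (a # b # c # us)" rule: remdups_adj.cases) auto
  qed
  have "(\<Sum>i<length vs. (-1) ^ i * (grad (?G (omit i vs)) x \<bullet> (vs ! i))) = form2 (curl U x) vs"
    for vs x
  proof (cases vs rule: list_cases3)
    case (3 v w)
    then show ?thesis
      using 2[where v = v and w = w and x = x] by (simp add: omit_def lessThan_Suc)
  next
    case (4 v w t us)
    then show ?thesis
      by (auto simp: z grad_const intro!: sum.neutral simp del: omit_def)
  qed (auto simp: omit_def grad_const lessThan_Suc)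
  moreover have "\<exists>q. poly_deg_le q (?G vs)" for vs :: "'v list"
    using form_model_poly[OF form_model_form1 U] by blast
  ultimately show ?thesis
    using admissible_poly_iff[OF S, of ?G u w] u by simp
qed

lemma poly_curl: "vpoly q U \<Longrightarrow> poly_deg_le (q - 1) (curl U)"
  unfolding curl_def[abs_def] by (intro poly_deg_le_diff poly_grad vpoly_inner)

lemma curl_grad: "poly_deg_le q f \<Longrightarrow> curl (grad f) x = 0"
  by (simp add: curl_def grad_grad_commute)


section \<open>Geometry of the split triangle\<close>

text \<open>The numbers \<open>w a\<close> are the barycentric coordinates of \<open>W\<close>. The affine function
  \<open>1 + G a \<bullet> (x - W)\<close> is the barycentric coordinate of \<open>x\<close> at \<open>a\<close>, divided by \<open>w a\<close>. This scaling gives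
  the three functions the common value \<open>1\<close> at \<open>W\<close> and makes the formulas below symmetric in the
  vertices.\<close>

locale split_triangle =
  fixes V :: "'v::euclidean_space set" and W :: 'v and w :: "'v \<Rightarrow> real" and G :: "'v \<Rightarrow> 'v"
  assumes dim: "DIM('v) = 2" and card_V: "card V = 3"
    and w_pos: "\<And>a. a \<in> V \<Longrightarrow> 0 < w a"
    and w_sum: "sum w V = 1"
    and w_W: "(\<Sum>a\<in>V. w a *\<^sub>R a) = W"
    and dual: "\<And>a b. a \<in> V \<Longrightarrow> b \<in> V \<Longrightarrow> 1 + G a \<bullet> (b - W) = (if a = b then 1 / w a else 0)"
begin

text \<open>On the small triangle opposite \<open>c\<close> this is the hat function of \<open>W\<close>; there \<open>gam c\<close> is the smallest of
  the three functions \<open>gam a\<close> (\<open>subtri_iff\<close>).\<close>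

definition gam :: "'v \<Rightarrow> 'v \<Rightarrow> real" where
  "gam a x = 1 + G a \<bullet> (x - W)"

definition ray :: "'v \<Rightarrow> real \<Rightarrow> 'v" where
  "ray a t = W + t *\<^sub>R (a - W)"

text \<open>Small triangles are indexed by the opposite vertex.\<close>

definition subtri :: "'v \<Rightarrow> 'v set" where
  "subtri c = convex hull (insert W (V - {c}))"

lemma finite_V [simp]: "finite V"
  using card_V by (metis card.infinite zero_neq_numeral)

lemma third:
  assumes "b \<in> V" "c \<in> V" "b \<noteq> c"
  obtains a where "V = {a, b, c}" "a \<noteq> b" "a \<noteq> c" "a \<in> V"
proof -
  have "card (V - {b, c}) = 1" using assms card_V by (simp add: card_Diff_subset)
  then obtain a where a: "V - {b, c} = {a}" by (meson card_1_singletonE)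
  show thesis
    by (rule that[of a]) (use a assms in auto)
qed

lemma two_others:
  assumes "c \<in> V"
  obtains a b where "V = {a, b, c}" "a \<noteq> b" "a \<noteq> c" "b \<noteq> c" "a \<in> V" "b \<in> V"
proof -
  have "card (V - {c}) = 2" using assms card_V by simp
  then obtain a b where "V - {c} = {a, b}" "a \<noteq> b" by (meson card_2_iff)
  then show thesis by (intro that[of a b]) (use assms in auto)
qed

lemma gam_vertex: "a \<in> V \<Longrightarrow> b \<in> V \<Longrightarrow> gam a b = (if a = b then 1 / w a else 0)"
  by (simp add: gam_def dual)

lemma gam_vertex_0 [simp]: "a \<in> V \<Longrightarrow> b \<in> V \<Longrightarrow> a \<noteq> b \<Longrightarrow> gam a b = 0"
  by (simp add: gam_vertex)

lemma gam_W [simp]: "gam a W = 1"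
  by (simp add: gam_def)

lemma G_vertex: "a \<in> V \<Longrightarrow> b \<in> V \<Longrightarrow> G a \<bullet> (b - W) = (if a = b then 1 / w a - 1 else - 1)"
  using dual[of a b] by (auto split: if_splits)

lemma gam_diff: "gam a x - gam a y = G a \<bullet> (x - y)"
  by (simp add: gam_def inner_diff_right)

lemma gam_affine: "u + v = 1 \<Longrightarrow> gam a (u *\<^sub>R x + v *\<^sub>R y) = u * gam a x + v * gam a y"
proof -
  assume uv: "u + v = 1"
  have "u *\<^sub>R x + v *\<^sub>R y - W = u *\<^sub>R (x - W) + v *\<^sub>R (y - W) + (u + v - 1) *\<^sub>R W"
    by (simp add: algebra_simps)
  with uv have "gam a (u *\<^sub>R x + v *\<^sub>R y) = (u + v) + G a \<bullet> (u *\<^sub>R (x - W) + v *\<^sub>R (y - W))"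
    by (simp add: gam_def)
  then show ?thesis by (simp only: gam_def inner_add_right inner_scaleR_right) (simp add: algebra_simps)
qed

lemma gam_ray: "gam a (ray b t) = (1 - t) + t * gam a b"
  by (simp add: gam_def ray_def algebra_simps)

lemma gam_ray_other: "a \<in> V \<Longrightarrow> b \<in> V \<Longrightarrow> a \<noteq> b \<Longrightarrow> gam a (ray b t) = 1 - t"
  by (simp add: gam_ray)

lemma ray_0 [simp]: "ray a 0 = W" and ray_1 [simp]: "ray a 1 = a"
  by (auto simp: ray_def)

lemma W_notin_V: "W \<notin> V"
proof
  assume W: "W \<in> V"
  obtain a where "a \<in> V" "a \<noteq> W" using two_others[OF W] by metis
  then show False using gam_vertex_0[of a W] W by simp
qed

lemma ex_vector_combination:
  assumes a: "a \<in> V" and b: "b \<in> V" and ab: "a \<noteq> b"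
  obtains p q where "y = p *\<^sub>R (a - W) + q *\<^sub>R (b - W)"
proof -
  let ?u = "a - W" and ?v = "b - W"
  obtain c where c: "V = {c, a, b}" "c \<noteq> a" "c \<noteq> b" "c \<in> V" using third[OF a b ab] .
  have g: "G c \<bullet> ?u = -1" "G c \<bullet> ?v = -1" "G a \<bullet> ?v = -1" "G a \<bullet> ?u = 1 / w a - 1"
    using G_vertex a b c ab by auto
  have v0: "?v \<noteq> 0" using g(2) by force
  have uv: "?u \<noteq> k *\<^sub>R ?v" for k
  proof
    assume e: "?u = k *\<^sub>R ?v"
    then have "G c \<bullet> ?u = k * (G c \<bullet> ?v)" "G a \<bullet> ?u = k * (G a \<bullet> ?v)" by simp_all
    then show False using g w_pos[OF a] by auto
  qed
  have "independent {?u, ?v}"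
    by (subst independent_insert) (use v0 uv in \<open>auto simp: span_singleton\<close>)
  moreover have "card {?u, ?v} = 2" using ab by simp
  ultimately have "UNIV \<subseteq> span {?u, ?v}"
    by (intro card_ge_dim_independent) (auto simp: dim)
  then have "y \<in> span {?u, ?v}" by blast
  then obtain p q where "y - p *\<^sub>R ?u = q *\<^sub>R ?v"
    by (auto simp: span_breakdown_eq span_singleton)
  then show thesis by (intro that[of p q]) (simp add: algebra_simps)
qed

lemma linear_eq_on_vertices:
  assumes f: "linear f" and g: "linear g"
    and eq: "\<And>b. b \<in> V \<Longrightarrow> f (b - W) = g (b - W)"
  shows "f y = g y"
proof -
  have "V \<noteq> {}" using card_V by auto
  then obtain c where "c \<in> V" by blast
  then obtain a b where ab: "a \<in> V" "b \<in> V" "a \<noteq> b" using two_others by metis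
  obtain p q where "y = p *\<^sub>R (a - W) + q *\<^sub>R (b - W)" using ex_vector_combination[OF ab] .
  then show ?thesis
    using eq ab by (simp add: linear_add[OF f] linear_add[OF g] linear_scale[OF f] linear_scale[OF g])
qed

lemma wG_vertex:
  "a \<in> V \<Longrightarrow> b \<in> V \<Longrightarrow> w a * (G a \<bullet> (b - W)) = (if a = b then 1 else 0) - w a"
  using w_pos[of a] G_vertex[of a b] by (auto simp: right_diff_distrib)

lemma sum_wG: "(\<Sum>a\<in>V. w a * (G a \<bullet> y)) = 0"
proof (rule linear_eq_on_vertices[of "\<lambda>y. \<Sum>a\<in>V. w a * (G a \<bullet> y)" "\<lambda>_. 0"])
  show "linear (\<lambda>y. \<Sum>a\<in>V. w a * (G a \<bullet> y))"
    by (auto simp: linear_iff inner_add_right sum.distrib sum_distrib_left algebra_simps)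
  show "linear (\<lambda>_::'v. 0::real)" by (simp add: linear_iff)
  fix b assume b: "b \<in> V"
  have "(\<Sum>a\<in>V. w a * (G a \<bullet> (b - W))) = (\<Sum>a\<in>V. (if a = b then 1 else 0) - w a)"
    by (intro sum.cong) (simp_all add: wG_vertex b)
  then show "(\<Sum>a\<in>V. w a * (G a \<bullet> (b - W))) = 0"
    using b w_sum by (simp add: sum_subtractf)
qed

lemma sum_w_vertices: "(\<Sum>a\<in>V. w a *\<^sub>R (a - z)) = W - z"
  by (simp add: scaleR_right_diff_distrib sum_subtractf w_W scaleR_left.sum[symmetric] w_sum)

lemma vector_expansion: "(\<Sum>a\<in>V. (w a * (G a \<bullet> y)) *\<^sub>R a) = y"
proof (rule linear_eq_on_vertices[of "\<lambda>y. \<Sum>a\<in>V. (w a * (G a \<bullet> y)) *\<^sub>R a" "\<lambda>y. y"])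
  show "linear (\<lambda>y. \<Sum>a\<in>V. (w a * (G a \<bullet> y)) *\<^sub>R a)"
    by (auto simp: linear_iff inner_add_right sum.distrib scaleR_sum_right algebra_simps)
  show "linear (\<lambda>y::'v. y)" by (simp add: linear_iff)
  fix b assume b: "b \<in> V"
  have "(\<Sum>a\<in>V. (w a * (G a \<bullet> (b - W))) *\<^sub>R a) = (\<Sum>a\<in>V. (if a = b then a else 0) - w a *\<^sub>R a)"
    by (intro sum.cong) (simp_all add: wG_vertex b scaleR_left_diff_distrib)
  then show "(\<Sum>a\<in>V. (w a * (G a \<bullet> (b - W))) *\<^sub>R a) = b - W"
    using b w_W by (simp add: sum_subtractf)
qed

lemma gam_sum: "(\<Sum>a\<in>V. w a * gam a x) = 1"
  by (simp add: gam_def distrib_left sum.distrib w_sum sum_wG)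

lemma gam_comb: "(\<Sum>a\<in>V. (w a * gam a x) *\<^sub>R a) = x"
  by (simp add: gam_def distrib_left scaleR_left_distrib sum.distrib w_W vector_expansion)

lemma gam_eqI:
  assumes "b \<in> V" "c \<in> V" "b \<noteq> c" "gam b x = gam b y" "gam c x = gam c y"
  shows "x = y"
proof -
  obtain a where a: "V = {a, b, c}" "a \<noteq> b" "a \<noteq> c" "a \<in> V" using third[OF assms(1-3)] .
  have "w a * gam a z + (w b * gam b z + w c * gam c z) = 1" for z
    using gam_sum[of z] assms a by simp
  from this[of x] this[of y] have "w a * gam a x = w a * gam a y"
    unfolding assms(4,5) by linarith
  then have "(\<Sum>z\<in>V. (w z * gam z x) *\<^sub>R z) = (\<Sum>z\<in>V. (w z * gam z y) *\<^sub>R z)"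
    using assms a by (intro sum.cong) auto
  then show ?thesis by (simp only: gam_comb)
qed

lemma convex_gam:
  "convex {x. \<forall>a\<in>A. 0 \<le> gam a x}"
  unfolding convex_def by (auto simp: gam_affine)

lemma cell_iff: "x \<in> cell V \<longleftrightarrow> (\<forall>a\<in>V. 0 \<le> gam a x)"
proof
  have "cell V \<subseteq> {x. \<forall>a\<in>V. 0 \<le> gam a x}"
    using w_pos by (intro hull_minimal convex_gam) (auto simp: gam_vertex less_imp_le)
  then show "x \<in> cell V \<Longrightarrow> (\<forall>a\<in>V. 0 \<le> gam a x)" by blast
  assume x: "\<forall>a\<in>V. 0 \<le> gam a x"
  show "x \<in> cell V"
    unfolding convex_hull_finite[OF finite_V]
    using x w_pos gam_sum[of x] gam_comb[of x]
    by (auto intro!: exI[of _ "\<lambda>a. w a * gam a x"] simp: less_imp_le)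
qed

text \<open>The barycentric coordinates of \<open>x\<close> in \<open>subtri c\<close> are \<open>gam c x\<close> at \<open>W\<close> and \<open>w a * (gam a x - gam c x)\<close>
  at the vertex \<open>a\<close>.\<close>

lemma subtri_iff:
  assumes c: "c \<in> V"
  shows "x \<in> subtri c \<longleftrightarrow> 0 \<le> gam c x \<and> (\<forall>a\<in>V. gam c x \<le> gam a x)"
proof
  let ?S = "{x. 0 \<le> gam c x \<and> (\<forall>a\<in>V. gam c x \<le> gam a x)}"
  have "convex ?S"
    unfolding convex_def by (auto simp: gam_affine intro!: add_mono mult_left_mono)
  moreover have "insert W (V - {c}) \<subseteq> ?S"
    using w_pos c by (auto simp: gam_vertex less_imp_le)
  ultimately have "subtri c \<subseteq> ?S" unfolding subtri_def by (intro hull_minimal)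
  then show "x \<in> subtri c \<Longrightarrow> 0 \<le> gam c x \<and> (\<forall>a\<in>V. gam c x \<le> gam a x)" by blast
  assume x: "0 \<le> gam c x \<and> (\<forall>a\<in>V. gam c x \<le> gam a x)"
  let ?u = "\<lambda>y. if y = W then gam c x else w y * (gam y x - gam c x)"
  have fin: "finite (insert W (V - {c}))" by simp
  have W: "W \<notin> V - {c}" using W_notin_V by blast
  have s1: "(\<Sum>y\<in>V - {c}. ?u y) = 1 - gam c x"
  proof -
    have "(\<Sum>y\<in>V - {c}. ?u y) = (\<Sum>y\<in>V - {c}. w y * (gam y x - gam c x))"
      by (intro sum.cong) (use W_notin_V in auto)
    also have "\<dots> = (\<Sum>y\<in>V. w y * (gam y x - gam c x))"
      by (simp add: sum.remove[OF finite_V c])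
    also have "\<dots> = 1 - gam c x"
      using w_sum gam_sum[of x] by (simp add: right_diff_distrib sum_subtractf sum_distrib_right[symmetric])
    finally show ?thesis .
  qed
  have s2: "(\<Sum>y\<in>V - {c}. ?u y *\<^sub>R y) = x - gam c x *\<^sub>R W"
  proof -
    have "(\<Sum>y\<in>V - {c}. ?u y *\<^sub>R y) = (\<Sum>y\<in>V - {c}. (w y * (gam y x - gam c x)) *\<^sub>R y)"
      by (intro sum.cong) (use W_notin_V in auto)
    also have "\<dots> = (\<Sum>y\<in>V. (w y * (gam y x - gam c x)) *\<^sub>R y)"
      by (simp add: sum.remove[OF finite_V c])
    also have "\<dots> = (\<Sum>y\<in>V. (w y * gam y x) *\<^sub>R y) - gam c x *\<^sub>R (\<Sum>y\<in>V. w y *\<^sub>R y)"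
      by (simp add: right_diff_distrib scaleR_left_diff_distrib sum_subtractf scaleR_sum_right mult.commute)
    finally show ?thesis by (simp add: gam_comb w_W)
  qed
  show "x \<in> subtri c"
    unfolding subtri_def convex_hull_finite[OF fin]
  proof (rule CollectI, rule exI[of _ ?u], intro conjI)
    show "\<forall>y\<in>insert W (V - {c}). 0 \<le> ?u y" using x w_pos by (auto simp: less_imp_le)
    show "sum ?u (insert W (V - {c})) = 1"
      using s1 W by (subst sum.insert) auto
    show "(\<Sum>y\<in>insert W (V - {c}). ?u y *\<^sub>R y) = x"
      using s2 W by (subst sum.insert) auto
  qed
qed

lemma edge_iff:
  assumes c: "c \<in> V"
  shows "x \<in> cell (V - {c}) \<longleftrightarrow> gam c x = 0 \<and> (\<forall>a\<in>V. 0 \<le> gam a x)"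
proof
  let ?S = "{x. gam c x = 0 \<and> (\<forall>a\<in>V. 0 \<le> gam a x)}"
  have "convex ?S" unfolding convex_def by (auto simp: gam_affine)
  moreover have "V - {c} \<subseteq> ?S" using w_pos c by (auto simp: gam_vertex less_imp_le)
  ultimately have "cell (V - {c}) \<subseteq> ?S" by (intro hull_minimal)
  then show "x \<in> cell (V - {c}) \<Longrightarrow> gam c x = 0 \<and> (\<forall>a\<in>V. 0 \<le> gam a x)" by blast
  assume x: "gam c x = 0 \<and> (\<forall>a\<in>V. 0 \<le> gam a x)"
  have fin: "finite (V - {c})" by simp
  show "x \<in> cell (V - {c})"
    unfolding convex_hull_finite[OF fin]
    using x w_pos gam_sum[of x] gam_comb[of x]
    by (auto intro!: exI[of _ "\<lambda>a. w a * gam a x"] simp: less_imp_le sum.remove[OF finite_V c])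
qed

lemma edges_V: "edges V = (\<lambda>c. V - {c}) ` V"
proof
  show "edges V \<subseteq> (\<lambda>c. V - {c}) ` V"
  proof
    fix e assume "e \<in> edges V"
    then have e: "e \<subseteq> V" "card e = 2" by (auto simp: edges_def)
    then have "card (V - e) = 1" using card_V by (simp add: card_Diff_subset finite_subset)
    then obtain c where "V - e = {c}" by (meson card_1_singletonE)
    then have "e = V - {c}" "c \<in> V" using e by auto
    then show "e \<in> (\<lambda>c. V - {c}) ` V" by blast
  qed
  show "(\<lambda>c. V - {c}) ` V \<subseteq> edges V" using card_V by (auto simp: edges_def)
qed

lemma split_V: "split V W = subtri ` V"
  unfolding split_def edges_V subtri_def by auto

lemma edge_subset_subtri: "c \<in> V \<Longrightarrow> cell (V - {c}) \<subseteq> subtri c"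
  unfolding subtri_def by (intro hull_mono) auto

lemma subtri_subset: "c \<in> V \<Longrightarrow> subtri c \<subseteq> cell V"
  unfolding subtri_def by (rule hull_minimal)
    (auto simp: cell_iff intro: hull_inc)

lemma cell_eq_Union: "cell V = (\<Union>c\<in>V. subtri c)"
proof
  show "(\<Union>c\<in>V. subtri c) \<subseteq> cell V" using subtri_subset by blast
  show "cell V \<subseteq> (\<Union>c\<in>V. subtri c)"
  proof
    fix x assume x: "x \<in> cell V"
    have "V \<noteq> {}" using card_V by auto
    then obtain c where c: "c \<in> V" "\<And>a. a \<in> V \<Longrightarrow> gam c x \<le> gam a x"
      using ex_is_arg_min_if_finite[OF finite_V, of "\<lambda>a. gam a x"]
      by (auto simp: is_arg_min_linorder)
    then have "x \<in> subtri c" using x by (auto simp: subtri_iff cell_iff)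
    then show "x \<in> (\<Union>c\<in>V. subtri c)" using c by blast
  qed
qed

lemma convex_subtri: "convex (subtri c)"
  by (simp add: subtri_def)

lemma closed_subtri: "closed (subtri c)"
  unfolding subtri_def by (intro compact_imp_closed finite_imp_compact_convex_hull) simp

lemma W_in_subtri: "W \<in> subtri c"
  unfolding subtri_def by (intro hull_inc) simp

lemma vertex_in_subtri: "a \<in> V \<Longrightarrow> a \<noteq> c \<Longrightarrow> a \<in> subtri c"
  unfolding subtri_def by (intro hull_inc) simp

lemma radial_in_subtri:
  assumes "x \<in> subtri c" "0 \<le> t" "t \<le> 1"
  shows "W + t *\<^sub>R (x - W) \<in> subtri c"
proof -
  have "(1 - t) *\<^sub>R W + t *\<^sub>R x \<in> subtri c"
    using convex_subtri W_in_subtri assms by (intro convexD) auto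
  then show ?thesis by (simp add: algebra_simps)
qed

lemma ray_in_subtri: "a \<in> V \<Longrightarrow> a \<noteq> c \<Longrightarrow> 0 \<le> t \<Longrightarrow> t \<le> 1 \<Longrightarrow> ray a t \<in> subtri c"
  unfolding ray_def by (intro radial_in_subtri vertex_in_subtri)

lemma tangent_subtri:
  assumes c: "c \<in> V"
  shows "tangent (subtri c) = UNIV"
proof -
  obtain a b where ab: "a \<in> V" "b \<in> V" "a \<noteq> b" "a \<noteq> c" "b \<noteq> c" using two_others[OF c] by metis
  have "y \<in> tangent (subtri c)" for y
  proof -
    obtain p q where y: "y = p *\<^sub>R (a - W) + q *\<^sub>R (b - W)"
      using ex_vector_combination[OF ab(1-3)] .
    have "a - W \<in> tangent (subtri c)" "b - W \<in> tangent (subtri c)"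
      using ab by (auto intro!: tangentI vertex_in_subtri W_in_subtri)
    then show ?thesis unfolding y tangent_def by (intro span_add span_scale)
  qed
  then show ?thesis by blast
qed

lemma gam_le_1:
  assumes "c \<in> V" "x \<in> subtri c"
  shows "gam c x \<le> 1"
proof -
  have "gam c x = (\<Sum>a\<in>V. w a * gam c x)"
    using w_sum by (simp add: sum_distrib_right[symmetric])
  also have "\<dots> \<le> (\<Sum>a\<in>V. w a * gam a x)"
    using assms w_pos by (intro sum_mono mult_left_mono) (auto simp: subtri_iff less_imp_le)
  finally show ?thesis by (simp add: gam_sum)
qed

lemma subtri_overlap:
  assumes "b \<in> V" "c \<in> V" "b \<noteq> c" "x \<in> subtri b" "x \<in> subtri c"
  obtains a t where "a \<in> V" "a \<noteq> b" "a \<noteq> c" "0 \<le> t" "t \<le> 1" "x = ray a t"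
proof -
  obtain a where a: "V = {a, b, c}" "a \<noteq> b" "a \<noteq> c" "a \<in> V" using third[OF assms(1-3)] .
  have e: "gam b x = gam c x" using assms by (auto simp: subtri_iff intro: antisym)
  have "x = ray a (1 - gam c x)"
    by (rule gam_eqI[OF assms(1-3)]) (use a assms e in \<open>auto simp: gam_ray_other\<close>)
  moreover have "gam c x \<le> 1" "0 \<le> gam c x"
    using gam_le_1[OF assms(2,5)] assms by (auto simp: subtri_iff)
  ultimately show thesis
    using that[of a "1 - gam c x"] a(2-4) by simp
qed

section \<open>Piecewise polynomial forms\<close>

text \<open>A piecewise function is a family of functions on the plane, one for each small triangle. The members
  define a single function on the triangle when they agree on the interior edges, which are the
  segments \<open>ray a t\<close> with \<open>0 \<le> t \<le> 1\<close>.\<close>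

definition ray_cont :: "('v \<Rightarrow> 'v \<Rightarrow> 'b) \<Rightarrow> bool" where
  "ray_cont F \<longleftrightarrow> (\<forall>a\<in>V. \<forall>b\<in>V - {a}. \<forall>c\<in>V - {a}. \<forall>t\<in>{0..1}. F b (ray a t) = F c (ray a t))"

lemma ray_contI:
  assumes "\<And>a b c t. \<lbrakk>a \<in> V; b \<in> V; c \<in> V; b \<noteq> a; c \<noteq> a; b \<noteq> c; 0 \<le> t; t \<le> 1\<rbrakk>
     \<Longrightarrow> F b (ray a t) = F c (ray a t)"
  shows "ray_cont F"
  unfolding ray_cont_def
proof (intro ballI)
  fix a b c t assume "a \<in> V" "b \<in> V - {a}" "c \<in> V - {a}" "t \<in> {0..1::real}"
  then show "F b (ray a t) = F c (ray a t)"
    using assms[of a b c t] by (cases "b = c") auto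
qed

lemma ray_contD:
  "ray_cont F \<Longrightarrow> a \<in> V \<Longrightarrow> b \<in> V \<Longrightarrow> c \<in> V \<Longrightarrow> b \<noteq> a \<Longrightarrow> c \<noteq> a \<Longrightarrow> 0 \<le> t \<Longrightarrow> t \<le> 1
     \<Longrightarrow> F b (ray a t) = F c (ray a t)"
  unfolding ray_cont_def by (meson DiffI atLeastAtMost_iff singletonD)

lemma ray_cont_subtri:
  assumes "ray_cont F" "b \<in> V" "c \<in> V" "x \<in> subtri b" "x \<in> subtri c"
  shows "F b x = F c x"
proof (cases "b = c")
  case False
  then obtain a t where "a \<in> V" "a \<noteq> b" "a \<noteq> c" "0 \<le> t" "t \<le> 1" "x = ray a t"
    using subtri_overlap[OF assms(2,3) _ assms(4,5)] by metis
  then show ?thesis using ray_contD[OF assms(1)] assms by metis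
qed simp

lemma ray_cont_from_field:
  assumes "form_model k \<iota>" "\<And>c x. c \<in> V \<Longrightarrow> x \<in> subtri c \<Longrightarrow> u x = \<iota> (F c x)"
  shows "ray_cont F"
proof (rule ray_contI)
  fix a b c t
  assume "a \<in> V" "b \<in> V" "c \<in> V" "b \<noteq> a" "c \<noteq> a" "0 \<le> (t::real)" "t \<le> 1"
  then have "\<iota> (F b (ray a t)) = \<iota> (F c (ray a t))"
    using assms(2) by (metis ray_in_subtri)
  then show "F b (ray a t) = F c (ray a t)" by (rule form_model_inj[OF assms(1)])
qed

text \<open>For a family with \<open>ray_cont\<close> the choice of the small triangle does not matter (\<open>glue_eq\<close>).\<close>

definition glue :: "('b \<Rightarrow> 'v form) \<Rightarrow> ('v \<Rightarrow> 'v \<Rightarrow> 'b) \<Rightarrow> 'v field" where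
  "glue \<iota> F x = (if x \<in> cell V then \<iota> (F (SOME c. c \<in> V \<and> x \<in> subtri c) x) else zero_form)"

lemma some_subtri:
  assumes "x \<in> cell V"
  shows "(SOME c. c \<in> V \<and> x \<in> subtri c) \<in> V" "x \<in> subtri (SOME c. c \<in> V \<and> x \<in> subtri c)"
proof -
  have "\<exists>c. c \<in> V \<and> x \<in> subtri c" using assms cell_eq_Union by blast
  from someI_ex[OF this]
  show "(SOME c. c \<in> V \<and> x \<in> subtri c) \<in> V" "x \<in> subtri (SOME c. c \<in> V \<and> x \<in> subtri c)" by auto
qed

lemma glue_eq:
  assumes "ray_cont F" "c \<in> V" "x \<in> subtri c"
  shows "glue \<iota> F x = \<iota> (F c x)"
proof -
  have x: "x \<in> cell V" using assms subtri_subset by blast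
  show ?thesis
    using ray_cont_subtri[OF assms(1) some_subtri(1)[OF x] assms(2) some_subtri(2)[OF x] assms(3)] x
    by (simp add: glue_def)
qed

lemma glue_outside: "x \<notin> cell V \<Longrightarrow> glue \<iota> F x = zero_form"
  by (simp add: glue_def)

lemma eq_glueI:
  assumes "ray_cont F" "\<And>c x. c \<in> V \<Longrightarrow> x \<in> subtri c \<Longrightarrow> u x = \<iota> (F c x)"
    "\<And>x. x \<notin> cell V \<Longrightarrow> u x = zero_form"
  shows "u = glue \<iota> F"
proof
  fix x
  show "u x = glue \<iota> F x"
  proof (cases "x \<in> cell V")
    case True
    then obtain c where "c \<in> V" "x \<in> subtri c" by (auto simp: cell_eq_Union)
    then show ?thesis using assms(2) glue_eq[OF assms(1)] by simp
  next
    case False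
    then show ?thesis using assms(3)[OF False] glue_outside[OF False] by metis
  qed
qed

lemma glue_continuous:
  assumes m: "form_model k \<iota>" and F: "\<And>c. c \<in> V \<Longrightarrow> vpoly q (F c)" and r: "ray_cont F"
  shows "continuous_field_on (cell V) (glue \<iota> F)"
proof -
  let ?U = "\<lambda>x. F (SOME c. c \<in> V \<and> x \<in> subtri c) x"
  have "continuous_on (subtri c) ?U" if c: "c \<in> V" for c
  proof (subst continuous_on_cong[OF refl])
    fix x assume x: "x \<in> subtri c"
    then have "x \<in> cell V" using subtri_subset c by blast
    then show "?U x = F c x" using ray_cont_subtri[OF r some_subtri(1) c some_subtri(2) x] by simp
  qed (rule vpoly_continuous_on[OF F[OF c]])
  then have "continuous_on (\<Union>c\<in>V. subtri c) ?U"
    by (intro continuous_on_closed_Union) (auto simp: closed_subtri)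
  then have "continuous_on (cell V) ?U" by (simp add: cell_eq_Union)
  then show ?thesis
    by (subst form_model_continuous_iff[OF m, of _ _ ?U]) (auto simp: glue_def)
qed

text \<open>A piecewise polynomial field is one function, so its pieces agree on the interior edges: the
  corresponding family satisfies \<open>ray_cont\<close>, and the field is continuous by \<open>glue_continuous\<close>.\<close>

lemma glue_fields_iff:
  fixes \<iota> :: "'b::euclidean_space \<Rightarrow> 'v form"
  assumes m: "form_model k \<iota>"
  shows "u \<in> fields_on (cell V) k \<and> (\<forall>S\<in>split V W. poly_field_on q S u) \<longleftrightarrow>
    (\<exists>F. (\<forall>c\<in>V. vpoly q (F c)) \<and> ray_cont F \<and> u = glue \<iota> F)"
proof
  assume u: "u \<in> fields_on (cell V) k \<and> (\<forall>S\<in>split V W. poly_field_on q S u)"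
  have "\<exists>U. vpoly q U \<and> (\<forall>x\<in>subtri c. u x = \<iota> (U x))" if c: "c \<in> V" for c
  proof -
    have "u x \<in> Alt k" if "x \<in> subtri c" for x
      using u subtri_subset[OF c] that unfolding fields_on_def by blast
    moreover have "poly_field_on q (subtri c) u" using u c by (simp add: split_V)
    ultimately show ?thesis using form_model_poly_fieldE[OF m, of "subtri c" u q] by metis
  qed
  then obtain F where F: "\<And>c. c \<in> V \<Longrightarrow> vpoly q (F c)"
    "\<And>c x. c \<in> V \<Longrightarrow> x \<in> subtri c \<Longrightarrow> u x = \<iota> (F c x)" by metis
  have r: "ray_cont F" using ray_cont_from_field[OF m F(2)] .
  have "u = glue \<iota> F"
  proof (rule eq_glueI[OF r])
    show "u x = \<iota> (F c x)" if "c \<in> V" "x \<in> subtri c" for c x using F(2) that .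
    show "u x = zero_form" if "x \<notin> cell V" for x using u that by (auto simp: fields_on_def)
  qed
  then show "\<exists>F. (\<forall>c\<in>V. vpoly q (F c)) \<and> ray_cont F \<and> u = glue \<iota> F" using F r by blast
next
  assume "\<exists>F. (\<forall>c\<in>V. vpoly q (F c)) \<and> ray_cont F \<and> u = glue \<iota> F"
  then obtain F where F: "\<And>c. c \<in> V \<Longrightarrow> vpoly q (F c)" "ray_cont F" "u = glue \<iota> F" by blast
  have "u \<in> fields_on (cell V) k"
    using form_model_Alt[OF m] by (auto simp: fields_on_def F(3) glue_def)
  moreover have "poly_field_on q (subtri c) u" if "c \<in> V" for c
    using form_model_poly_field_on[OF m F(1)[OF that], of "subtri c" u] glue_eq[OF F(2) that] F(3) by auto
  ultimately show "u \<in> fields_on (cell V) k \<and> (\<forall>S\<in>split V W. poly_field_on q S u)"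
    by (auto simp: split_V)
qed

lemmas scalar_model = form_model_scalar
lemmas form1_model = form_model_form1
lemma form2_model: "form_model 2 (form2 :: real \<Rightarrow> 'v form)"
  by (rule form_model_form2[OF dim])

text \<open>The derivative \<open>D c\<close> of each piece is determined on its small triangle, hence an exterior derivative
  exists exactly if these pieces fit together, and then it is the glued field.\<close>

lemma is_ext_deriv_glue:
  fixes D :: "'v \<Rightarrow> 'v \<Rightarrow> 'b::euclidean_space"
  assumes m: "form_model k \<kappa>"
    and D: "\<And>c. c \<in> V \<Longrightarrow> vpoly q (D c)"
    and adm: "\<And>c z. c \<in> V \<Longrightarrow> admissible (subtri c) u z \<longleftrightarrow>
        (\<forall>x\<in>subtri c. \<forall>vs. set vs \<subseteq> tangent (subtri c) \<longrightarrow> z x vs = \<kappa> (D c x) vs)"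
  shows "is_ext_deriv V W u z \<longleftrightarrow> ray_cont D \<and> z = glue \<kappa> D"
    and "ray_cont D \<Longrightarrow> ext_deriv V W u = glue \<kappa> D"
proof -
  have adm': "admissible (subtri c) u z \<longleftrightarrow> (\<forall>x\<in>subtri c. z x = \<kappa> (D c x))" if "c \<in> V" for c z
    using adm[OF that] tangent_subtri[OF that] by (auto simp: fun_eq_iff)
  have *: "is_ext_deriv V W u z \<longleftrightarrow> ray_cont D \<and> z = glue \<kappa> D" for z
  proof
    assume z: "is_ext_deriv V W u z"
    then have e: "z x = \<kappa> (D c x)" if "c \<in> V" "x \<in> subtri c" for c x
      using that by (auto simp: is_ext_deriv_def split_V adm')
    have r: "ray_cont D" by (rule ray_cont_from_field[OF m e])
    moreover have "z = glue \<kappa> D"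
    proof (rule eq_glueI[OF r])
      show "z x = \<kappa> (D c x)" if "c \<in> V" "x \<in> subtri c" for c x using e that .
      show "z x = zero_form" if "x \<notin> cell V" for x using z that by (auto simp: is_ext_deriv_def)
    qed
    ultimately show "ray_cont D \<and> z = glue \<kappa> D" by blast
  next
    assume r: "ray_cont D \<and> z = glue \<kappa> D"
    then show "is_ext_deriv V W u z"
      using glue_continuous[OF m D] glue_eq[of D] glue_outside[of _ \<kappa> D]
      by (auto simp: is_ext_deriv_def split_V adm')
  qed
  show "is_ext_deriv V W u z \<longleftrightarrow> ray_cont D \<and> z = glue \<kappa> D" by (rule *)
  show "ext_deriv V W u = glue \<kappa> D" if "ray_cont D"
    unfolding ext_deriv_def using that by (intro the_equality) (auto simp: *)
qed

lemma ext_deriv_scalar: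
  assumes F: "\<And>c. c \<in> V \<Longrightarrow> poly_deg_le q (F c)" and r: "ray_cont F"
  shows "is_ext_deriv V W (glue scalar F) z \<longleftrightarrow>
      ray_cont (\<lambda>c. grad (F c)) \<and> z = glue form1 (\<lambda>c. grad (F c))"
    and "ray_cont (\<lambda>c. grad (F c)) \<Longrightarrow>
      ext_deriv V W (glue scalar F) = glue form1 (\<lambda>c. grad (F c))"
proof -
  have adm: "admissible (subtri c) (glue scalar F) z \<longleftrightarrow>
        (\<forall>x\<in>subtri c. \<forall>vs. set vs \<subseteq> tangent (subtri c) \<longrightarrow> z x vs = form1 (grad (F c) x) vs)"
    if "c \<in> V" for c z
    by (rule admissible_scalar_iff[OF convex_subtri F[OF that]]) (rule glue_eq[OF r that])
  note * = is_ext_deriv_glue[OF form1_model vpoly_grad[OF F] adm]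
  show "is_ext_deriv V W (glue scalar F) z \<longleftrightarrow>
      ray_cont (\<lambda>c. grad (F c)) \<and> z = glue form1 (\<lambda>c. grad (F c))"
    "ray_cont (\<lambda>c. grad (F c)) \<Longrightarrow>
      ext_deriv V W (glue scalar F) = glue form1 (\<lambda>c. grad (F c))"
    by (rule *; assumption)+
qed

lemma ext_deriv_form1:
  assumes F: "\<And>c. c \<in> V \<Longrightarrow> vpoly q (F c)" and r: "ray_cont F"
  shows "is_ext_deriv V W (glue form1 F) z \<longleftrightarrow>
      ray_cont (\<lambda>c. curl (F c)) \<and> z = glue form2 (\<lambda>c. curl (F c))"
    and "ray_cont (\<lambda>c. curl (F c)) \<Longrightarrow>
      ext_deriv V W (glue form1 F) = glue form2 (\<lambda>c. curl (F c))"
proof -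
  have adm: "admissible (subtri c) (glue form1 F) z \<longleftrightarrow>
        (\<forall>x\<in>subtri c. \<forall>vs. set vs \<subseteq> tangent (subtri c) \<longrightarrow> z x vs = form2 (curl (F c) x) vs)"
    if "c \<in> V" for c z
    by (rule admissible_form1_iff[OF dim convex_subtri F[OF that]]) (rule glue_eq[OF r that])
  have p: "vpoly (q - 1) (curl (F c))" if "c \<in> V" for c using poly_curl[OF F[OF that]] by simp
  note * = is_ext_deriv_glue[OF form2_model p adm]
  show "is_ext_deriv V W (glue form1 F) z \<longleftrightarrow>
      ray_cont (\<lambda>c. curl (F c)) \<and> z = glue form2 (\<lambda>c. curl (F c))"
    "ray_cont (\<lambda>c. curl (F c)) \<Longrightarrow>
      ext_deriv V W (glue form1 F) = glue form2 (\<lambda>c. curl (F c))"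
    by (rule *; assumption)+
qed

text \<open>At a point of an interior edge the derivative within the triangle is assembled from the derivatives
  within the small triangles that contain the point; the remaining small triangles are closed and
  stay away from it.\<close>

lemma C1_on_glue_iff:
  assumes F: "\<And>c. c \<in> V \<Longrightarrow> poly_deg_le q (F c)" and r: "ray_cont F"
  shows "C1_on (cell V) (\<lambda>x. glue scalar F x []) \<longleftrightarrow> ray_cont (\<lambda>c. grad (F c))"
proof
  let ?f = "\<lambda>x. glue scalar F x []"
  have f: "?f x = F c x" if "c \<in> V" "x \<in> subtri c" for c x
    using glue_eq[OF r that, of scalar] by simp
  have dT: "(?f has_derivative (\<bullet>) (grad (F c) x)) (at x within subtri c)" if "c \<in> V" "x \<in> subtri c" for c x
    by (rule has_derivative_transform[OF that(2) _
          has_derivative_at_withinI[OF poly_has_derivative[OF F[OF that(1)]]]]) (use f that in auto)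
  {
    assume "C1_on (cell V) ?f"
    then obtain f' :: "'v \<Rightarrow> 'v \<Rightarrow>\<^sub>L real" where
      f': "\<And>x. x \<in> cell V \<Longrightarrow> (?f has_derivative blinfun_apply (f' x)) (at x within cell V)"
      unfolding C1_on_def by blast
    have e: "f' x v = grad (F c) x \<bullet> v" if "c \<in> V" "x \<in> subtri c" for c x v
    proof (rule derivative_within_tangent_unique[OF convex_subtri that(2) _ _ dT[OF that]])
      show "v \<in> tangent (subtri c)" by (simp add: tangent_subtri[OF that(1)])
      show "(?f has_derivative blinfun_apply (f' x)) (at x within subtri c)"
        using has_derivative_subset[OF f' subtri_subset] that subtri_subset by blast
    qed
    show "ray_cont (\<lambda>c. grad (F c))"
    proof (rule ray_contI, rule vector_eq_ldot[THEN iffD1], rule allI)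
      fix a b c t v
      assume "a \<in> V" "b \<in> V" "c \<in> V" "b \<noteq> a" "c \<noteq> a" "0 \<le> (t::real)" "t \<le> 1"
      then have "f' (ray a t) v = grad (F b) (ray a t) \<bullet> v" "f' (ray a t) v = grad (F c) (ray a t) \<bullet> v"
        by (auto intro!: e ray_in_subtri)
      then show "v \<bullet> grad (F b) (ray a t) = v \<bullet> grad (F c) (ray a t)"
        by (simp add: inner_commute)
    qed
  }
  assume rg: "ray_cont (\<lambda>c. grad (F c))"
  let ?U = "\<lambda>x. grad (F (SOME c. c \<in> V \<and> x \<in> subtri c)) x"
  have U: "?U x = grad (F c) x" if "c \<in> V" "x \<in> subtri c" for c x
    using ray_cont_subtri[OF rg some_subtri(1) that(1) some_subtri(2) that(2)] subtri_subset that by blast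
  have "continuous_field_on (cell V) (glue form1 (\<lambda>c. grad (F c)))"
    by (rule glue_continuous[OF form1_model vpoly_grad[OF F] rg])
  then have cU: "continuous_on (cell V) ?U"
    by (subst (asm) form_model_continuous_iff[OF form1_model, of _ _ ?U]) (auto simp: glue_def)
  show "C1_on (cell V) ?f"
    unfolding C1_on_def
  proof (intro exI[of _ "\<lambda>x. blinfun_inner_left (?U x)"] conjI ballI)
    show "continuous_on (cell V) (\<lambda>x. blinfun_inner_left (?U x))"
      by (rule bounded_linear.continuous_on[OF bounded_linear_blinfun_inner_left cU])
    fix x assume x: "x \<in> cell V"
    have *: "((\<lambda>y. norm (?f y - ?f x - ?U x \<bullet> (y - x)) / norm (y - x)) \<longlongrightarrow> 0) (at x within subtri c)"
      if c: "c \<in> V" for c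
    proof (cases "x \<in> subtri c")
      case True
      then show ?thesis
        using dT[OF c True] unfolding U[OF c True] has_derivative_iff_norm by blast
    next
      case False
      then have "at x within subtri c = bot"
        using closed_subtri[of c] by (auto simp: trivial_limit_within closed_limpt)
      then show ?thesis by simp
    qed
    obtain a b c where V: "V = {a, b, c}"
      using card_V by (auto simp: card_3_iff)
    have "((\<lambda>y. norm (?f y - ?f x - ?U x \<bullet> (y - x)) / norm (y - x)) \<longlongrightarrow> 0)
       (at x within subtri a \<union> (subtri b \<union> subtri c))"
      unfolding at_within_union by (intro filterlim_sup *) (auto simp: V)
    moreover have "cell V = subtri a \<union> (subtri b \<union> subtri c)"
      unfolding cell_eq_Union by (auto simp: V)
    ultimately show "(?f has_derivative blinfun_apply (blinfun_inner_left (?U x))) (at x within cell V)"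
      unfolding has_derivative_iff_norm
      by (simp add: bounded_linear_inner_left inner_commute)
  qed
qed


section \<open>Homogeneous extension and division\<close>

lemma poly_gam: "poly_deg_le (Suc 0) (gam c)"
  unfolding gam_def[abs_def] by (rule poly_deg_le_affine)

lemma poly_gam_mult: "poly_deg_le q f \<Longrightarrow> poly_deg_le (Suc q) (\<lambda>x. gam c x * f x)"
  using poly_deg_le_mult[OF poly_gam] by simp

lemma vpoly_gam_scaleR: "vpoly q f \<Longrightarrow> vpoly (Suc q) (\<lambda>x. gam c x *\<^sub>R f x)"
  using vpoly_scaleR[OF poly_gam] by fastforce

lemma grad_gam: "grad (gam c) x = G c"
  unfolding gam_def[abs_def] by (rule grad_affine)

text \<open>A direction along which \<open>gam c\<close> grows at unit speed.\<close>

definition tau :: "'v \<Rightarrow> 'v" where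
  "tau c = G c /\<^sub>R (G c \<bullet> G c)"

lemma G_tau:
  assumes "c \<in> V"
  shows "G c \<bullet> tau c = 1"
proof -
  obtain a where "a \<in> V" "a \<noteq> c" using two_others[OF assms] by metis
  then have "G c \<noteq> 0" using G_vertex[of c a] assms by auto
  then show ?thesis by (simp add: tau_def)
qed

lemma gam_dilate: "gam c (W + t *\<^sub>R (x - W)) = 1 - t * (1 - gam c x)"
  by (simp add: gam_def)

definition homogeneous :: "nat \<Rightarrow> ('v \<Rightarrow> 'b::real_vector) \<Rightarrow> bool" where
  "homogeneous q h \<longleftrightarrow> (\<forall>x t. h (W + t *\<^sub>R (x - W)) = t ^ q *\<^sub>R h x)"

lemma homogeneous_ray: "homogeneous q h \<Longrightarrow> h (ray a t) = t ^ q *\<^sub>R h a"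
  by (simp add: homogeneous_def ray_def)

text \<open>On the line through the edge \<open>1 - gam c\<close> equals \<open>1\<close>, and it is homogeneous of degree \<open>1\<close> about \<open>W\<close>. So
  a polynomial becomes homogeneous, without change on the line, when every affine function
  \<open>k + l (x - W)\<close> in it is replaced by \<open>k (1 - gam c x) + l (x - W)\<close>.\<close>

lemma homogeneous_extension_scalar:
  assumes "poly_deg_le q g"
  shows "\<exists>H. poly_deg_le q H \<and> homogeneous q H \<and> (\<forall>x. gam c x = 0 \<longrightarrow> H x = g x)"
  using assms
proof induction
  case (const q k)
  have "poly_deg_le (q * 1) (\<lambda>x. (1 - gam c x) ^ q)"
    using poly_gam by (intro poly_deg_le_power poly_deg_le_diff poly_deg_le.const) simp
  then have "poly_deg_le q (\<lambda>x. k * (1 - gam c x) ^ q)"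
    by (intro poly_deg_le_cmult) simp
  moreover have "homogeneous q (\<lambda>x. k * (1 - gam c x) ^ q)"
    by (simp add: homogeneous_def gam_dilate power_mult_distrib)
  ultimately show ?case by (intro exI[of _ "\<lambda>x. k * (1 - gam c x) ^ q"]) auto
next
  case (add q f g)
  then obtain F H where "poly_deg_le q F" "homogeneous q F" "\<forall>x. gam c x = 0 \<longrightarrow> F x = f x"
    "poly_deg_le q H" "homogeneous q H" "\<forall>x. gam c x = 0 \<longrightarrow> H x = g x" by blast
  then show ?case
    by (intro exI[of _ "\<lambda>x. F x + H x"]) (auto intro: poly_deg_le.add simp: homogeneous_def distrib_left)
next
  case (mult l q f)
  interpret l: bounded_linear l by fact
  obtain F where F: "poly_deg_le q F" "homogeneous q F" "\<forall>x. gam c x = 0 \<longrightarrow> F x = f x"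
    using mult.IH by blast
  let ?L = "\<lambda>x. l W * (1 - gam c x) + (l x - l W)"
  have "poly_deg_le (Suc 0) ?L"
    using poly_gam poly_deg_le_linear[OF mult(1)]
    by (intro poly_deg_le.add poly_deg_le_cmult poly_deg_le_diff poly_deg_le.const) auto
  then have "poly_deg_le (Suc q) (\<lambda>x. ?L x * F x)"
    using poly_deg_le_mult[OF _ F(1)] by fastforce
  moreover have "homogeneous (Suc q) (\<lambda>x. ?L x * F x)"
  proof -
    have "?L (W + t *\<^sub>R (x - W)) = t * ?L x" for x t
      unfolding gam_dilate l.add l.scaleR l.diff by (simp add: algebra_simps)
    then show ?thesis using F(2) by (simp add: homogeneous_def)
  qed
  moreover have "\<forall>x. gam c x = 0 \<longrightarrow> ?L x * F x = l x * f x"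
    using F(3) by auto
  ultimately show ?case by blast
qed

lemma homogeneous_extension:
  fixes g :: "'v \<Rightarrow> 'b::euclidean_space"
  assumes "vpoly q g"
  shows "\<exists>H. vpoly q H \<and> homogeneous q H \<and> (\<forall>x. gam c x = 0 \<longrightarrow> H x = g x)"
proof -
  have "\<forall>i\<in>Basis. \<exists>H. poly_deg_le q H \<and> homogeneous q H \<and> (\<forall>x. gam c x = 0 \<longrightarrow> H x = g x \<bullet> i)"
    using assms homogeneous_extension_scalar by (auto simp: vpoly_def)
  then obtain H where H: "\<And>i. i \<in> Basis \<Longrightarrow> poly_deg_le q (H i)"
    "\<And>i. i \<in> Basis \<Longrightarrow> homogeneous q (H i)"
    "\<And>i x. i \<in> Basis \<Longrightarrow> gam c x = 0 \<Longrightarrow> H i x = g x \<bullet> i" by metis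
  let ?H = "\<lambda>x. \<Sum>i\<in>Basis. H i x *\<^sub>R i"
  have "vpoly q ?H" using H(1) by (intro vpoly_sum vpoly_scaleR_const)
  moreover have "homogeneous q ?H"
    unfolding homogeneous_def scaleR_sum_right using H(2)
    by (intro allI sum.cong) (auto simp: homogeneous_def)
  moreover have "?H x = g x" if "gam c x = 0" for x
    using H(3)[OF _ that] by (simp add: euclidean_representation)
  ultimately show ?thesis by blast
qed

text \<open>The point \<open>x - gam c x *\<^sub>R tau c\<close> is the projection of \<open>x\<close> onto the line \<open>gam c = 0\<close> along \<open>tau c\<close>; the
  change of a polynomial under this projection is divisible by \<open>gam c\<close>.\<close>

lemma division_scalar:
  assumes c: "c \<in> V" and g: "poly_deg_le q g"
  shows "\<exists>g'. poly_deg_le (q - 1) g' \<and>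
    (\<forall>x. g x = g (x - gam c x *\<^sub>R tau c) + gam c x * g' x)"
  using g
proof induction
  case (const q k)
  then show ?case by (intro exI[of _ "\<lambda>_. 0"]) (auto intro: poly_deg_le.const)
next
  case (add q f g)
  then obtain F H where F: "poly_deg_le (q - 1) F"
    "\<And>x. f x = f (x - gam c x *\<^sub>R tau c) + gam c x * F x"
    and H: "poly_deg_le (q - 1) H" "\<And>x. g x = g (x - gam c x *\<^sub>R tau c) + gam c x * H x"
    by blast
  have "f x + g x = (f (x - gam c x *\<^sub>R tau c) + g (x - gam c x *\<^sub>R tau c)) + gam c x * (F x + H x)"
    for x
    using F(2)[of x] H(2)[of x] by (simp only: distrib_left)
  then show ?case
    using poly_deg_le.add[OF F(1) H(1)] by blast
next
  case (mult l q f)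
  interpret l: bounded_linear l by fact
  show ?case
  proof (cases q)
    case 0
    then obtain k where k: "f = (\<lambda>_. k)" using mult(2) poly_deg_le_0D by metis
    show ?thesis
      by (intro exI[of _ "\<lambda>_. l (tau c) * k"])
         (auto simp: k l.diff l.scaleR algebra_simps intro: poly_deg_le.const)
  next
    case (Suc r)
    obtain F where F: "poly_deg_le r F" "\<And>x. f x = f (x - gam c x *\<^sub>R tau c) + gam c x * F x"
      using mult.IH Suc by auto
    let ?l = "\<lambda>x. l x - l (tau c) * gam c x"
    have "poly_deg_le (Suc 0) ?l"
      using poly_gam poly_deg_le_linear[OF mult(1)]
      by (intro poly_deg_le_diff poly_deg_le_cmult) auto
    then have p: "poly_deg_le q (\<lambda>x. l (tau c) * f x + ?l x * F x)"
      using poly_deg_le_mult[OF _ F(1), of "Suc 0" ?l] mult(2) Suc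
      by (intro poly_deg_le.add poly_deg_le_cmult) auto
    have e: "l x * f x = l (x - gam c x *\<^sub>R tau c) * f (x - gam c x *\<^sub>R tau c)
        + gam c x * (l (tau c) * f x + ?l x * F x)" for x
    proof -
      define y where "y = f (x - gam c x *\<^sub>R tau c)"
      have y: "f x = y + gam c x * F x" using F(2)[of x] unfolding y_def .
      show ?thesis
        unfolding y_def[symmetric] l.diff l.scaleR y real_scaleR_def by algebra
    qed
    show ?thesis
      unfolding diff_Suc_1 using p e by blast
  qed
qed

lemma division:
  fixes g :: "'v \<Rightarrow> 'b::euclidean_space"
  assumes c: "c \<in> V" and g: "vpoly (Suc m) g" and z: "\<And>x. gam c x = 0 \<Longrightarrow> g x = 0"
  shows "\<exists>g'. vpoly m g' \<and> (\<forall>x. g x = gam c x *\<^sub>R g' x)"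
proof -
  have zero: "gam c (x - gam c x *\<^sub>R tau c) = 0" for x
    using gam_diff[of c x "x - gam c x *\<^sub>R tau c"] G_tau[OF c] by simp
  have "\<exists>g'. poly_deg_le m g' \<and> (\<forall>x. g x \<bullet> i = gam c x * g' x)" if "i \<in> Basis" for i
    using division_scalar[OF c, of "Suc m" "\<lambda>x. g x \<bullet> i"] g that z[OF zero]
    by (simp add: vpoly_def)
  then obtain g' where g': "\<And>i. i \<in> Basis \<Longrightarrow> poly_deg_le m (g' i)"
    "\<And>i x. i \<in> Basis \<Longrightarrow> g x \<bullet> i = gam c x * g' i x" by metis
  have "g x = gam c x *\<^sub>R (\<Sum>i\<in>Basis. g' i x *\<^sub>R i)" for x
    by (subst euclidean_representation[of "g x", symmetric]) (simp add: g'(2) scaleR_sum_right)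
  moreover have "vpoly m (\<lambda>x. \<Sum>i\<in>Basis. g' i x *\<^sub>R i)"
    using g'(1) by (intro vpoly_sum vpoly_scaleR_const)
  ultimately show ?thesis by blast
qed

lemma ray_cont_map2:
  assumes "ray_cont F" "ray_cont H"
  shows "ray_cont (\<lambda>c x. f (F c x) (H c x))"
  using assms unfolding ray_cont_def by metis

lemmas ray_cont_add = ray_cont_map2[of _ _ "(+)"]
lemmas ray_cont_diff = ray_cont_map2[of _ _ "(-)"]
lemmas ray_cont_mult = ray_cont_map2[of _ _ "(*)"]
lemmas ray_cont_scaleR = ray_cont_map2[of _ _ "(*\<^sub>R)"]

lemma ray_cont_map: "ray_cont F \<Longrightarrow> ray_cont (\<lambda>c x. f (F c x))"
  using ray_cont_map2[of F F "\<lambda>x y. f x"] by simp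

lemma ray_cont_eq: "ray_cont H \<Longrightarrow> (\<And>c x. c \<in> V \<Longrightarrow> F c x = H c x) \<Longrightarrow> ray_cont F"
  unfolding ray_cont_def by (metis DiffD1)

lemma ray_cont_const: "ray_cont (\<lambda>_ x. f x)"
  by (simp add: ray_cont_def)

lemma ray_cont_gam: "ray_cont gam"
  by (rule ray_contI) (simp add: gam_ray_other)

text \<open>On an interior edge a homogeneous function is determined by its value at the end.\<close>

lemma homogeneous_ray_cont:
  assumes "\<And>c. c \<in> V \<Longrightarrow> homogeneous q (H c)"
    and "\<And>a b c. \<lbrakk>a \<in> V; b \<in> V; c \<in> V; b \<noteq> a; c \<noteq> a\<rbrakk> \<Longrightarrow> H b a = H c a"
  shows "ray_cont H"
proof (rule ray_contI)
  fix a b c t assume "a \<in> V" "b \<in> V" "c \<in> V" "b \<noteq> a" "c \<noteq> a"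
  then show "H b (ray a t) = H c (ray a t)"
    using homogeneous_ray[OF assms(1)] assms(2) by metis
qed

lemma homogeneous_family:
  fixes f :: "'v \<Rightarrow> 'v \<Rightarrow> 'b::euclidean_space"
  assumes f: "\<And>c. c \<in> V \<Longrightarrow> vpoly q (f c)"
    and v: "\<And>a b c. \<lbrakk>a \<in> V; b \<in> V; c \<in> V; b \<noteq> a; c \<noteq> a\<rbrakk> \<Longrightarrow> f b a = f c a"
  obtains H where "\<And>c. c \<in> V \<Longrightarrow> vpoly q (H c)" "ray_cont H"
    "\<And>c x. c \<in> V \<Longrightarrow> gam c x = 0 \<Longrightarrow> H c x = f c x"
proof -
  have "\<forall>c\<in>V. \<exists>H. vpoly q H \<and> homogeneous q H \<and> (\<forall>x. gam c x = 0 \<longrightarrow> H x = f c x)"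
    using homogeneous_extension[OF f] by blast
  then obtain H where H: "\<And>c. c \<in> V \<Longrightarrow> vpoly q (H c)" "\<And>c. c \<in> V \<Longrightarrow> homogeneous q (H c)"
    "\<And>c x. c \<in> V \<Longrightarrow> gam c x = 0 \<Longrightarrow> H c x = f c x" by metis
  have "ray_cont H"
  proof (rule homogeneous_ray_cont[OF H(2)])
    fix a b c assume "a \<in> V" "b \<in> V" "c \<in> V" "b \<noteq> a" "c \<noteq> a"
    then show "H b a = H c a" using v[of a b c] H(3)[of b a] H(3)[of c a] by simp
  qed
  then show thesis using that H by blast
qed

text \<open>The weight of \<open>K a\<close> is a barycentric coordinate in \<open>subtri c\<close>, zero for \<open>a = c\<close>. The power of
  \<open>1 - gam c\<close>, which is \<open>1\<close> on the edge, raises the degree to \<open>m + 1\<close>.\<close>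

definition vertex_interp :: "nat \<Rightarrow> ('v \<Rightarrow> 'b::euclidean_space) \<Rightarrow> 'v \<Rightarrow> 'v \<Rightarrow> 'b" where
  "vertex_interp m K c x = (\<Sum>a\<in>V. (w a * (gam a x - gam c x) * (1 - gam c x) ^ m) *\<^sub>R K a)"

lemma vpoly_vertex_interp: "vpoly (Suc m) (vertex_interp m K c)"
  unfolding vertex_interp_def[abs_def]
proof (intro vpoly_sum vpoly_scaleR_const)
  fix a
  have "poly_deg_le (m * 1) (\<lambda>x. (1 - gam c x) ^ m)"
    using poly_gam by (intro poly_deg_le_power poly_deg_le_diff poly_deg_le.const) simp
  moreover have "poly_deg_le 1 (\<lambda>x. w a * (gam a x - gam c x))"
    using poly_gam by (intro poly_deg_le_cmult poly_deg_le_diff) simp_all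
  ultimately have "poly_deg_le (1 + m * 1) (\<lambda>x. w a * (gam a x - gam c x) * (1 - gam c x) ^ m)"
    by (intro poly_deg_le_mult)
  then show "poly_deg_le (Suc m) (\<lambda>x. w a * (gam a x - gam c x) * (1 - gam c x) ^ m)"
    by simp
qed

lemma ray_cont_vertex_interp: "ray_cont (vertex_interp m K)"
  by (rule ray_contI) (simp add: vertex_interp_def gam_ray_other)

lemma vertex_interp_vertex:
  assumes "a \<in> V" "c \<in> V" "c \<noteq> a"
  shows "vertex_interp m K c a = K a"
proof -
  have "vertex_interp m K c a = (\<Sum>b\<in>V. if b = a then K a else 0)"
    unfolding vertex_interp_def using assms w_pos[OF assms(1)]
    by (intro sum.cong) (auto simp: gam_vertex)
  then show ?thesis using assms by simp
qed


section \<open>Correcting the divergence across the interior edges\<close>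

text \<open>The correction step for \<open>1\<close>-forms, written for the rotated vector field (\<open>curl_rot\<close>). In positive
  degree the values of \<open>Z\<close> on the boundary are chosen so that the remainder vanishes there: at a
  vertex the two adjacent edges impose two independent linear conditions, and along an edge the
  normal component is free between the vertices. Dividing the remainder by \<open>gam c\<close> lowers the degree
  and raises \<open>j\<close> by one.\<close>

lemma div_correction:
  fixes S :: "'v \<Rightarrow> 'v \<Rightarrow> real" and j :: real
  assumes "\<And>c. c \<in> V \<Longrightarrow> poly_deg_le m (S c)" "0 < j"
  shows "\<exists>Z. (\<forall>c\<in>V. vpoly m (Z c)) \<and> ray_cont Z \<and>
    ray_cont (\<lambda>c x. S c x - j * (G c \<bullet> Z c x) - gam c x * divergence (Z c) x) \<and>
    (0 < m \<longrightarrow> (\<forall>c\<in>V. \<forall>x. gam c x = 0 \<longrightarrow>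
       S c x - j * (G c \<bullet> Z c x) - gam c x * divergence (Z c) x = 0))"
  using assms
proof (induction m arbitrary: S j)
  case 0
  define s where "s c = S c W" for c
  have S: "S c x = s c" if "c \<in> V" for c x
    unfolding s_def using poly_deg_le_0D[OF 0(1)[OF that]] by metis
  \<comment> \<open>for every \<open>c\<close>, subtracting \<open>j * (G c \<bullet> z)\<close> from \<open>S c\<close> leaves the weighted mean of the three values\<close>
  define z where "z = (1 / j) *\<^sub>R (\<Sum>a\<in>V. s a *\<^sub>R (w a *\<^sub>R (a - W)))"
  have z: "j * (G c \<bullet> z) = s c - (\<Sum>a\<in>V. w a * s a)" if c: "c \<in> V" for c
  proof -
    have "j * (G c \<bullet> z) = (\<Sum>a\<in>V. w a * s a * (G c \<bullet> (a - W)))"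
      using 0(2) by (simp add: z_def inner_sum_right mult_ac)
    also have "\<dots> = (\<Sum>a\<in>V. (if a = c then s c else 0) - w a * s a)"
      using w_pos[OF c] by (intro sum.cong) (auto simp: G_vertex c right_diff_distrib)
    finally show ?thesis using c by (simp add: sum_subtractf)
  qed
  have "ray_cont (\<lambda>c x. S c x - j * (G c \<bullet> z) - gam c x * divergence (\<lambda>_. z) x)"
    by (rule ray_contI) (simp add: divergence_const z S)
  then show ?case
    by (intro exI[of _ "\<lambda>_ _. z"]) (auto simp: ray_cont_const vpoly_const)
next
  case (Suc m)
  \<comment> \<open>the solution of \<open>j * (G c \<bullet> K a) = S c a\<close> for the two edges at \<open>a\<close>, in the basis \<open>w x *\<^sub>R (x - a)\<close> dual to \<open>G x\<close>\<close>
  define K where "K a = (1 / j) *\<^sub>R (\<Sum>x\<in>V. S x a *\<^sub>R (w x *\<^sub>R (x - a)))" for a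
  have K: "j * (G c \<bullet> K a) = S c a" if "a \<in> V" "c \<in> V" "c \<noteq> a" for a c
  proof -
    have "j * (G c \<bullet> K a) = (\<Sum>x\<in>V. S x a * (w x * (gam c x - gam c a)))"
      using Suc.prems(2) by (simp add: K_def inner_sum_right gam_diff mult.assoc)
    also have "\<dots> = (\<Sum>x\<in>V. if x = c then S c a else 0)"
      using that w_pos[OF that(2)] by (intro sum.cong) (auto simp: gam_vertex)
    finally show ?thesis using that by simp
  qed
  let ?J = "vertex_interp m K"
  have Z0p: "poly_deg_le (Suc m) (\<lambda>x. G c \<bullet> ?J c x)" for c
    by (rule vpoly_inner'[OF vpoly_vertex_interp])
  have "\<forall>c\<in>V. \<exists>H. vpoly (Suc m) H \<and> homogeneous (Suc m) H \<and>
     (\<forall>x. gam c x = 0 \<longrightarrow> H x = (1 / j) * (S c x - j * (G c \<bullet> ?J c x)))"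
    by (intro ballI homogeneous_extension) (simp add: poly_deg_le_cmult poly_deg_le_diff Suc.prems Z0p
       del: times_divide_eq_left)
  then obtain H where H: "\<And>c. c \<in> V \<Longrightarrow> poly_deg_le (Suc m) (H c)" "\<And>c. c \<in> V \<Longrightarrow> homogeneous (Suc m) (H c)"
    "\<And>c x. c \<in> V \<Longrightarrow> gam c x = 0 \<Longrightarrow> H c x = (1 / j) * (S c x - j * (G c \<bullet> ?J c x))"
    unfolding vpoly_real by metis
  have H0: "H c a = 0" if "a \<in> V" "c \<in> V" "c \<noteq> a" for a c
    using H(3)[of c a] that by (simp add: vertex_interp_vertex K)
  have rH: "ray_cont (\<lambda>c x. H c x *\<^sub>R tau c)"
    by (rule homogeneous_ray_cont[of "Suc m"]) (use H(2) H0 in \<open>auto simp: homogeneous_def\<close>)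
  \<comment> \<open>the second summand adjusts the normal component along the edge and vanishes at its ends\<close>
  define Z' where "Z' c x = ?J c x + H c x *\<^sub>R tau c" for c x
  have rZ': "ray_cont Z'"
    unfolding Z'_def[abs_def] by (rule ray_cont_add[OF ray_cont_vertex_interp rH])
  have pZ': "vpoly (Suc m) (Z' c)" if "c \<in> V" for c
    unfolding Z'_def[abs_def] using H(1)[OF that]
    by (intro vpoly_add vpoly_vertex_interp vpoly_scaleR_const)
  define R where "R c x = S c x - j * (G c \<bullet> Z' c x) - gam c x * divergence (Z' c) x" for c x
  have pR: "vpoly (Suc m) (R c)" if "c \<in> V" for c
    unfolding R_def[abs_def] vpoly_real using poly_divergence[OF pZ'[OF that]]
    by (intro poly_deg_le_diff poly_deg_le_cmult poly_gam_mult vpoly_inner' pZ' Suc.prems that) simp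
  have R0: "R c x = 0" if "c \<in> V" "gam c x = 0" for c x
    using H(3)[OF that] G_tau[OF that(1)] that(2) Suc.prems(2)
    by (simp add: R_def Z'_def inner_add_right algebra_simps)
  have "\<forall>c\<in>V. \<exists>S'. vpoly m S' \<and> (\<forall>x. R c x = gam c x *\<^sub>R S' x)"
    using division[OF _ pR R0] by blast
  then obtain S' where S': "\<And>c. c \<in> V \<Longrightarrow> poly_deg_le m (S' c)"
    "\<And>c x. c \<in> V \<Longrightarrow> R c x = gam c x * S' c x"
    unfolding vpoly_real real_scaleR_def by metis
  obtain Z1 where Z1: "\<And>c. c \<in> V \<Longrightarrow> vpoly m (Z1 c)" "ray_cont Z1"
    "ray_cont (\<lambda>c x. S' c x - (j + 1) * (G c \<bullet> Z1 c x) - gam c x * divergence (Z1 c) x)"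
    using Suc.IH[of S' "j + 1"] S'(1) Suc.prems(2) by auto
  let ?Z = "\<lambda>c x. Z' c x + gam c x *\<^sub>R Z1 c x"
  have e: "S c x - j * (G c \<bullet> ?Z c x) - gam c x * divergence (?Z c) x =
      gam c x * (S' c x - (j + 1) * (G c \<bullet> Z1 c x) - gam c x * divergence (Z1 c) x)"
    if c: "c \<in> V" for c x
  proof -
    have "divergence (?Z c) x = divergence (Z' c) x + (gam c x * divergence (Z1 c) x + G c \<bullet> Z1 c x)"
      by (simp add: divergence_add[OF pZ'[OF c] vpoly_gam_scaleR[OF Z1(1)[OF c]]]
           divergence_scaleR[OF poly_gam Z1(1)[OF c]] grad_gam)
    then have "S c x - j * (G c \<bullet> ?Z c x) - gam c x * divergence (?Z c) x =
      R c x - j * gam c x * (G c \<bullet> Z1 c x) - gam c x * (gam c x * divergence (Z1 c) x + G c \<bullet> Z1 c x)"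
      by (simp add: R_def inner_add_right algebra_simps)
    then show ?thesis
      by (simp add: S'(2)[OF c] algebra_simps)
  qed
  have "ray_cont (\<lambda>c x. S c x - j * (G c \<bullet> ?Z c x) - gam c x * divergence (?Z c) x)"
    by (rule ray_cont_eq[OF ray_cont_mult[OF ray_cont_gam Z1(3)]]) (rule e)
  moreover have "vpoly (Suc m) (?Z c)" if "c \<in> V" for c
    using that by (intro vpoly_add pZ' vpoly_gam_scaleR Z1)
  moreover have "ray_cont ?Z"
    by (rule ray_cont_add[OF rZ' ray_cont_scaleR[OF ray_cont_gam Z1(2)]])
  moreover have "S c x - j * (G c \<bullet> ?Z c x) - gam c x * divergence (?Z c) x = 0"
    if "c \<in> V" "gam c x = 0" for c x
    by (subst e[OF that(1)]) (simp add: that(2))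
  ultimately show ?case by (intro exI[of _ ?Z]) blast
qed


section \<open>Correcting the gradient across the interior edges\<close>

text \<open>The components along the interior edges fit together. Gradients of the pieces of a continuous
  function have this property.\<close>

definition tangent_cont :: "('v \<Rightarrow> 'v \<Rightarrow> 'v) \<Rightarrow> bool" where
  "tangent_cont S \<longleftrightarrow> (\<forall>a\<in>V. \<forall>b\<in>V - {a}. \<forall>c\<in>V - {a}. \<forall>t\<in>{0..1}.
     S b (ray a t) \<bullet> (a - W) = S c (ray a t) \<bullet> (a - W))"

lemma tangent_contD:
  "tangent_cont S \<Longrightarrow> a \<in> V \<Longrightarrow> b \<in> V \<Longrightarrow> c \<in> V \<Longrightarrow> b \<noteq> a \<Longrightarrow> c \<noteq> a \<Longrightarrow> 0 \<le> t \<Longrightarrow> t \<le> 1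
     \<Longrightarrow> S b (ray a t) \<bullet> (a - W) = S c (ray a t) \<bullet> (a - W)"
  unfolding tangent_cont_def by (meson DiffI atLeastAtMost_iff singletonD)

lemma tangent_contI:
  assumes "\<And>a b c t. \<lbrakk>a \<in> V; b \<in> V; c \<in> V; b \<noteq> a; c \<noteq> a; 0 \<le> t; t \<le> 1\<rbrakk>
     \<Longrightarrow> S b (ray a t) \<bullet> (a - W) = S c (ray a t) \<bullet> (a - W)"
  shows "tangent_cont S"
  unfolding tangent_cont_def using assms by auto

lemma tangent_cont_grad:
  assumes F: "\<And>c. c \<in> V \<Longrightarrow> poly_deg_le q (F c)" and r: "ray_cont F"
  shows "tangent_cont (\<lambda>c. grad (F c))"
proof (rule tangent_contI)
  fix a b c t
  assume *: "a \<in> V" "b \<in> V" "c \<in> V" "b \<noteq> a" "c \<noteq> a" "0 \<le> (t::real)" "t \<le> 1"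
  let ?S = "ray a ` {0..1}"
  have ray: "ray a s = (1 - s) *\<^sub>R W + s *\<^sub>R a" for s
    by (simp add: ray_def algebra_simps)
  have "?S = closed_segment W a"
    unfolding closed_segment_def by (auto simp: ray)
  then have "convex ?S" by simp
  moreover have "ray a t \<in> ?S" using * by auto
  moreover have "a - W \<in> tangent ?S"
    by (rule tangentI) (auto intro: image_eqI[of _ _ 1] image_eqI[of _ _ 0])
  ultimately show "grad (F b) (ray a t) \<bullet> (a - W) = grad (F c) (ray a t) \<bullet> (a - W)"
    by (rule grad_eq_along[OF F[OF *(2)] F[OF *(3)]]) (auto intro!: ray_contD[OF r *(1-5)])
qed

text \<open>A jump across the interior edge at \<open>a\<close> without tangential component is a multiple of the jump of the
  gradient of the hat function, because both vanish on \<open>a - W\<close>.\<close>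

lemma jump_normal:
  assumes V: "a \<in> V" "b \<in> V" "c \<in> V" "a \<noteq> b" "b \<noteq> c" "a \<noteq> c" and d: "d \<bullet> (a - W) = 0"
  shows "d = (w b * (d \<bullet> (b - W))) *\<^sub>R (G b - G c)"
proof -
  have Vabc: "V = {a, b, c}"
    using third[of b c] V by (metis insert_iff singletonD)
  let ?k = "w b * (d \<bullet> (b - W))"
  have "d \<bullet> y = (?k *\<^sub>R (G b - G c)) \<bullet> y" for y
  proof (rule linear_eq_on_vertices)
    show "linear (\<lambda>y. d \<bullet> y)" "linear (\<lambda>y. (?k *\<^sub>R (G b - G c)) \<bullet> y)"
      by (rule bounded_linear.linear[OF bounded_linear_inner_right])+
    fix e assume "e \<in> V"
    have "d \<bullet> (\<Sum>a\<in>V. w a *\<^sub>R (a - W)) = 0" by (simp add: sum_w_vertices)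
    then have s: "w b * (d \<bullet> (b - W)) + w c * (d \<bullet> (c - W)) = 0"
      using d V by (simp add: Vabc inner_add_right)
    consider "e = a" | "e = b" | "e = c" using \<open>e \<in> V\<close> Vabc by auto
    then show "d \<bullet> (e - W) = (?k *\<^sub>R (G b - G c)) \<bullet> (e - W)"
    proof cases
      case 1
      then show ?thesis using d V by (simp add: inner_diff_left G_vertex)
    next
      case 2
      then show ?thesis using V w_pos[OF V(2)] by (simp add: inner_diff_left G_vertex)
    next
      case 3
      then show ?thesis using V w_pos[OF V(3)] s
        by (simp add: inner_diff_left G_vertex field_simps)
    qed
  qed
  then show ?thesis by (metis vector_eq_ldot inner_commute)
qed

text \<open>The homogeneous extension \<open>H\<close> of the boundary values is continuous, and the rest vanishes on the
  boundary. Division by \<open>gam c\<close>, which is positive on an interior edge except at its end, preserves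
  tangential continuity; the end is reached by continuity.\<close>

lemma normal_split:
  assumes Q: "\<And>c. c \<in> V \<Longrightarrow> vpoly (Suc m) (Q c)" and t: "tangent_cont Q"
    and v: "\<And>a b c. \<lbrakk>a \<in> V; b \<in> V; c \<in> V; b \<noteq> a; c \<noteq> a\<rbrakk> \<Longrightarrow> Q b a = Q c a"
  obtains H S where "ray_cont H" "\<And>c. c \<in> V \<Longrightarrow> vpoly m (S c)" "tangent_cont S"
    "\<And>c x. c \<in> V \<Longrightarrow> Q c x = H c x + gam c x *\<^sub>R S c x"
proof -
  obtain H where H: "\<And>c. c \<in> V \<Longrightarrow> vpoly (Suc m) (H c)" "ray_cont H"
    "\<And>c x. c \<in> V \<Longrightarrow> gam c x = 0 \<Longrightarrow> H c x = Q c x"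
    using homogeneous_family[where f = Q, OF Q v] by blast
  have "\<forall>c\<in>V. \<exists>S. vpoly m S \<and> (\<forall>x. Q c x - H c x = gam c x *\<^sub>R S x)"
    by (intro ballI division) (auto intro: vpoly_diff Q H(1) simp: H(3))
  then obtain S where S: "\<And>c. c \<in> V \<Longrightarrow> vpoly m (S c)"
    "\<And>c x. c \<in> V \<Longrightarrow> Q c x - H c x = gam c x *\<^sub>R S c x" by metis
  have "tangent_cont S"
  proof (rule tangent_contI)
    fix a b c t
    assume *: "a \<in> V" "b \<in> V" "c \<in> V" "b \<noteq> a" "c \<noteq> a" "0 \<le> (t::real)" "t \<le> 1"
    let ?h = "\<lambda>t. S b (ray a t) \<bullet> (a - W) - S c (ray a t) \<bullet> (a - W)"
    have lt1: "?h s = 0" if s: "0 \<le> s" "s < 1" for s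
    proof -
      have "(1 - s) * (S e (ray a s) \<bullet> (a - W)) = (Q e (ray a s) - H e (ray a s)) \<bullet> (a - W)"
        if "e \<in> V" "e \<noteq> a" for e
        using S(2)[OF that(1), of "ray a s"] that * by (simp add: gam_ray_other)
      moreover have "Q b (ray a s) \<bullet> (a - W) = Q c (ray a s) \<bullet> (a - W)" "H b (ray a s) = H c (ray a s)"
        using tangent_contD[OF t *(1-5), of s] ray_contD[OF H(2) *(1-5), of s] s by auto
      ultimately have "(1 - s) * (S b (ray a s) \<bullet> (a - W)) = (1 - s) * (S c (ray a s) \<bullet> (a - W))"
        using * by (simp add: inner_diff_left)
      then show ?thesis using s by simp
    qed
    have "continuous_on {0..1} ?h"
    proof -
      have "continuous_on {0..1} (\<lambda>t. S e (ray a t))" if "e \<in> V" for e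
        by (rule continuous_on_compose2[OF vpoly_continuous_on[OF S(1)[OF that], of UNIV]])
           (auto simp: ray_def intro!: continuous_intros)
      then show ?thesis using * by (intro continuous_intros) auto
    qed
    then have "\<forall>s\<in>{0..1}. (?h \<longlongrightarrow> ?h s) (at s within {0..1})"
      by (simp only: continuous_on_def)
    then have "(?h \<longlongrightarrow> ?h 1) (at 1 within {0..1})"
      by (rule bspec) simp
    moreover have "(?h \<longlongrightarrow> 0) (at 1 within {0..1})"
    proof (rule tendsto_eventually)
      have "s \<noteq> 1 \<longrightarrow> s \<in> {0..1} \<longrightarrow> ?h s = 0" for s
        using lt1[of s] by auto
      then show "eventually (\<lambda>s. ?h s = 0) (at 1 within {0..1})"
        unfolding eventually_at_filter by (intro always_eventually) blast
    qed
    ultimately have "?h 1 = 0"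
      by (rule tendsto_unique[rotated]) (simp add: trivial_limit_within)
    then show "S b (ray a t) \<bullet> (a - W) = S c (ray a t) \<bullet> (a - W)"
      using lt1[of t] * by (cases "t = 1") auto
  qed
  moreover have "Q c x = H c x + gam c x *\<^sub>R S c x" if "c \<in> V" for c x
    using S(2)[OF that] by (metis add.commute diff_add_cancel)
  ultimately show thesis using that[of H S] H(2) S(1) by blast
qed

text \<open>The correction step for functions. In positive degree \<open>X\<close> is chosen at the vertices so that the
  remainder becomes continuous there, which suffices for \<open>normal_split\<close>. In degree \<open>0\<close> each jump of
  \<open>S\<close> is a multiple of the corresponding jump of \<open>G\<close>; both kinds of jumps sum to zero around \<open>W\<close>, so
  the three factors coincide.\<close>

lemma grad_correction:
  fixes S :: "'v \<Rightarrow> 'v \<Rightarrow> 'v" and j :: real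
  assumes "\<And>c. c \<in> V \<Longrightarrow> vpoly m (S c)" "tangent_cont S" "0 < j"
  shows "\<exists>X. (\<forall>c\<in>V. poly_deg_le m (X c)) \<and> ray_cont X \<and>
    ray_cont (\<lambda>c x. S c x - (j * X c x) *\<^sub>R G c - gam c x *\<^sub>R grad (X c) x)"
  using assms
proof (induction m arbitrary: S j)
  case 0
  define s where "s c = S c W" for c
  have S: "S c x = s c" if "c \<in> V" for c x
    unfolding s_def by (rule vpoly_0D[OF 0(1)[OF that]])
  have t: "(s b - s c) \<bullet> (a - W) = 0" if "a \<in> V" "b \<in> V" "c \<in> V" "b \<noteq> a" "c \<noteq> a" for a b c
    using tangent_contD[OF 0(2) that, of 0] S that by (simp add: inner_diff_left)
  obtain a b c where V: "V = {a, b, c}" "a \<noteq> b" "a \<noteq> c" "b \<noteq> c"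
    using card_V by (auto simp: card_3_iff)
  then have iV: "a \<in> V" "b \<in> V" "c \<in> V" by auto
  define ka where "ka = w b * ((s b - s c) \<bullet> (b - W))"
  define kb where "kb = w c * ((s c - s a) \<bullet> (c - W))"
  define kc where "kc = w a * ((s a - s b) \<bullet> (a - W))"
  have 1: "s b - s c = ka *\<^sub>R (G b - G c)" "s c - s a = kb *\<^sub>R (G c - G a)" "s a - s b = kc *\<^sub>R (G a - G b)"
    unfolding ka_def kb_def kc_def
    using jump_normal[OF iV(1,2,3), of "s b - s c"] jump_normal[OF iV(2,3,1), of "s c - s a"]
      jump_normal[OF iV(3,1,2), of "s a - s b"] V(2-4) t[OF iV(1,2,3)] t[OF iV(2,3,1)] t[OF iV(3,1,2)]
    by simp_all
  have sum0: "ka *\<^sub>R (G b - G c) + kb *\<^sub>R (G c - G a) + kc *\<^sub>R (G a - G b) = 0"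
    unfolding 1[symmetric] by simp
  \<comment> \<open>testing the vanishing sum of the jumps with two vectors shows that the three factors are equal\<close>
  have "(ka *\<^sub>R (G b - G c) + kb *\<^sub>R (G c - G a) + kc *\<^sub>R (G a - G b)) \<bullet> (a - W) = 0"
    "(ka *\<^sub>R (G b - G c) + kb *\<^sub>R (G c - G a) + kc *\<^sub>R (G a - G b)) \<bullet> (b - W) = 0"
    unfolding sum0 by simp_all
  then have k: "kb = ka" "kc = ka"
    using V iV w_pos[OF iV(1)] w_pos[OF iV(2)]
    by (auto simp: inner_add_left inner_diff_left G_vertex field_simps)
  have e: "s b - ka *\<^sub>R G b = s c - ka *\<^sub>R G c" "s a - ka *\<^sub>R G a = s c - ka *\<^sub>R G c"
    using 1 unfolding k by (auto simp: algebra_simps)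
  have "s u - ka *\<^sub>R G u = s c - ka *\<^sub>R G c" if "u \<in> V" for u
    using that e V by auto
  then have "ray_cont (\<lambda>c x. S c x - (j * (ka / j)) *\<^sub>R G c - gam c x *\<^sub>R grad (\<lambda>_. ka / j) x)"
    using 0(3) by (intro ray_contI) (simp add: S grad_const)
  then show ?case
    by (intro exI[of _ "\<lambda>_ _. ka / j"]) (auto simp: ray_cont_const poly_deg_le.const)
next
  case (Suc m)
  have "\<exists>k. \<forall>b\<in>V-{a}. \<forall>c\<in>V-{a}. S b a - S c a = (j * k) *\<^sub>R (G b - G c)" if a: "a \<in> V" for a
  proof -
    obtain b c where V: "V = {b, c, a}" "b \<noteq> c" "b \<noteq> a" "c \<noteq> a" "b \<in> V" "c \<in> V"
      using two_others[OF a] .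
    define k where "k = w b * ((S b a - S c a) \<bullet> (b - W))"
    have "(S b a - S c a) \<bullet> (a - W) = 0"
      using tangent_contD[OF Suc.prems(2), of a b c 1] V a by (simp add: inner_diff_left)
    then have e: "S b a - S c a = k *\<^sub>R (G b - G c)"
      unfolding k_def using V a by (intro jump_normal) auto
    then have e': "S c a - S b a = k *\<^sub>R (G c - G b)"
      by (metis minus_diff_eq scaleR_minus_right)
    have "V - {a} = {b, c}" using V by auto
    then show ?thesis
      using e e' Suc.prems(3) by (intro exI[of _ "k / j"]) auto
  qed
  then obtain K where K: "\<And>a b c. \<lbrakk>a \<in> V; b \<in> V - {a}; c \<in> V - {a}\<rbrakk>
     \<Longrightarrow> S b a - S c a = (j * K a) *\<^sub>R (G b - G c)" by metis
  let ?I = "vertex_interp m K :: 'v \<Rightarrow> 'v \<Rightarrow> real"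
  have pX0: "poly_deg_le (Suc m) (?I c)" for c using vpoly_vertex_interp[of m K c] by simp
  define Q where "Q c x = S c x - (j * ?I c x) *\<^sub>R G c - gam c x *\<^sub>R grad (?I c) x" for c x
  have pQ: "vpoly (Suc m) (Q c)" if "c \<in> V" for c
    unfolding Q_def[abs_def] using vpoly_grad[OF pX0[of c]] Suc.prems(1)[OF that]
    by (intro vpoly_diff vpoly_scaleR_const poly_deg_le_cmult pX0 vpoly_gam_scaleR) simp_all
  have tQ: "tangent_cont Q"
  proof (rule tangent_contI)
    fix a b c t
    assume *: "a \<in> V" "b \<in> V" "c \<in> V" "b \<noteq> a" "c \<noteq> a" "0 \<le> (t::real)" "t \<le> 1"
    show "Q b (ray a t) \<bullet> (a - W) = Q c (ray a t) \<bullet> (a - W)"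
      using tangent_contD[OF Suc.prems(2) *] tangent_contD[OF tangent_cont_grad[OF pX0 ray_cont_vertex_interp] *]
        ray_contD[OF ray_cont_vertex_interp[of m K] *] *
      by (simp add: Q_def inner_diff_left G_vertex gam_ray_other)
  qed
  have vQ: "Q b a = Q c a" if "a \<in> V" "b \<in> V" "c \<in> V" "b \<noteq> a" "c \<noteq> a" for a b c
    using K[of a b c] that by (simp add: Q_def vertex_interp_vertex scaleR_right_diff_distrib algebra_simps)
  obtain H S' where H: "ray_cont H" and S': "\<And>c. c \<in> V \<Longrightarrow> vpoly m (S' c)" "tangent_cont S'"
    "\<And>c x. c \<in> V \<Longrightarrow> Q c x = H c x + gam c x *\<^sub>R S' c x"
    using normal_split[OF pQ tQ vQ] by blast
  obtain X1 where X1: "\<And>c. c \<in> V \<Longrightarrow> poly_deg_le m (X1 c)" "ray_cont X1"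
    "ray_cont (\<lambda>c x. S' c x - ((j + 1) * X1 c x) *\<^sub>R G c - gam c x *\<^sub>R grad (X1 c) x)"
    using Suc.IH[of S' "j + 1"] S'(1,2) Suc.prems(3) by auto
  let ?X = "\<lambda>c x. ?I c x + gam c x * X1 c x"
  have e: "S c x - (j * ?X c x) *\<^sub>R G c - gam c x *\<^sub>R grad (?X c) x =
    H c x + gam c x *\<^sub>R (S' c x - ((j + 1) * X1 c x) *\<^sub>R G c - gam c x *\<^sub>R grad (X1 c) x)"
    if c: "c \<in> V" for c x
  proof -
    have "grad (?X c) x = grad (?I c) x + (gam c x *\<^sub>R grad (X1 c) x + X1 c x *\<^sub>R G c)"
      by (simp only: grad_add[OF pX0[of c] poly_gam_mult[OF X1(1)[OF c]]] grad_mult[OF poly_gam X1(1)[OF c]]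
           grad_gam)
    then have "S c x - (j * ?X c x) *\<^sub>R G c - gam c x *\<^sub>R grad (?X c) x = Q c x
       - (j * gam c x * X1 c x) *\<^sub>R G c
       - gam c x *\<^sub>R (gam c x *\<^sub>R grad (X1 c) x + X1 c x *\<^sub>R G c)"
      by (simp add: Q_def algebra_simps)
    then show ?thesis
      by (simp add: S'(3)[OF c] algebra_simps)
  qed
  have "ray_cont (\<lambda>c x. S c x - (j * ?X c x) *\<^sub>R G c - gam c x *\<^sub>R grad (?X c) x)"
    by (rule ray_cont_eq[OF ray_cont_add[OF H ray_cont_scaleR[OF ray_cont_gam X1(3)]]]) (rule e)
  moreover have "poly_deg_le (Suc m) (?X c)" if "c \<in> V" for c
    using that by (intro poly_deg_le.add pX0 poly_gam_mult X1)
  moreover have "ray_cont ?X"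
    by (rule ray_cont_add[OF ray_cont_vertex_interp ray_cont_mult[OF ray_cont_gam X1(2)]])
  ultimately show ?case by (intro exI[of _ ?X]) auto
qed


section \<open>Extension of boundary data\<close>

text \<open>The quarter turn identifies \<open>1\<close>-forms with vector fields in such a way that \<open>curl\<close> becomes
  \<open>divergence\<close>. The divergence involves no orientation, so that the vertices of the triangle need not
  be ordered.\<close>

definition rot :: "'v \<Rightarrow> 'v" where
  "rot y = (y \<bullet> E1) *\<^sub>R E2 - (y \<bullet> E2) *\<^sub>R E1"

lemma linear_rot: "linear rot"
  by (simp add: linear_iff rot_def inner_add_left algebra_simps)

lemma curl_rot:
  assumes "vpoly q Z"
  shows "curl (\<lambda>x. rot (Z x)) x = divergence Z x"
proof -
  have "(\<lambda>x. rot (Z x) \<bullet> E2) = (\<lambda>x. Z x \<bullet> E1)" "(\<lambda>x. rot (Z x) \<bullet> E1) = (\<lambda>x. -1 * (Z x \<bullet> E2))"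
    by (simp_all add: rot_def inner_diff_left plane_basis_inner[OF dim])
  then show ?thesis
    unfolding curl_def divergence_def
    using grad_cmult[OF vpoly_inner[OF assms, of E2], of "-1" x] plane_basis(2)[OF dim]
    by (simp add: plane_basis(1)[OF dim])
qed

lemma curl_add:
  assumes "vpoly q U" "vpoly r Z"
  shows "curl (\<lambda>x. U x + Z x) x = curl U x + curl Z x"
  by (simp add: curl_def inner_add_left inner_diff_left
       grad_add[OF vpoly_inner[OF assms(1)] vpoly_inner[OF assms(2)]])

text \<open>The homogeneous extension \<open>U1\<close> of \<open>U0\<close> is corrected by a multiple of the hat function, which leaves
  its trace alone. Lemma \<open>div_correction\<close> is applied to the difference between the desired and the
  actual curl; its remainder is continuous and vanishes on the boundary, as \<open>q\<close> is positive.\<close>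

lemma curl_extension:
  assumes U0: "\<And>c. c \<in> V \<Longrightarrow> vpoly (Suc q) (U0 c)" and s0: "\<And>c. c \<in> V \<Longrightarrow> poly_deg_le q (s0 c)"
    and q: "0 < q"
    and vU: "\<And>a b c. \<lbrakk>a \<in> V; b \<in> V; c \<in> V; b \<noteq> a; c \<noteq> a\<rbrakk> \<Longrightarrow> U0 b a = U0 c a"
    and vs: "\<And>a b c. \<lbrakk>a \<in> V; b \<in> V; c \<in> V; b \<noteq> a; c \<noteq> a\<rbrakk> \<Longrightarrow> s0 b a = s0 c a"
  obtains U where "\<And>c. c \<in> V \<Longrightarrow> vpoly (Suc q) (U c)" "ray_cont U" "ray_cont (\<lambda>c. curl (U c))"
    "\<And>c x. c \<in> V \<Longrightarrow> gam c x = 0 \<Longrightarrow> U c x = U0 c x"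
    "\<And>c x. c \<in> V \<Longrightarrow> gam c x = 0 \<Longrightarrow> curl (U c) x = s0 c x"
proof -
  obtain U1 where U1: "\<And>c. c \<in> V \<Longrightarrow> vpoly (Suc q) (U1 c)" "ray_cont U1"
    "\<And>c x. c \<in> V \<Longrightarrow> gam c x = 0 \<Longrightarrow> U1 c x = U0 c x"
    using homogeneous_family[where f = U0, OF U0 vU] by blast
  have s0': "\<And>c. c \<in> V \<Longrightarrow> vpoly q (s0 c)" using s0 by simp
  obtain s1 where s1: "\<And>c. c \<in> V \<Longrightarrow> vpoly q (s1 c)" "ray_cont s1"
    "\<And>c x. c \<in> V \<Longrightarrow> gam c x = 0 \<Longrightarrow> s1 c x = s0 c x"
    using homogeneous_family[where f = s0, OF s0' vs] by blast
  have "poly_deg_le q (\<lambda>x. s1 c x - curl (U1 c) x)" if "c \<in> V" for c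
    using s1(1)[OF that] poly_curl[OF U1(1)[OF that]] by (intro poly_deg_le_diff) simp_all
  from div_correction[of q "\<lambda>c x. s1 c x - curl (U1 c) x" 1, OF this]
  obtain Z where Z: "\<And>c. c \<in> V \<Longrightarrow> vpoly q (Z c)" "ray_cont Z"
    "ray_cont (\<lambda>c x. s1 c x - curl (U1 c) x - 1 * (G c \<bullet> Z c x) - gam c x * divergence (Z c) x)"
    "\<And>c x. c \<in> V \<Longrightarrow> gam c x = 0 \<Longrightarrow>
       s1 c x - curl (U1 c) x - 1 * (G c \<bullet> Z c x) - gam c x * divergence (Z c) x = 0"
    using q by auto
  let ?U = "\<lambda>c x. U1 c x + rot (gam c x *\<^sub>R Z c x)"
  have pZ: "vpoly (Suc q) (\<lambda>x. gam c x *\<^sub>R Z c x)" if "c \<in> V" for c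
    using that by (intro vpoly_gam_scaleR Z)
  have p: "vpoly (Suc q) (?U c)" if "c \<in> V" for c
    using that by (intro vpoly_add U1 vpoly_linear_image[OF pZ linear_rot])
  have e: "curl (?U c) x = s1 c x -
     (s1 c x - curl (U1 c) x - 1 * (G c \<bullet> Z c x) - gam c x * divergence (Z c) x)"
    if c: "c \<in> V" for c x
    by (simp add: curl_add[OF U1(1)[OF c] vpoly_linear_image[OF pZ[OF c] linear_rot]]
        curl_rot[OF pZ[OF c]] divergence_scaleR[OF poly_gam Z(1)[OF c]] grad_gam)
  show thesis
  proof (rule that[of ?U])
    show "vpoly (Suc q) (?U c)" if "c \<in> V" for c using p[OF that] .
    show "ray_cont ?U"
      by (rule ray_cont_add[OF U1(2) ray_cont_map[OF ray_cont_scaleR[OF ray_cont_gam Z(2)]]])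
    show "ray_cont (\<lambda>c. curl (?U c))"
      by (rule ray_cont_eq[OF ray_cont_diff[OF s1(2) Z(3)]]) (rule e)
    fix c x assume c: "c \<in> V" "gam c x = 0"
    show "?U c x = U0 c x" using U1(3)[OF c] c linear_0[OF linear_rot] by simp
    show "curl (?U c) x = s0 c x" unfolding e[OF c(1)] Z(4)[OF c] using s1(3)[OF c] by simp
  qed
qed

text \<open>The homogeneous extension \<open>f0\<close> of the values already has the right tangential derivatives. Adding
  \<open>gam c\<close> times a function changes the normal derivative on the edge by the value of that function,
  which is thereby prescribed; tangential continuity of \<open>grad f0\<close> makes the two prescriptions at a
  vertex agree. A multiple of the square of \<open>gam c\<close> then removes the jumps of the gradient inside.\<close>

lemma grad_extension:
  assumes f: "\<And>c. c \<in> V \<Longrightarrow> poly_deg_le (Suc (Suc m)) (f c)"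
    and D: "\<And>c. c \<in> V \<Longrightarrow> vpoly (Suc m) (D c)"
    and vf: "\<And>a b c. \<lbrakk>a \<in> V; b \<in> V; c \<in> V; b \<noteq> a; c \<noteq> a\<rbrakk> \<Longrightarrow> f b a = f c a"
    and vD: "\<And>a b c. \<lbrakk>a \<in> V; b \<in> V; c \<in> V; b \<noteq> a; c \<noteq> a\<rbrakk> \<Longrightarrow> D b a = D c a"
    and tan: "\<And>c x v. \<lbrakk>c \<in> V; x \<in> cell (V - {c}); G c \<bullet> v = 0\<rbrakk> \<Longrightarrow> grad (f c) x \<bullet> v = D c x \<bullet> v"
  obtains F where "\<And>c. c \<in> V \<Longrightarrow> poly_deg_le (Suc (Suc m)) (F c)" "ray_cont F" "ray_cont (\<lambda>c. grad (F c))"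
    "\<And>c x. c \<in> V \<Longrightarrow> x \<in> cell (V - {c}) \<Longrightarrow> F c x = f c x"
    "\<And>c x. c \<in> V \<Longrightarrow> x \<in> cell (V - {c}) \<Longrightarrow> grad (F c) x = D c x"
proof -
  have f': "\<And>c. c \<in> V \<Longrightarrow> vpoly (Suc (Suc m)) (f c)" using f by simp
  obtain f0 where f0: "\<And>c. c \<in> V \<Longrightarrow> poly_deg_le (Suc (Suc m)) (f0 c)" "ray_cont f0"
    "\<And>c x. c \<in> V \<Longrightarrow> gam c x = 0 \<Longrightarrow> f0 c x = f c x"
    using homogeneous_family[where f = f, OF f' vf] unfolding vpoly_real by blast
  have tan0: "grad (f0 c) x \<bullet> v = D c x \<bullet> v" if c: "c \<in> V" "x \<in> cell (V - {c})" "G c \<bullet> v = 0" for c x v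
  proof -
    let ?L = "{x. gam c x = 0}"
    have "convex ?L" unfolding convex_def by (auto simp: gam_affine)
    moreover have x: "x \<in> ?L" using c edge_iff by auto
    moreover have "v \<in> tangent ?L"
      using tangentI[of "x + v" ?L x] x c(3) gam_diff[of c "x + v" x] by simp
    ultimately have "grad (f0 c) x \<bullet> v = grad (f c) x \<bullet> v"
      by (rule grad_eq_along[OF f0(1)[OF c(1)] f[OF c(1)]]) (use f0(3)[OF c(1)] in auto)
    then show ?thesis using tan c by simp
  qed
  \<comment> \<open>on the edge \<open>y\<close> has no tangential component, hence it is a multiple of \<open>G c\<close>\<close>
  define y where "y c x = D c x - grad (f0 c) x" for c x
  have y: "y c x = (y c x \<bullet> tau c) *\<^sub>R G c" if c: "c \<in> V" "x \<in> cell (V - {c})" for c x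
  proof -
    have "y c x \<bullet> v = ((y c x \<bullet> tau c) *\<^sub>R G c) \<bullet> v" for v
    proof -
      have "G c \<bullet> (v - (G c \<bullet> v) *\<^sub>R tau c) = 0"
        using G_tau[OF c(1)] by (simp add: inner_diff_right)
      from tan0[OF c this] have "y c x \<bullet> (v - (G c \<bullet> v) *\<^sub>R tau c) = 0"
        by (simp add: y_def inner_diff_left)
      then show ?thesis by (simp add: inner_diff_right mult.commute)
    qed
    then show ?thesis by (metis vector_eq_ldot inner_commute)
  qed
  have ve: "a \<in> cell (V - {c})" if "a \<in> V" "c \<in> V" "c \<noteq> a" for a c
    using that by (intro hull_inc) auto
  have py: "vpoly (Suc m) (y c)" if "c \<in> V" for c
    unfolding y_def[abs_def] using vpoly_grad[OF f0(1)[OF that]] D[OF that]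
    by (intro vpoly_diff) simp_all
  have "vpoly (Suc m) (\<lambda>x. y c x \<bullet> tau c)" if "c \<in> V" for c
    using vpoly_inner[OF py[OF that]] by simp
  moreover have "y b a \<bullet> tau b = y c a \<bullet> tau c" if V: "a \<in> V" "b \<in> V" "c \<in> V" "b \<noteq> a" "c \<noteq> a" for a b c
  proof -
    have "y e a \<bullet> tau e = grad (f0 e) a \<bullet> (a - W) - D e a \<bullet> (a - W)" if "e \<in> V" "e \<noteq> a" for e
    proof -
      have "y e a \<bullet> (a - W) = (y e a \<bullet> tau e) * (G e \<bullet> (a - W))"
        by (subst y) (use that V ve in auto)
      then show ?thesis using that V by (simp add: G_vertex y_def inner_diff_left)
    qed
    then show ?thesis
      using V vD[OF V] tangent_contD[OF tangent_cont_grad[OF f0(1,2)] V, of 1] by simp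
  qed
  ultimately obtain g where g: "\<And>c. c \<in> V \<Longrightarrow> vpoly (Suc m) (g c)" "ray_cont g"
    "\<And>c x. c \<in> V \<Longrightarrow> gam c x = 0 \<Longrightarrow> g c x = y c x \<bullet> tau c"
    using homogeneous_family[of "Suc m" "\<lambda>c x. y c x \<bullet> tau c"] by metis
  have pg: "poly_deg_le (Suc m) (g c)" if "c \<in> V" for c using g(1)[OF that] by simp
  define f1 where "f1 c x = f0 c x + gam c x * g c x" for c x
  have pf1: "poly_deg_le (Suc (Suc m)) (f1 c)" if "c \<in> V" for c
    unfolding f1_def[abs_def] using that by (intro poly_deg_le.add f0 poly_gam_mult pg)
  have rf1: "ray_cont f1"
    unfolding f1_def[abs_def] by (rule ray_cont_add[OF f0(2) ray_cont_mult[OF ray_cont_gam g(2)]])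
  have gf1: "grad (f1 c) x = grad (f0 c) x + (gam c x *\<^sub>R grad (g c) x + g c x *\<^sub>R G c)"
    if c: "c \<in> V" for c x
    unfolding f1_def[abs_def]
    by (simp add: grad_add[OF f0(1)[OF c] poly_gam_mult[OF pg[OF c]]] grad_mult[OF poly_gam pg[OF c]]
           grad_gam)
  have f1D: "grad (f1 c) x = D c x" if c: "c \<in> V" "x \<in> cell (V - {c})" for c x
  proof -
    have "gam c x = 0" using c edge_iff by blast
    then have "grad (f1 c) x = grad (f0 c) x + y c x"
      using gf1[OF c(1)] g(3)[OF c(1)] y[OF c] by simp
    then show ?thesis by (simp add: y_def)
  qed
  have p1: "vpoly (Suc m) (grad (f1 c))" if "c \<in> V" for c
    using vpoly_grad[OF pf1[OF that]] by simp
  have v1: "grad (f1 b) a = grad (f1 c) a" if "a \<in> V" "b \<in> V" "c \<in> V" "b \<noteq> a" "c \<noteq> a" for a b c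
    using f1D[of b a] f1D[of c a] ve[of a b] ve[of a c] vD[OF that] that by simp
  obtain H S where H: "ray_cont H" and S: "\<And>c. c \<in> V \<Longrightarrow> vpoly m (S c)" "tangent_cont S"
    "\<And>c x. c \<in> V \<Longrightarrow> grad (f1 c) x = H c x + gam c x *\<^sub>R S c x"
    using normal_split[OF p1 tangent_cont_grad[OF pf1 rf1] v1] by blast
  obtain X where X: "\<And>c. c \<in> V \<Longrightarrow> poly_deg_le m (X c)" "ray_cont X"
    "ray_cont (\<lambda>c x. S c x - (2 * X c x) *\<^sub>R G c - gam c x *\<^sub>R grad (X c) x)"
    using grad_correction[OF S(1,2), of 2] by auto
  define F where "F c x = f1 c x - gam c x * (gam c x * X c x)" for c x
  have gF: "grad (F c) x = H c x + gam c x *\<^sub>R (S c x - (2 * X c x) *\<^sub>R G c - gam c x *\<^sub>R grad (X c) x)"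
    if c: "c \<in> V" for c x
  proof -
    note pX = poly_gam_mult[OF X(1)[OF c], of c]
    have "grad (F c) x = grad (f1 c) x - (gam c x *\<^sub>R (gam c x *\<^sub>R grad (X c) x + X c x *\<^sub>R G c)
       + (gam c x * X c x) *\<^sub>R G c)"
      unfolding F_def[abs_def]
      by (simp add: grad_diff[OF pf1[OF c] poly_gam_mult[OF pX]] grad_mult[OF poly_gam pX]
            grad_mult[OF poly_gam X(1)[OF c]] grad_gam)
    moreover have "(2 * X c x) *\<^sub>R G c = X c x *\<^sub>R G c + X c x *\<^sub>R G c"
      by (simp flip: scaleR_left_distrib)
    ultimately show ?thesis
      unfolding S(3)[OF c] by (simp add: algebra_simps)
  qed
  show thesis
  proof (rule that[of F])
    show "poly_deg_le (Suc (Suc m)) (F c)" if "c \<in> V" for c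
      unfolding F_def[abs_def] using that by (intro poly_deg_le_diff pf1 poly_gam_mult X)
    show "ray_cont F"
      unfolding F_def[abs_def]
      by (rule ray_cont_diff[OF rf1 ray_cont_mult[OF ray_cont_gam ray_cont_mult[OF ray_cont_gam X(2)]]])
    show "ray_cont (\<lambda>c. grad (F c))"
      by (rule ray_cont_eq[OF ray_cont_add[OF H ray_cont_scaleR[OF ray_cont_gam X(3)]]]) (rule gF)
    fix c x assume c: "c \<in> V" "x \<in> cell (V - {c})"
    then have z: "gam c x = 0" using edge_iff by blast
    show "F c x = f c x" using z f0(3)[OF c(1) z] by (simp add: F_def f1_def)
    have "grad (F c) x = grad (f1 c) x" by (simp add: gF[OF c(1)] S(3)[OF c(1)] z)
    then show "grad (F c) x = D c x" using f1D[OF c] by simp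
  qed
qed

end


section \<open>Potentials\<close>

lemma vanishing_gradient_imp_constant:
  assumes f: "poly_deg_le q f" and S: "convex S" "x \<in> S" "y \<in> S"
    and g: "\<And>z v. z \<in> S \<Longrightarrow> v \<in> tangent S \<Longrightarrow> grad f z \<bullet> v = 0"
  shows "f x = f y"
proof -
  let ?h = "\<lambda>t::real. x + t *\<^sub>R (y - x)"
  have "\<exists>c. \<forall>t\<in>{0..1}. f (?h t) = c"
  proof (rule has_field_derivative_zero_constant)
    show "convex {0..1::real}" by simp
    fix t :: real assume t: "t \<in> {0..1}"
    have "(1 - t) *\<^sub>R x + t *\<^sub>R y \<in> S"
      using S t by (intro convexD) auto
    moreover have "(1 - t) *\<^sub>R x + t *\<^sub>R y = ?h t" by (simp add: algebra_simps)
    ultimately have "grad f (?h t) \<bullet> (y - x) = 0"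
      using g tangentI[OF S(3,2)] by simp
    moreover have "((\<lambda>t. f (?h t)) has_derivative (\<lambda>s. grad f (?h t) \<bullet> (s *\<^sub>R (y - x)))) (at t)"
      by (rule has_derivative_compose[of ?h, OF _ poly_has_derivative[OF f]])
         (auto intro!: derivative_eq_intros)
    ultimately have "((\<lambda>t. f (?h t)) has_field_derivative 0) (at t)"
      by (simp add: has_field_derivative_def lambda_zero)
    then show "((\<lambda>t. f (?h t)) has_field_derivative 0) (at t within {0..1})"
      by (rule has_field_derivative_at_within)
  qed
  then obtain c where "\<forall>t\<in>{0..1}. f (?h t) = c" by blast
  from this[rule_format, of 0] this[rule_format, of 1] show ?thesis by simp
qed

lemma grad_mult_affine:
  fixes n a :: "'v::euclidean_space"
  assumes "poly_deg_le q f"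
  shows "grad (\<lambda>x. n \<bullet> (x - a) * f x) x = (n \<bullet> (x - a)) *\<^sub>R grad f x + f x *\<^sub>R n"
  using grad_mult[OF poly_deg_le_affine[of 0 0 n a] assms] grad_affine[of 0 n a] by simp

lemma poly_mult_affine:
  fixes n a :: "'v::euclidean_space"
  assumes "poly_deg_le q f"
  shows "poly_deg_le (Suc q) (\<lambda>x. n \<bullet> (x - a) * f x)"
  using poly_deg_le_mult[OF poly_deg_le_affine[of 0 0 n a] assms] by simp

text \<open>The Poincare homotopy on \<open>1\<close>-forms.\<close>

definition potential :: "'v::euclidean_space \<Rightarrow> ('v \<Rightarrow> 'v) \<Rightarrow> 'v \<Rightarrow> real" where
  "potential W U x = E1 \<bullet> (x - W) * radial_mean W 0 (\<lambda>x. U x \<bullet> E1) x + E2 \<bullet> (x - W) * radial_mean W 0 (\<lambda>x. U x \<bullet> E2) x"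

lemma poly_potential: "vpoly q U \<Longrightarrow> poly_deg_le (Suc q) (potential W U)"
  unfolding potential_def[abs_def]
  by (intro poly_deg_le.add poly_mult_affine poly_radial_mean vpoly_inner)

text \<open>Closedness along the segment from \<open>W\<close> to \<open>x\<close> makes the Jacobian of the averaged form symmetric, and the
  Euler identity for the averages then gives the gradient.\<close>

lemma grad_potential:
  fixes U :: "'v::euclidean_space \<Rightarrow> 'v"
  assumes dim: "DIM('v) = 2" and U: "vpoly q U"
    and c: "\<And>t. 0 \<le> t \<Longrightarrow> t \<le> 1 \<Longrightarrow> curl U (W + t *\<^sub>R (x - W)) = 0"
  shows "grad (potential W U) x = U x"
proof -
  let ?h1 = "radial_mean W 0 (\<lambda>x. U x \<bullet> E1)" and ?h2 = "radial_mean W 0 (\<lambda>x. U x \<bullet> E2)"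
  note p1 = vpoly_inner[OF U, of E1] and p2 = vpoly_inner[OF U, of E2]
  note e = plane_basis_inner[OF dim]
  have g: "grad (potential W U) x = (E1 \<bullet> (x - W)) *\<^sub>R grad ?h1 x + ?h1 x *\<^sub>R E1
     + ((E2 \<bullet> (x - W)) *\<^sub>R grad ?h2 x + ?h2 x *\<^sub>R E2)"
    unfolding potential_def[abs_def]
    by (simp only: grad_add[OF poly_mult_affine[OF poly_radial_mean[OF p1]] poly_mult_affine[OF poly_radial_mean[OF p2]]]
       grad_mult_affine[OF poly_radial_mean[OF p1]] grad_mult_affine[OF poly_radial_mean[OF p2]])
  have sym: "grad ?h2 x \<bullet> E1 = grad ?h1 x \<bullet> E2"
    unfolding grad_radial_mean[OF p1] grad_radial_mean[OF p2]
    by (rule radial_mean_cong) (use c in \<open>auto simp: curl_def\<close>)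
  have rep: "z \<bullet> (x - W) = (E1 \<bullet> (x - W)) * (z \<bullet> E1) + (E2 \<bullet> (x - W)) * (z \<bullet> E2)" for z
    by (subst (1) plane_representation[OF dim, of "x - W"])
       (simp only: inner_add_right inner_scaleR_right inner_commute)
  have "grad (potential W U) x \<bullet> E1 = U x \<bullet> E1"
    using radial_mean_Euler[OF p1, where k = 0 and W = W and x = x]
    unfolding rep[of "grad ?h1 x"] g inner_add_left inner_scaleR_left sym e by simp
  moreover have "grad (potential W U) x \<bullet> E2 = U x \<bullet> E2"
    using radial_mean_Euler[OF p2, where k = 0 and W = W and x = x]
    unfolding rep[of "grad ?h2 x"] g inner_add_left inner_scaleR_left sym e by simp
  ultimately show ?thesis
    using plane_representation[OF dim, of "grad (potential W U) x"]
      plane_representation[OF dim, of "U x"] by simp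
qed

context split_triangle
begin

lemma ray_cont_radial_mean:
  assumes "ray_cont f"
  shows "ray_cont (\<lambda>c. radial_mean W k (f c))"
proof (rule ray_contI, rule radial_mean_cong)
  fix a b c s t
  assume *: "a \<in> V" "b \<in> V" "c \<in> V" "b \<noteq> a" "c \<noteq> a" "0 \<le> (t::real)" "t \<le> 1" "0 \<le> (s::real)" "s \<le> 1"
  have "W + s *\<^sub>R (ray a t - W) = ray a (s * t)" by (simp add: ray_def)
  then show "f b (W + s *\<^sub>R (ray a t - W)) = f c (W + s *\<^sub>R (ray a t - W))"
    using ray_contD[OF assms *(1-5), of "s * t"] * by (simp add: mult_le_one)
qed

lemma ray_cont_potential:
  assumes "ray_cont U"
  shows "ray_cont (\<lambda>c. potential W (U c))"
proof -
  have "ray_cont (\<lambda>c. radial_mean W 0 (\<lambda>x. U c x \<bullet> v))" for v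
    by (rule ray_cont_radial_mean[OF ray_cont_map[OF assms]])
  then show ?thesis
    unfolding potential_def by (intro ray_cont_add ray_cont_mult ray_cont_const)
qed

text \<open>The Poincare homotopy on \<open>2\<close>-forms: the contraction of the averaged form with \<open>x - W\<close>.\<close>

definition koszul :: "('v \<Rightarrow> real) \<Rightarrow> 'v \<Rightarrow> 'v" where
  "koszul f x = rot (radial_mean W 1 f x *\<^sub>R (x - W))"

lemma vpoly_radial: "poly_deg_le q f \<Longrightarrow> vpoly (Suc q) (\<lambda>x. radial_mean W 1 f x *\<^sub>R (x - W))"
proof -
  have "vpoly 1 (\<lambda>x. x - W)"
    unfolding vpoly_def using poly_deg_le_affine[of 0 0 _ W] by (simp add: inner_commute)
  then show "poly_deg_le q f \<Longrightarrow> vpoly (Suc q) (\<lambda>x. radial_mean W 1 f x *\<^sub>R (x - W))"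
    using vpoly_scaleR[OF poly_radial_mean] by fastforce
qed

lemma vpoly_koszul: "poly_deg_le q f \<Longrightarrow> vpoly (Suc q) (koszul f)"
  unfolding koszul_def[abs_def] by (intro vpoly_linear_image[OF _ linear_rot] vpoly_radial)

lemma curl_koszul:
  assumes f: "poly_deg_le q f"
  shows "curl (koszul f) x = f x"
proof -
  have v: "vpoly 1 (\<lambda>x. x - W)"
    unfolding vpoly_def using poly_deg_le_affine[of 0 0 _ W] by (simp add: inner_commute)
  have "divergence (\<lambda>x. x - W) x = (\<Sum>i\<in>Basis. i \<bullet> (i::'v))"
    unfolding divergence_def using grad_affine[of 0 _ W] by (simp add: inner_commute)
  then have d: "divergence (\<lambda>x. x - W) x = 2" by (simp add: dim)
  have "curl (koszul f) x = divergence (\<lambda>x. radial_mean W 1 f x *\<^sub>R (x - W)) x"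
    unfolding koszul_def[abs_def] by (rule curl_rot[OF vpoly_radial[OF f]])
  also have "\<dots> = radial_mean W 1 f x * 2 + grad (radial_mean W 1 f) x \<bullet> (x - W)"
    by (simp add: divergence_scaleR[OF poly_radial_mean[OF f] v] d)
  also have "\<dots> = f x" using radial_mean_Euler[OF f, of 1 W x] by simp
  finally show ?thesis .
qed

lemma ray_cont_koszul: "ray_cont f \<Longrightarrow> ray_cont (\<lambda>c. koszul (f c))"
  unfolding koszul_def by (intro ray_cont_map[OF ray_cont_scaleR[OF ray_cont_radial_mean ray_cont_const]])


section \<open>The spaces on the triangle\<close>

lemma A_tri_0_iff:
  "u \<in> A_tri p V W 0 \<longleftrightarrow> (\<exists>F. (\<forall>c\<in>V. poly_deg_le p (F c)) \<and> ray_cont F \<and>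
     ray_cont (\<lambda>c. grad (F c)) \<and> u = glue scalar F)"
proof -
  have "u \<in> A_tri p V W 0 \<longleftrightarrow> (\<exists>F. (\<forall>c\<in>V. poly_deg_le p (F c)) \<and> ray_cont F \<and> u = glue scalar F) \<and>
      C1_on (cell V) (\<lambda>x. u x [])"
    using glue_fields_iff[OF scalar_model, of u p] by (auto simp: A_tri_def)
  then show ?thesis using C1_on_glue_iff by blast
qed

lemma A_tri_1_iff:
  "u \<in> A_tri p V W 1 \<longleftrightarrow> (\<exists>U. (\<forall>c\<in>V. vpoly (p - 1) (U c)) \<and> ray_cont U \<and>
     ray_cont (\<lambda>c. curl (U c)) \<and> u = glue form1 U)"
proof -
  have "u \<in> A_tri p V W 1 \<longleftrightarrow> (\<exists>U. (\<forall>c\<in>V. vpoly (p - 1) (U c)) \<and> ray_cont U \<and> u = glue form1 U) \<and>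
      continuous_field_on (cell V) u \<and> (\<exists>w. is_ext_deriv V W u w)"
    using glue_fields_iff[OF form1_model, of u "p - 1"] by (auto simp: A_tri_def)
  then show ?thesis
    using ext_deriv_form1(1) glue_continuous[OF form1_model] by blast
qed

lemma A_tri_2_iff:
  "u \<in> A_tri p V W 2 \<longleftrightarrow> (\<exists>f. (\<forall>c\<in>V. poly_deg_le (p - 2) (f c)) \<and> ray_cont f \<and> u = glue form2 f)"
proof -
  have "u \<in> A_tri p V W 2 \<longleftrightarrow> (\<exists>f. (\<forall>c\<in>V. vpoly (p - 2) (f c)) \<and> ray_cont f \<and> u = glue form2 f) \<and>
      continuous_field_on (cell V) u"
    using glue_fields_iff[OF form2_model, of u "p - 2"] by (auto simp: A_tri_def)
  then show ?thesis
    using glue_continuous[OF form2_model] by (metis vpoly_real)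
qed

lemma glue_zero_iff:
  assumes m: "form_model k \<iota>" and r: "ray_cont F"
  shows "glue \<iota> F = zero_field \<longleftrightarrow> (\<forall>c\<in>V. \<forall>x\<in>subtri c. F c x = 0)"
proof
  assume z: "glue \<iota> F = zero_field"
  show "\<forall>c\<in>V. \<forall>x\<in>subtri c. F c x = 0"
  proof (intro ballI)
    fix c x assume "c \<in> V" "x \<in> subtri c"
    then have "\<iota> (F c x) = \<iota> 0"
      using glue_eq[OF r, of c x \<iota>] z form_model_0[OF m] by (simp add: zero_field_def)
    then show "F c x = 0" by (rule form_model_inj[OF m])
  qed
next
  assume z: "\<forall>c\<in>V. \<forall>x\<in>subtri c. F c x = 0"
  have "zero_field = glue \<iota> F"
    by (rule eq_glueI[OF r]) (use z form_model_0[OF m] in \<open>auto simp: zero_field_def\<close>)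
  then show "glue \<iota> F = zero_field" by simp
qed

lemma incl_tri_eq: "incl_tri V r = glue scalar (\<lambda>_ _. r)"
  by (auto simp: incl_tri_def tr_def glue_def fun_eq_iff)

text \<open>A radial segment stays in one small triangle, so closedness there suffices for the potential, and
  the averages of a continuous family form a continuous family.\<close>

lemma exact_triangle:
  assumes p: "2 \<le> p"
  shows "exact_sequence zero_field (incl_tri V) (ext_deriv V W) (A_tri p V W)"
  unfolding exact_sequence_def
proof (intro conjI)
  have "V \<noteq> {}" using card_V by auto
  then obtain v where v: "v \<in> V" by blast
  show "inj (incl_tri V)"
  proof (rule injI)
    fix r s assume "incl_tri V r = incl_tri V s"
    then have "glue scalar (\<lambda>_ _. r) W = glue scalar (\<lambda>_ _. s) W" by (simp add: incl_tri_eq)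
    then have "scalar r = (scalar s :: 'v form)"
      by (simp only: glue_eq[OF ray_cont_const v W_in_subtri])
    then show "r = s" by (rule form_model_inj[OF scalar_model])
  qed
  show "range (incl_tri V) = {u \<in> A_tri p V W 0. ext_deriv V W u = zero_field}"
  proof (intro set_eqI iffI)
    fix u assume "u \<in> range (incl_tri V)"
    then obtain r where u: "u = glue scalar (\<lambda>_ _. r)" by (auto simp: incl_tri_eq)
    have g: "ray_cont (\<lambda>c::'v. grad (\<lambda>_::'v. r))" by (rule ray_cont_const)
    have "ext_deriv V W u = glue form1 (\<lambda>c. grad (\<lambda>_. r))"
      unfolding u by (rule ext_deriv_scalar(2)[OF poly_deg_le.const ray_cont_const g])
    also have "\<dots> = zero_field"
      unfolding glue_zero_iff[OF form1_model g] by (simp add: grad_const)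
    finally have "ext_deriv V W u = zero_field" .
    moreover have "u \<in> A_tri p V W 0"
      unfolding A_tri_0_iff u
      by (intro exI[of _ "\<lambda>_ _. r"]) (use g in \<open>auto simp: poly_deg_le.const ray_cont_const\<close>)
    ultimately show "u \<in> {u \<in> A_tri p V W 0. ext_deriv V W u = zero_field}" by simp
  next
    fix u assume "u \<in> {u \<in> A_tri p V W 0. ext_deriv V W u = zero_field}"
    then have u0: "u \<in> A_tri p V W 0" "ext_deriv V W u = zero_field" by auto
    then obtain F where F: "\<And>c. c \<in> V \<Longrightarrow> poly_deg_le p (F c)" "ray_cont F" "ray_cont (\<lambda>c. grad (F c))"
      "u = glue scalar F" by (auto simp: A_tri_0_iff)
    have "glue form1 (\<lambda>c. grad (F c)) = zero_field"
      using ext_deriv_scalar(2)[OF F(1,2,3)] u0(2) F(4) by simp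
    then have z: "\<And>c x. c \<in> V \<Longrightarrow> x \<in> subtri c \<Longrightarrow> grad (F c) x = 0"
      unfolding glue_zero_iff[OF form1_model F(3)] by blast
    have "F c x = F v W" if c: "c \<in> V" "x \<in> subtri c" for c x
    proof -
      have "F c x = F c W"
        by (rule vanishing_gradient_imp_constant[OF F(1)[OF c(1)] convex_subtri c(2) W_in_subtri])
           (simp add: z c)
      also have "\<dots> = F v W" by (rule ray_cont_subtri[OF F(2) c(1) v W_in_subtri W_in_subtri])
      finally show ?thesis .
    qed
    then have "u = glue scalar (\<lambda>_ _. F v W)"
      unfolding F(4) by (intro eq_glueI ray_cont_const) (auto simp: glue_eq[OF F(2)] glue_outside)
    then show "u \<in> range (incl_tri V)" by (auto simp: incl_tri_eq)
  qed
  show "ext_deriv V W ` A_tri p V W 0 = {u \<in> A_tri p V W 1. ext_deriv V W u = zero_field}"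
  proof (intro set_eqI iffI)
    fix u assume "u \<in> ext_deriv V W ` A_tri p V W 0"
    then obtain F where F: "\<And>c. c \<in> V \<Longrightarrow> poly_deg_le p (F c)" "ray_cont F" "ray_cont (\<lambda>c. grad (F c))"
      "u = ext_deriv V W (glue scalar F)" unfolding image_iff Bex_def A_tri_0_iff by blast
    have u: "u = glue form1 (\<lambda>c. grad (F c))"
      unfolding F(4) by (rule ext_deriv_scalar(2)[OF F(1,2,3)])
    have g: "\<And>c. c \<in> V \<Longrightarrow> vpoly (p - 1) (grad (F c))" by (rule vpoly_grad[OF F(1)])
    have c: "ray_cont (\<lambda>c. curl (grad (F c)))"
      by (rule ray_cont_eq[OF ray_cont_const[of "\<lambda>_. 0"]]) (rule curl_grad[OF F(1)])
    have "ext_deriv V W u = glue form2 (\<lambda>c. curl (grad (F c)))"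
      unfolding u by (rule ext_deriv_form1(2)[OF g F(3) c])
    also have "\<dots> = zero_field"
      unfolding glue_zero_iff[OF form2_model c] using curl_grad[OF F(1)] by simp
    finally have "ext_deriv V W u = zero_field" .
    moreover have "u \<in> A_tri p V W 1"
      unfolding A_tri_1_iff
      by (intro exI[of _ "\<lambda>c. grad (F c)"] conjI ballI g F(3) c u)
    ultimately show "u \<in> {u \<in> A_tri p V W 1. ext_deriv V W u = zero_field}" by blast
  next
    fix u assume "u \<in> {u \<in> A_tri p V W 1. ext_deriv V W u = zero_field}"
    then obtain U where U: "\<And>c. c \<in> V \<Longrightarrow> vpoly (p - 1) (U c)" "ray_cont U" "ray_cont (\<lambda>c. curl (U c))"
      "u = glue form1 U" and d: "ext_deriv V W u = zero_field"
      unfolding mem_Collect_eq A_tri_1_iff by blast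
    have "glue form2 (\<lambda>c. curl (U c)) = zero_field"
      using ext_deriv_form1(2)[OF U(1,2,3)] d U(4) by simp
    then have z: "\<And>c x. c \<in> V \<Longrightarrow> x \<in> subtri c \<Longrightarrow> curl (U c) x = 0"
      unfolding glue_zero_iff[OF form2_model U(3)] by blast
    let ?F = "\<lambda>c. potential W (U c)"
    have F: "\<And>c. c \<in> V \<Longrightarrow> poly_deg_le p (?F c)"
      using poly_potential[OF U(1)] p by simp
    have gF: "grad (?F c) x = U c x" if "c \<in> V" "x \<in> subtri c" for c x
      using that by (intro grad_potential[OF dim U(1)] z radial_in_subtri)
    have r: "ray_cont (\<lambda>c. grad (?F c))"
    proof (rule ray_contI)
      fix a b c t
      assume *: "a \<in> V" "b \<in> V" "c \<in> V" "b \<noteq> a" "c \<noteq> a" "0 \<le> (t::real)" "t \<le> 1"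
      then show "grad (?F b) (ray a t) = grad (?F c) (ray a t)"
        using gF ray_contD[OF U(2) *] ray_in_subtri by metis
    qed
    have "ext_deriv V W (glue scalar ?F) = glue form1 (\<lambda>c. grad (?F c))"
      by (rule ext_deriv_scalar(2)[OF F ray_cont_potential[OF U(2)] r])
    also have "\<dots> = u"
      unfolding U(4) by (intro eq_glueI U) (auto simp: glue_eq[OF r] gF glue_outside)
    finally have "ext_deriv V W (glue scalar ?F) = u" .
    moreover have "glue scalar ?F \<in> A_tri p V W 0"
      unfolding A_tri_0_iff by (intro exI[of _ ?F] conjI ballI F ray_cont_potential[OF U(2)] r refl)
    ultimately show "u \<in> ext_deriv V W ` A_tri p V W 0" by blast
  qed
  show "ext_deriv V W ` A_tri p V W 1 = A_tri p V W 2"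
  proof (intro set_eqI iffI)
    fix u assume "u \<in> ext_deriv V W ` A_tri p V W 1"
    then obtain U where U: "\<And>c. c \<in> V \<Longrightarrow> vpoly (p - 1) (U c)" "ray_cont U" "ray_cont (\<lambda>c. curl (U c))"
      "u = ext_deriv V W (glue form1 U)" unfolding image_iff Bex_def A_tri_1_iff by blast
    have "u = glue form2 (\<lambda>c. curl (U c))"
      unfolding U(4) by (rule ext_deriv_form1(2)[OF U(1,2,3)])
    moreover have "poly_deg_le (p - 2) (curl (U c))" if "c \<in> V" for c
      using poly_curl[OF U(1)[OF that]] by (simp add: numeral_2_eq_2)
    ultimately show "u \<in> A_tri p V W 2"
      unfolding A_tri_2_iff using U(3) by (intro exI[of _ "\<lambda>c. curl (U c)"]) blast
  next
    fix u assume "u \<in> A_tri p V W 2"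
    then obtain f where f: "\<And>c. c \<in> V \<Longrightarrow> poly_deg_le (p - 2) (f c)" "ray_cont f" "u = glue form2 f"
      by (auto simp: A_tri_2_iff)
    let ?U = "\<lambda>c. koszul (f c)"
    have "Suc (p - 2) = p - 1" using p by simp
    then have U: "\<And>c. c \<in> V \<Longrightarrow> vpoly (p - 1) (?U c)"
      using vpoly_koszul[OF f(1)] by metis
    have c: "ray_cont (\<lambda>c. curl (?U c))"
      by (rule ray_cont_eq[OF f(2)]) (rule curl_koszul[OF f(1)])
    have "ext_deriv V W (glue form1 ?U) = glue form2 (\<lambda>c. curl (?U c))"
      by (rule ext_deriv_form1(2)[OF U ray_cont_koszul[OF f(2)] c])
    also have "\<dots> = u"
      unfolding f(3) by (intro eq_glueI f) (auto simp: glue_eq[OF c] curl_koszul[OF f(1)] glue_outside)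
    finally have "ext_deriv V W (glue form1 ?U) = u" .
    moreover have "glue form1 ?U \<in> A_tri p V W 1"
      unfolding A_tri_1_iff by (intro exI[of _ ?U] conjI ballI U ray_cont_koszul[OF f(2)] c refl)
    ultimately show "u \<in> ext_deriv V W ` A_tri p V W 1" by blast
  qed
qed

end


section \<open>Spaces on an edge\<close>

lemma zero_form_Alt: "zero_form \<in> Alt k"
  by (simp add: Alt_def zero_form_def linear_iff)

lemma zero_field_poly_fields: "zero_field \<in> poly_fields q S k"
  using zero_form_Alt
  by (auto simp: poly_fields_def fields_on_def poly_field_on_def zero_field_def zero_form_def
      intro: poly_deg_le.const)

lemma poly_fields_at: "u \<in> poly_fields q S k \<Longrightarrow> x \<in> S \<Longrightarrow> u x \<in> Alt k"
  by (simp add: poly_fields_def fields_on_def)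

lemma poly_fields_off: "u \<in> poly_fields q S k \<Longrightarrow> x \<notin> S \<Longrightarrow> u x = zero_form"
  by (simp add: poly_fields_def fields_on_def)

lemma A_edge_0_iff:
  "u \<in> A_edge p e 0 \<longleftrightarrow> (\<exists>f D. poly_deg_le p f \<and> vpoly (p - 1) D \<and>
     u = (tr (cell e) (\<lambda>x. scalar (f x)), tr (cell e) (\<lambda>x. form1 (D x))) \<and>
     (\<forall>x\<in>cell e. \<forall>v\<in>tangent (cell e). D x \<bullet> v = grad f x \<bullet> v))"
proof -
  have *: "admissible (cell e) (tr (cell e) (\<lambda>x. scalar (f x))) (tr (cell e) (\<lambda>x. form1 (D x))) \<longleftrightarrow>
     (\<forall>x\<in>cell e. \<forall>v\<in>tangent (cell e). D x \<bullet> v = grad f x \<bullet> v)" (is "?A \<longleftrightarrow> ?R")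
    if f: "poly_deg_le p f" for f :: "'v::euclidean_space \<Rightarrow> real" and D e
  proof -
    have 1: "?A \<longleftrightarrow> (\<forall>x\<in>cell e. \<forall>vs. set vs \<subseteq> tangent (cell e) \<longrightarrow>
         tr (cell e) (\<lambda>x. form1 (D x)) x vs = form1 (grad f x) vs)"
      by (rule admissible_scalar_iff[OF convex_convex_hull f]) (simp add: tr_def)
    show ?thesis
    proof
      assume ?A
      then have a: "\<And>x vs. x \<in> cell e \<Longrightarrow> set vs \<subseteq> tangent (cell e) \<Longrightarrow>
         form1 (D x) vs = form1 (grad f x) vs"
        unfolding 1 by (simp add: tr_def)
      show ?R using a[of _ "[v]" for v] by auto
    next
      assume r: ?R
      have "form1 (D x) vs = form1 (grad f x) vs" if "x \<in> cell e" "set vs \<subseteq> tangent (cell e)" for x vs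
        using r that by (cases vs rule: remdups_adj.cases) auto
      then show ?A unfolding 1 by (simp add: tr_def)
    qed
  qed
  have "u \<in> A_edge p e 0 \<longleftrightarrow> fst u \<in> poly_fields p (cell e) 0 \<and>
      snd u \<in> poly_fields (p - 1) (cell e) 1 \<and> admissible (cell e) (fst u) (snd u)"
    by (cases u) (simp add: A_edge_def)
  also have "\<dots> \<longleftrightarrow> (\<exists>f D. poly_deg_le p f \<and> vpoly (p - 1) D \<and>
     u = (tr (cell e) (\<lambda>x. scalar (f x)), tr (cell e) (\<lambda>x. form1 (D x))) \<and>
     admissible (cell e) (tr (cell e) (\<lambda>x. scalar (f x))) (tr (cell e) (\<lambda>x. form1 (D x))))"
    unfolding poly_fields_iff[OF form_model_scalar] poly_fields_iff[OF form_model_form1] vpoly_real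
      prod_eq_iff fst_conv snd_conv by metis
  finally show ?thesis using * by blast
qed

lemma A_edge_1_iff:
  "u \<in> A_edge p e 1 \<longleftrightarrow> u \<in> poly_fields (p - 1) (cell e) 1 \<times> poly_fields (p - 2) (cell e) 2"
  by (simp add: A_edge_def)

lemma A_edge_2_iff:
  "u \<in> A_edge p e 2 \<longleftrightarrow> u \<in> poly_fields (p - 2) (cell e) 2 \<times> {zero_field}"
  by (simp add: A_edge_def)

lemma A_edge_vertex:
  assumes "k \<in> {0, 1, 2}" "u \<in> A_edge p e k" "v \<in> e"
  shows "res_edge_vert v u \<in> A_vert k"
proof -
  have v: "v \<in> cell e" using assms(3) by (rule hull_inc)
  show ?thesis
    using assms(1,2) poly_fields_at[OF _ v] zero_form_Alt
    by (auto simp: A_edge_def A_vert_def res_edge_vert_def zero_field_def split: if_splits)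
qed

lemma tangent_segment:
  assumes "v \<in> tangent (cell {a, b})"
  obtains s where "v = s *\<^sub>R (b - a)"
proof -
  have "tangent (cell {a, b}) \<subseteq> span {b - a}"
    unfolding tangent_def
  proof (rule span_minimal)
    show "{x - y |x y. x \<in> cell {a, b} \<and> y \<in> cell {a, b}} \<subseteq> span {b - a}"
    proof safe
      fix x y assume "x \<in> cell {a, b}" "y \<in> cell {a, b}"
      then obtain s t where xy: "x = (1 - s) *\<^sub>R a + s *\<^sub>R b" "y = (1 - t) *\<^sub>R a + t *\<^sub>R b"
        unfolding segment_convex_hull[symmetric] closed_segment_def by blast
      have "x - y = (s - t) *\<^sub>R (b - a)" unfolding xy by (simp add: algebra_simps)
      then show "x - y \<in> span {b - a}" by (simp add: span_base span_scale)
    qed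
  qed simp
  then have "v \<in> span {b - a}" using assms by blast
  then show thesis using that by (auto simp: span_singleton)
qed

text \<open>The gradient of the affine coordinate that is \<open>0\<close> at \<open>a\<close> and \<open>1\<close> at \<open>b\<close>.\<close>

definition dual_edge :: "'v::euclidean_space \<Rightarrow> 'v \<Rightarrow> 'v" where
  "dual_edge a b = (b - a) /\<^sub>R ((b - a) \<bullet> (b - a))"

lemma dual_edge: "a \<noteq> b \<Longrightarrow> dual_edge a b \<bullet> (b - a) = 1"
  by (simp add: dual_edge_def)

lemma linear_interpolation:
  fixes a b :: "'v::euclidean_space" and A B :: "'b::euclidean_space"
  assumes "a \<noteq> b"
  obtains U where "vpoly 1 U" "U a = A" "U b = B"
proof
  let ?U = "\<lambda>x. A + (dual_edge a b \<bullet> (x - a)) *\<^sub>R (B - A)"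
  have "poly_deg_le 1 (\<lambda>x. dual_edge a b \<bullet> (x - a))"
    using poly_deg_le_affine[of 0 0 "dual_edge a b" a] by simp
  then show "vpoly 1 ?U" by (intro vpoly_add vpoly_const vpoly_scaleR_const)
  show "?U a = A" by simp
  show "?U b = B" using dual_edge[OF assms] by simp
qed

lemma hermite_interpolation:
  fixes a b A B :: "'v::euclidean_space" and \<alpha> \<beta> :: real
  assumes ab: "a \<noteq> b"
  obtains F where "poly_deg_le 3 F" "F a = \<alpha>" "F b = \<beta>" "grad F a = A" "grad F b = B"
proof
  define n where "n = dual_edge a b"
  \<comment> \<open>the data at \<open>b\<close> fix the affine \<open>Q\<close>; the square of the coordinate \<open>n \<bullet> (x - a)\<close> shields the data at \<open>a\<close>\<close>
  define k where "k = \<beta> - \<alpha> - A \<bullet> (b - a)"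
  define Q where "Q x = k + (B - A - (2 * k) *\<^sub>R n) \<bullet> (x - b)" for x
  define F where "F x = \<alpha> + A \<bullet> (x - a) + n \<bullet> (x - a) * (n \<bullet> (x - a) * Q x)" for x
  have nb: "n \<bullet> (b - a) = 1" using dual_edge[OF ab] by (simp add: n_def)
  have pQ: "poly_deg_le 1 Q"
    unfolding Q_def[abs_def] using poly_deg_le_affine[of 0] by simp
  have gQ: "grad Q x = B - A - (2 * k) *\<^sub>R n" for x
    unfolding Q_def[abs_def] by (rule grad_affine)
  have pa: "poly_deg_le 3 (\<lambda>x. \<alpha> + A \<bullet> (x - a))"
    using poly_deg_le_affine[of 2] by (simp add: eval_nat_numeral)
  note p2 = poly_mult_affine[OF poly_mult_affine[OF pQ, of n a], of n a]
  show "poly_deg_le 3 F"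
    unfolding F_def[abs_def] using p2 by (intro poly_deg_le.add pa) (simp add: eval_nat_numeral)
  have g: "grad F x = A + ((n \<bullet> (x - a)) *\<^sub>R ((n \<bullet> (x - a)) *\<^sub>R grad Q x + Q x *\<^sub>R n)
       + (n \<bullet> (x - a) * Q x) *\<^sub>R n)" for x
    unfolding F_def[abs_def]
    by (simp only: grad_add[OF pa p2] grad_affine grad_mult_affine[OF poly_mult_affine[OF pQ]]
       grad_mult_affine[OF pQ])
  show "F a = \<alpha>" by (simp add: F_def)
  show "F b = \<beta>" by (simp add: F_def nb Q_def k_def)
  show "grad F a = A" by (simp add: g)
  have "Q b = k" by (simp add: Q_def)
  moreover have "(2 * k) *\<^sub>R n = k *\<^sub>R n + k *\<^sub>R n" by (simp flip: scaleR_left_distrib)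
  ultimately show "grad F b = B" by (simp add: g nb gQ)
qed

lemma edge_restriction_onto:
  fixes a b :: "'v::euclidean_space"
  assumes dim: "DIM('v) = 2" and ab: "a \<noteq> b" and p: "3 \<le> p" and k: "k \<in> {0, 1, 2}"
  shows "res_bd_edge {a, b} ` A_edge p {a, b} k = A_bd_edge {a, b} k"
proof
  show "res_bd_edge {a, b} ` A_edge p {a, b} k \<subseteq> A_bd_edge {a, b} k"
    using A_edge_vertex[OF k] unfolding res_bd_edge_def A_bd_edge_def
    by (intro image_subsetI) (simp only: restrict_PiE_iff, blast)
  have in_cell: "a \<in> cell {a, b}" "b \<in> cell {a, b}" by (auto intro: hull_inc)
  have onto: "h \<in> res_bd_edge {a, b} ` A_edge p {a, b} k"
    if "u \<in> A_edge p {a, b} k" "res_edge_vert a u = h a" "res_edge_vert b u = h b"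
      "h \<in> A_bd_edge {a, b} k" for u h
  proof -
    have "h = res_bd_edge {a, b} u"
      using that by (intro extensionalityI[of _ "{a, b}"]) (auto simp: res_bd_edge_def A_bd_edge_def PiE_def)
    then show ?thesis using that(1) by blast
  qed
  note form2_model = form_model_form2[OF dim]
  show "A_bd_edge {a, b} k \<subseteq> res_bd_edge {a, b} ` A_edge p {a, b} k"
  proof
    fix h assume h: "h \<in> A_bd_edge {a, b} k"
    then have hv: "h a \<in> A_vert k" "h b \<in> A_vert k" by (auto simp: A_bd_edge_def)
    consider "k = 0" | "k = 1" | "k = 2" using k by auto
    then show "h \<in> res_bd_edge {a, b} ` A_edge p {a, b} k"
    proof cases
      case 1
      have "\<exists>\<alpha> A. h v = (scalar \<alpha>, form1 A)" if "h v \<in> A_vert k" for v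
        using that 1 form_model_scalar form_model_form1
        by (auto simp: A_vert_def form_model_def mem_Times_iff prod_eq_iff)
      then obtain \<alpha> A \<beta> B where ha: "h a = (scalar \<alpha>, form1 A)" and hb: "h b = (scalar \<beta>, form1 B)"
        using hv by blast
      obtain F where F: "poly_deg_le 3 F" "F a = \<alpha>" "F b = \<beta>" "grad F a = A" "grad F b = B"
        using hermite_interpolation[OF ab] .
      have pF: "poly_deg_le p F" using poly_deg_le_mono[OF F(1) p] .
      show ?thesis
      proof (rule onto[OF _ _ _ h])
        show "(tr (cell {a, b}) (\<lambda>x. scalar (F x)), tr (cell {a, b}) (\<lambda>x. form1 (grad F x)))
            \<in> A_edge p {a, b} k"
          unfolding 1 A_edge_0_iff using pF vpoly_grad[OF pF] by blast
      qed (use F ha hb in_cell in \<open>auto simp: res_edge_vert_def tr_def\<close>)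
    next
      case 2
      have "\<exists>A s. h v = (form1 A, form2 s)" if "h v \<in> A_vert k" for v
        using that 2 form_model_form1 form2_model
        by (auto simp: A_vert_def form_model_def mem_Times_iff prod_eq_iff)
      then obtain A s B t where ha: "h a = (form1 A, form2 s)" and hb: "h b = (form1 B, form2 t)"
        using hv by blast
      obtain U where U: "vpoly 1 U" "U a = A" "U b = B" using linear_interpolation[OF ab] .
      obtain f :: "'v \<Rightarrow> real" where f: "vpoly 1 f" "f a = s" "f b = t"
        using linear_interpolation[OF ab] .
      have pU: "vpoly (p - 1) U" "vpoly (p - 2) f"
        using vpoly_mono[OF U(1)] vpoly_mono[OF f(1)] p by auto
      show ?thesis
      proof (rule onto[OF _ _ _ h])
        show "(tr (cell {a, b}) (\<lambda>x. form1 (U x)), tr (cell {a, b}) (\<lambda>x. form2 (f x)))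
            \<in> A_edge p {a, b} k"
          unfolding 2 A_edge_1_iff mem_Times_iff fst_conv snd_conv
            poly_fields_iff[OF form_model_form1] poly_fields_iff[OF form2_model] using pU by blast
      qed (use U f ha hb in_cell in \<open>auto simp: res_edge_vert_def tr_def\<close>)
    next
      case 3
      have "\<exists>s. h v = (form2 s, zero_form)" if "h v \<in> A_vert k" for v
        using that 3 form2_model
        by (auto simp: A_vert_def form_model_def mem_Times_iff prod_eq_iff)
      then obtain s t where ha: "h a = (form2 s, zero_form)" and hb: "h b = (form2 t, zero_form)"
        using hv by blast
      obtain f :: "'v \<Rightarrow> real" where f: "vpoly 1 f" "f a = s" "f b = t"
        using linear_interpolation[OF ab] .
      have pf: "vpoly (p - 2) f" using vpoly_mono[OF f(1)] p by auto
      show ?thesis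
      proof (rule onto[OF _ _ _ h])
        show "(tr (cell {a, b}) (\<lambda>x. form2 (f x)), zero_field) \<in> A_edge p {a, b} k"
          unfolding 3 A_edge_2_iff mem_Times_iff fst_conv snd_conv
            poly_fields_iff[OF form2_model] using pf by blast
      qed (use f ha hb in_cell in \<open>auto simp: res_edge_vert_def tr_def zero_field_def\<close>)
    qed
  qed
qed

text \<open>The kernel in degree \<open>1\<close> consists of the pairs \<open>(v0, 0)\<close> with arbitrary \<open>v0\<close>, since every \<open>1\<close>-form on
  the edge is closed. A primitive is the radial mean of the component along \<open>b - a\<close>, with centre \<open>a\<close>,
  multiplied by the affine coordinate on the edge.\<close>

lemma exact_edge:
  fixes a b :: "'v::euclidean_space"
  assumes ab: "a \<noteq> b" and p: "1 \<le> p"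
  shows "exact_sequence (zero_field, zero_field) (incl_edge {a, b}) d_edge (A_edge p {a, b})"
  unfolding exact_sequence_def
proof (intro conjI)
  let ?e = "{a, b}"
  have a: "a \<in> cell ?e" by (auto intro: hull_inc)
  note scalar_model = form_model_scalar[where 'v = 'v] and form1_model = form_model_form1[where 'v = 'v]
  have z1: "tr (cell ?e) (\<lambda>x. form1 (0::'v)) = zero_field"
    using form_model_0[OF form1_model] by (auto simp: tr_def zero_field_def)
  show "inj (incl_edge ?e)"
  proof (rule injI)
    fix r s assume "incl_edge ?e r = incl_edge ?e s"
    then have "tr (cell ?e) (\<lambda>_. scalar r) a = tr (cell ?e) (\<lambda>_. scalar s) a"
      by (simp add: incl_edge_def)
    then have "scalar r = (scalar s :: 'v form)" using a by (simp add: tr_def)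
    then show "r = s" by (rule form_model_inj[OF scalar_model])
  qed
  show "range (incl_edge ?e) = {u \<in> A_edge p ?e 0. d_edge u = (zero_field, zero_field)}"
  proof (intro set_eqI iffI)
    fix u assume "u \<in> range (incl_edge ?e)"
    then obtain r where u: "u = (tr (cell ?e) (\<lambda>_. scalar r), tr (cell ?e) (\<lambda>x. form1 0))"
      unfolding z1 by (auto simp: incl_edge_def)
    have "u \<in> A_edge p ?e 0"
      unfolding A_edge_0_iff u
      by (intro exI[of _ "\<lambda>_. r"] exI[of _ "\<lambda>_. 0"]) (simp add: poly_deg_le.const vpoly_const grad_const)
    then show "u \<in> {u \<in> A_edge p ?e 0. d_edge u = (zero_field, zero_field)}"
      by (simp add: u d_edge_def z1)
  next
    fix u assume "u \<in> {u \<in> A_edge p ?e 0. d_edge u = (zero_field, zero_field)}"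
    then obtain f D where f: "poly_deg_le p f" and
      u: "u = (tr (cell ?e) (\<lambda>x. scalar (f x)), tr (cell ?e) (\<lambda>x. form1 (D x)))"
      and D: "\<forall>x\<in>cell ?e. \<forall>v\<in>tangent (cell ?e). D x \<bullet> v = grad f x \<bullet> v"
      and d: "d_edge u = (zero_field, zero_field)"
      by (auto simp: A_edge_0_iff)
    have z: "tr (cell ?e) (\<lambda>x. form1 (D x)) = zero_field" using d by (simp add: u d_edge_def)
    have "D x = 0" if "x \<in> cell ?e" for x
    proof -
      have "form1 (D x) = form1 (0::'v)"
        using fun_cong[OF z, of x] that form_model_0[OF form1_model] by (simp add: tr_def zero_field_def)
      then show ?thesis by (rule form_model_inj[OF form1_model])
    qed
    then have "f x = f a" if "x \<in> cell ?e" for x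
      using D by (intro vanishing_gradient_imp_constant[OF f convex_convex_hull that a]) simp
    then have "u = incl_edge ?e (f a)"
      unfolding u z incl_edge_def by (auto simp: tr_def)
    then show "u \<in> range (incl_edge ?e)" by blast
  qed
  show "d_edge ` A_edge p ?e 0 = {u \<in> A_edge p ?e 1. d_edge u = (zero_field, zero_field)}"
  proof (intro set_eqI iffI)
    fix u assume "u \<in> d_edge ` A_edge p ?e 0"
    then obtain D where D: "vpoly (p - 1) D" and u: "u = (tr (cell ?e) (\<lambda>x. form1 (D x)), zero_field)"
      by (auto simp: A_edge_0_iff d_edge_def)
    show "u \<in> {u \<in> A_edge p ?e 1. d_edge u = (zero_field, zero_field)}"
      using D zero_field_poly_fields
      by (auto simp: u d_edge_def A_edge_1_iff[unfolded One_nat_def] poly_fields_iff[OF form1_model, unfolded One_nat_def])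
  next
    fix u assume "u \<in> {u \<in> A_edge p ?e 1. d_edge u = (zero_field, zero_field)}"
    then have "fst u \<in> poly_fields (p - 1) (cell ?e) 1" "snd u = zero_field"
      unfolding A_edge_1_iff by (auto simp: d_edge_def)
    then obtain U where U: "vpoly (p - 1) U" and
      u: "u = (tr (cell ?e) (\<lambda>x. form1 (U x)), zero_field)"
      unfolding poly_fields_iff[OF form1_model] by (metis prod.collapse)
    note q = vpoly_inner[OF U, of "b - a"]
    let ?r = "radial_mean a 0 (\<lambda>x. U x \<bullet> (b - a))"
    let ?f = "\<lambda>x. dual_edge a b \<bullet> (x - a) * ?r x"
    have f: "poly_deg_le p ?f" using poly_mult_affine[OF poly_radial_mean[OF q]] p by simp
    have "U x \<bullet> v = grad ?f x \<bullet> v" if x: "x \<in> cell ?e" and v: "v \<in> tangent (cell ?e)" for x v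
    proof -
      obtain s where s: "v = s *\<^sub>R (b - a)" using tangent_segment[OF v] .
      have "x - a \<in> tangent (cell ?e)" using x a by (rule tangentI)
      then obtain t where t: "x - a = t *\<^sub>R (b - a)" by (rule tangent_segment)
      have "grad ?f x \<bullet> (b - a) = ?r x + t * (grad ?r x \<bullet> (b - a))"
        unfolding grad_mult_affine[OF poly_radial_mean[OF q]] by (simp add: t inner_add_left dual_edge[OF ab])
      also have "\<dots> = U x \<bullet> (b - a)"
        using radial_mean_Euler[OF q, of 0 a x] by (simp add: t)
      finally show ?thesis by (simp add: s)
    qed
    then have "(tr (cell ?e) (\<lambda>x. scalar (?f x)), tr (cell ?e) (\<lambda>x. form1 (U x))) \<in> A_edge p ?e 0"
      unfolding A_edge_0_iff using f U by blast
    then have "d_edge (tr (cell ?e) (\<lambda>x. scalar (?f x)), tr (cell ?e) (\<lambda>x. form1 (U x)))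
       \<in> d_edge ` A_edge p ?e 0" by (rule imageI)
    then show "u \<in> d_edge ` A_edge p ?e 0" by (simp add: u d_edge_def)
  qed
  show "d_edge ` A_edge p ?e 1 = A_edge p ?e 2"
  proof (intro set_eqI iffI)
    fix u assume "u \<in> d_edge ` A_edge p ?e 1"
    then show "u \<in> A_edge p ?e 2" unfolding A_edge_2_iff by (auto simp: A_edge_def d_edge_def)
  next
    fix u assume "u \<in> A_edge p ?e 2"
    then obtain v where v: "v \<in> poly_fields (p - 2) (cell ?e) 2" "u = (v, zero_field)"
      unfolding A_edge_2_iff by auto
    have "(zero_field, v) \<in> A_edge p ?e 1"
      unfolding A_edge_1_iff using v zero_field_poly_fields by blast
    then have "d_edge (zero_field, v) \<in> d_edge ` A_edge p ?e 1" by (rule imageI)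
    then show "u \<in> d_edge ` A_edge p ?e 1" by (simp add: v d_edge_def)
  qed
qed


section \<open>Spaces at a vertex\<close>

lemma vertex_restriction_onto:
  assumes "k \<in> {0, 1, 2}"
  shows "(\<lambda>u. \<lambda>_\<in>({} :: 'v::euclidean_space set). u) ` (A_vert k :: ('v form \<times> 'v form) set)
                        = (\<Pi>\<^sub>E _\<in>{}. A_vert k)"
proof -
  have "(A_vert k :: ('v form \<times> 'v form) set) \<noteq> {}"
    using zero_form_Alt by (auto simp: A_vert_def)
  then show ?thesis by (auto simp: restrict_def)
qed

lemma exact_vertex:
  "exact_sequence (zero_form, zero_form) incl_vert d_vert
     (A_vert :: nat \<Rightarrow> ('v::euclidean_space form \<times> 'v form) set)"
proof -
  have A0: "(Alt 0 :: 'v form set) = range scalar"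
    using form_model_scalar by (auto simp: form_model_def)
  have "inj (incl_vert :: real \<Rightarrow> 'v form \<times> 'v form)"
    by (rule injI) (auto simp: incl_vert_def dest: form_model_inj[OF form_model_scalar])
  moreover have "range (incl_vert :: real \<Rightarrow> 'v form \<times> 'v form) =
     {u \<in> A_vert 0. d_vert u = (zero_form, zero_form)}"
    using zero_form_Alt by (auto simp: incl_vert_def A_vert_def d_vert_def A0)
  moreover have "d_vert ` A_vert 0 =
     {u \<in> (A_vert 1 :: ('v form \<times> 'v form) set). d_vert u = (zero_form, zero_form)}"
    using zero_form_Alt[of 0] zero_form_Alt[of 2]
    by (auto simp: A_vert_def d_vert_def image_iff)
  moreover have "d_vert ` A_vert 1 = (A_vert 2 :: ('v form \<times> 'v form) set)"
    using zero_form_Alt[of 1]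
    by (auto simp: A_vert_def d_vert_def image_iff)
  ultimately show ?thesis unfolding exact_sequence_def by blast
qed


context split_triangle
begin

section \<open>Extension from the boundary of the triangle\<close>

lemma vertex_in_edge: "a \<in> V \<Longrightarrow> c \<noteq> a \<Longrightarrow> a \<in> cell (V - {c})"
  by (intro hull_inc) auto

lemma restriction_in_boundary_space:
  assumes k: "k \<in> {0, 1, 2}"
    and e: "\<And>c. c \<in> V \<Longrightarrow> res_tri_edge V W k (V - {c}) u \<in> A_edge p (V - {c}) k"
  shows "res_bd_tri V W k u \<in> A_bd_tri p V k"
proof -
  have c: "res_tri_vert V W k v u = res_edge_vert v (res_tri_edge V W k e u)" if "v \<in> e" for v e
    using hull_inc[OF that, of convex]
    by (simp add: res_tri_vert_def res_edge_vert_def res_tri_edge_def tr_def zero_field_def)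
  have "res_tri_vert V W k v u \<in> A_vert k" if v: "v \<in> V" for v
  proof -
    obtain b where b: "b \<in> V" "b \<noteq> v" using two_others[OF v] by metis
    then have "v \<in> V - {b}" using v by auto
    then show ?thesis unfolding c[OF \<open>v \<in> V - {b}\<close>] using A_edge_vertex[OF k e[OF b(1)]] by blast
  qed
  moreover have "res_tri_edge V W k e u \<in> A_edge p e k" if "e \<in> edges V" for e
    using that e by (auto simp: edges_V)
  moreover have "v \<in> V" if "e \<in> edges V" "v \<in> e" for e v
    using that by (auto simp: edges_def)
  ultimately show ?thesis
    using c by (auto simp: A_bd_tri_def res_bd_tri_def restrict_PiE_iff)
qed

lemma A_edge_outside:
  assumes "(v0, v1) \<in> A_edge p e k" "x \<notin> cell e"
  shows "v0 x = zero_form" "v1 x = zero_form"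
  using assms poly_fields_off by (auto simp: A_edge_def zero_field_def split: if_splits)

text \<open>The vertex components of boundary data are forced by the edge components, so it suffices to match
  the latter.\<close>

lemma boundary_data_eq_restriction:
  assumes k: "k \<in> {0, 1, 2}" and fg: "(f, g) \<in> A_bd_tri p V k"
    and 0: "\<And>c x. c \<in> V \<Longrightarrow> x \<in> cell (V - {c}) \<Longrightarrow> u x = fst (f (V - {c})) x"
    and 1: "\<And>c x. c \<in> V \<Longrightarrow> x \<in> cell (V - {c}) \<Longrightarrow> k \<le> 1 \<Longrightarrow>
         ext_deriv V W u x = snd (f (V - {c})) x"
  shows "(f, g) = res_bd_tri V W k u"
proof -
  have f: "f \<in> (\<Pi>\<^sub>E e\<in>edges V. A_edge p e k)" and g: "g \<in> (\<Pi>\<^sub>E v\<in>V. A_vert k)"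
    and fgv: "\<And>e v. e \<in> edges V \<Longrightarrow> v \<in> e \<Longrightarrow> g v = res_edge_vert v (f e)"
    using fg by (auto simp: A_bd_tri_def)
  have two: "snd (f e) = zero_field" if "e \<in> edges V" "\<not> k \<le> 1" for e
  proof -
    have "k = 2" using k that(2) by auto
    then have "f e \<in> poly_fields (p - 2) (cell e) 2 \<times> {zero_field}"
      using PiE_mem[OF f that(1)] unfolding A_edge_2_iff[symmetric] by simp
    then show ?thesis by auto
  qed
  have fe: "f e = res_tri_edge V W k e u" if e: "e \<in> edges V" for e
  proof -
    obtain c where c: "c \<in> V" "e = V - {c}" using e by (auto simp: edges_V)
    have m: "(fst (f e), snd (f e)) \<in> A_edge p e k" using PiE_mem[OF f e] by simp
    have "fst (f e) x = tr (cell e) u x" for x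
      using 0[OF c(1)] A_edge_outside(1)[OF m] c(2) by (simp add: tr_def)
    moreover have "snd (f e) x = tr (cell e) (ext_deriv V W u) x" if "k \<le> 1" for x
      using 1[OF c(1) _ that] A_edge_outside(2)[OF m] c(2) by (simp add: tr_def)
    ultimately show ?thesis
      using two[OF e] by (simp add: res_tri_edge_def prod_eq_iff fun_eq_iff)
  qed
  have gv: "g v = res_tri_vert V W k v u" if v: "v \<in> V" for v
  proof -
    obtain c where c: "c \<in> V" "c \<noteq> v" using two_others[OF v] by metis
    then have e: "V - {c} \<in> edges V" "v \<in> V - {c}" using v by (auto simp: edges_V)
    then show ?thesis
      using hull_inc[OF e(2), of convex]
      by (simp add: fgv[OF e] fe[OF e(1)] res_tri_vert_def res_edge_vert_def res_tri_edge_def tr_def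
          zero_field_def)
  qed
  have "f = (\<lambda>e\<in>edges V. res_tri_edge V W k e u)"
    using f fe by (intro extensionalityI[of _ "edges V"]) (auto simp: PiE_def)
  moreover have "g = (\<lambda>v\<in>V. res_tri_vert V W k v u)"
    using g gv by (intro extensionalityI[of _ V]) (auto simp: PiE_def)
  ultimately show ?thesis by (simp add: res_bd_tri_def)
qed

lemma boundary_data_vertex:
  assumes "(f, g) \<in> A_bd_tri p V k" "a \<in> V" "b \<in> V" "c \<in> V" "b \<noteq> a" "c \<noteq> a"
  shows "fst (f (V - {b})) a = fst (f (V - {c})) a" "snd (f (V - {b})) a = snd (f (V - {c})) a"
proof -
  have "V - {b} \<in> edges V" "V - {c} \<in> edges V" "a \<in> V - {b}" "a \<in> V - {c}"
    using assms by (auto simp: edges_V)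
  moreover have "\<forall>e\<in>edges V. \<forall>v\<in>e. g v = res_edge_vert v (f e)"
    using assms(1) unfolding A_bd_tri_def by blast
  ultimately have "g a = res_edge_vert a (f (V - {b}))" "g a = res_edge_vert a (f (V - {c}))"
    by blast+
  then have "res_edge_vert a (f (V - {b})) = res_edge_vert a (f (V - {c}))" by simp
  then show "fst (f (V - {b})) a = fst (f (V - {c})) a" "snd (f (V - {b})) a = snd (f (V - {c})) a"
    by (auto simp: res_edge_vert_def split_beta)
qed

lemma boundary_data_edge: "(f, g) \<in> A_bd_tri p V k \<Longrightarrow> c \<in> V \<Longrightarrow> f (V - {c}) \<in> A_edge p (V - {c}) k"
  by (auto simp: A_bd_tri_def edges_V)

lemma glue_on_edge:
  assumes "ray_cont F" "c \<in> V" "x \<in> cell (V - {c})"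
  shows "glue \<iota> F x = \<iota> (F c x)"
  using glue_eq[OF assms(1,2)] edge_subset_subtri[OF assms(2)] assms(3) by blast

lemma tr_glue_edge:
  assumes "ray_cont F" "c \<in> V"
  shows "tr (cell (V - {c})) (glue \<iota> F) = tr (cell (V - {c})) (\<lambda>x. \<iota> (F c x))"
  using glue_on_edge[OF assms] by (auto simp: tr_def)

lemma tangent_edge:
  assumes c: "c \<in> V" and v: "G c \<bullet> v = 0"
  shows "v \<in> tangent (cell (V - {c}))"
proof -
  obtain a b where ab: "a \<noteq> c" "b \<noteq> c" "a \<noteq> b" "a \<in> V" "b \<in> V" using two_others[OF c] by metis
  obtain p q where vpq: "v = p *\<^sub>R (a - W) + q *\<^sub>R (b - W)"
    using ex_vector_combination[OF ab(4,5,3)] .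
  have "p + q = 0" using v ab c by (simp add: vpq inner_add_right G_vertex)
  then have "q = - p" by simp
  then have "v = p *\<^sub>R (a - b)" by (simp add: vpq algebra_simps)
  moreover have "a - b \<in> tangent (cell (V - {c}))"
    using ab by (intro tangentI vertex_in_edge) auto
  ultimately show ?thesis by (simp add: tangent_def span_scale)
qed

lemma extension_0:
  assumes p: "2 \<le> p"
  shows "res_bd_tri V W 0 ` A_tri p V W 0 = A_bd_tri p V 0"
proof (intro set_eqI iffI)
  fix h assume "h \<in> res_bd_tri V W 0 ` A_tri p V W 0"
  then obtain F where F: "\<And>c. c \<in> V \<Longrightarrow> poly_deg_le p (F c)" "ray_cont F" "ray_cont (\<lambda>c. grad (F c))"
    and h: "h = res_bd_tri V W 0 (glue scalar F)"
    unfolding image_iff Bex_def A_tri_0_iff by blast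
  note d = ext_deriv_scalar(2)[OF F]
  show "h \<in> A_bd_tri p V 0"
    unfolding h
  proof (rule restriction_in_boundary_space)
    fix c assume c: "c \<in> V"
    have e: "res_tri_edge V W 0 (V - {c}) (glue scalar F) =
      (tr (cell (V - {c})) (\<lambda>x. scalar (F c x)), tr (cell (V - {c})) (\<lambda>x. form1 (grad (F c) x)))"
      by (simp add: res_tri_edge_def d tr_glue_edge[OF F(2) c] tr_glue_edge[OF F(3) c])
    show "res_tri_edge V W 0 (V - {c}) (glue scalar F) \<in> A_edge p (V - {c}) 0"
      unfolding e A_edge_0_iff using F(1)[OF c] vpoly_grad[OF F(1)[OF c]] by blast
  qed simp
next
  fix h assume "h \<in> A_bd_tri p V 0"
  then obtain f g where h: "h = (f, g)" and fg: "(f, g) \<in> A_bd_tri p V 0" by (cases h) auto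
  have "\<forall>c\<in>V. \<exists>\<phi> D. poly_deg_le p \<phi> \<and> vpoly (p - 1) D \<and>
     f (V - {c}) = (tr (cell (V - {c})) (\<lambda>x. scalar (\<phi> x)), tr (cell (V - {c})) (\<lambda>x. form1 (D x))) \<and>
     (\<forall>x\<in>cell (V - {c}). \<forall>v\<in>tangent (cell (V - {c})). D x \<bullet> v = grad \<phi> x \<bullet> v)"
    using boundary_data_edge[OF fg] unfolding A_edge_0_iff by blast
  then obtain \<phi> D where
    \<phi>: "\<And>c. c \<in> V \<Longrightarrow> poly_deg_le p (\<phi> c)" and D: "\<And>c. c \<in> V \<Longrightarrow> vpoly (p - 1) (D c)"
    and f: "\<And>c. c \<in> V \<Longrightarrow> f (V - {c}) =
      (tr (cell (V - {c})) (\<lambda>x. scalar (\<phi> c x)), tr (cell (V - {c})) (\<lambda>x. form1 (D c x)))"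
    and tan: "\<And>c x v. \<lbrakk>c \<in> V; x \<in> cell (V - {c}); v \<in> tangent (cell (V - {c}))\<rbrakk>
       \<Longrightarrow> D c x \<bullet> v = grad (\<phi> c) x \<bullet> v"
    by metis
  have v: "\<phi> b a = \<phi> c a" "D b a = D c a"
    if *: "a \<in> V" "b \<in> V" "c \<in> V" "b \<noteq> a" "c \<noteq> a" for a b c
  proof -
    have "scalar (\<phi> b a) = (scalar (\<phi> c a) :: 'v form)" "form1 (D b a) = form1 (D c a)"
      using boundary_data_vertex[OF fg *] vertex_in_edge[OF *(1,4)] vertex_in_edge[OF *(1,5)]
      by (simp_all add: f * tr_def)
    then show "\<phi> b a = \<phi> c a" "D b a = D c a"
      by (auto dest: form_model_inj[OF scalar_model] form_model_inj[OF form1_model])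
  qed
  obtain m where m: "p = Suc (Suc m)" using p by (metis add_2_eq_Suc le_Suc_ex)
  obtain F where F: "\<And>c. c \<in> V \<Longrightarrow> poly_deg_le (Suc (Suc m)) (F c)" "ray_cont F"
    "ray_cont (\<lambda>c. grad (F c))"
    "\<And>c x. c \<in> V \<Longrightarrow> x \<in> cell (V - {c}) \<Longrightarrow> F c x = \<phi> c x"
    "\<And>c x. c \<in> V \<Longrightarrow> x \<in> cell (V - {c}) \<Longrightarrow> grad (F c) x = D c x"
  proof (rule grad_extension[of m \<phi> D])
    show "poly_deg_le (Suc (Suc m)) (\<phi> c)" if "c \<in> V" for c using \<phi>[OF that] by (simp add: m)
    show "vpoly (Suc m) (D c)" if "c \<in> V" for c using D[OF that] by (simp add: m)
    show "grad (\<phi> c) x \<bullet> v = D c x \<bullet> v" if "c \<in> V" "x \<in> cell (V - {c})" "G c \<bullet> v = 0" for c x v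
      using tan[OF that(1,2) tangent_edge[OF that(1,3)]] by simp
  qed (use v in blast)+
  let ?u = "glue scalar F"
  have d: "ext_deriv V W ?u = glue form1 (\<lambda>c. grad (F c))"
    by (rule ext_deriv_scalar(2)[OF F(1,2,3)])
  have "h = res_bd_tri V W 0 ?u"
    unfolding h
  proof (rule boundary_data_eq_restriction[OF _ fg])
    fix c x assume c: "c \<in> V" "x \<in> cell (V - {c})"
    show "?u x = fst (f (V - {c})) x"
      using c F(4)[OF c] by (simp add: glue_on_edge[OF F(2) c] f tr_def)
    show "ext_deriv V W ?u x = snd (f (V - {c})) x"
      using c F(5)[OF c] by (simp add: d glue_on_edge[OF F(3) c] f tr_def)
  qed simp
  moreover have "?u \<in> A_tri p V W 0"
    unfolding A_tri_0_iff m by (intro exI[of _ F] conjI ballI F refl)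
  ultimately show "h \<in> res_bd_tri V W 0 ` A_tri p V W 0" by blast
qed

lemma extension_1:
  assumes p: "3 \<le> p"
  shows "res_bd_tri V W 1 ` A_tri p V W 1 = A_bd_tri p V 1"
proof (intro set_eqI iffI)
  fix h assume "h \<in> res_bd_tri V W 1 ` A_tri p V W 1"
  then obtain U where U: "\<And>c. c \<in> V \<Longrightarrow> vpoly (p - 1) (U c)" "ray_cont U" "ray_cont (\<lambda>c. curl (U c))"
    and h: "h = res_bd_tri V W 1 (glue form1 U)"
    unfolding image_iff Bex_def A_tri_1_iff by blast
  note d = ext_deriv_form1(2)[OF U]
  show "h \<in> A_bd_tri p V 1"
    unfolding h
  proof (rule restriction_in_boundary_space)
    fix c assume c: "c \<in> V"
    have e: "res_tri_edge V W 1 (V - {c}) (glue form1 U) =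
      (tr (cell (V - {c})) (\<lambda>x. form1 (U c x)), tr (cell (V - {c})) (\<lambda>x. form2 (curl (U c) x)))"
      by (simp add: res_tri_edge_def d tr_glue_edge[OF U(2) c] tr_glue_edge[OF U(3) c])
    have "p - 1 - 1 = p - 2" by simp
    then have "vpoly (p - 2) (curl (U c))" using poly_curl[OF U(1)[OF c]] by simp
    then show "res_tri_edge V W 1 (V - {c}) (glue form1 U) \<in> A_edge p (V - {c}) 1"
      unfolding e A_edge_1_iff mem_Times_iff fst_conv snd_conv poly_fields_iff[OF form1_model]
        poly_fields_iff[OF form2_model] using U(1)[OF c] by blast
  qed simp
next
  fix h assume "h \<in> A_bd_tri p V 1"
  then obtain f g where h: "h = (f, g)" and fg: "(f, g) \<in> A_bd_tri p V 1" by (cases h) auto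
  have "\<forall>c\<in>V. \<exists>U s. vpoly (p - 1) U \<and> vpoly (p - 2) s \<and>
     f (V - {c}) = (tr (cell (V - {c})) (\<lambda>x. form1 (U x)), tr (cell (V - {c})) (\<lambda>x. form2 (s x)))"
    using boundary_data_edge[OF fg]
    unfolding A_edge_1_iff mem_Times_iff poly_fields_iff[OF form1_model] poly_fields_iff[OF form2_model] prod_eq_iff
      fst_conv snd_conv by blast
  then obtain U0 s0 where
    U0: "\<And>c. c \<in> V \<Longrightarrow> vpoly (p - 1) (U0 c)" and s0: "\<And>c. c \<in> V \<Longrightarrow> vpoly (p - 2) (s0 c)"
    and f: "\<And>c. c \<in> V \<Longrightarrow> f (V - {c}) =
      (tr (cell (V - {c})) (\<lambda>x. form1 (U0 c x)), tr (cell (V - {c})) (\<lambda>x. form2 (s0 c x)))"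
    by metis
  have v: "U0 b a = U0 c a" "s0 b a = s0 c a"
    if *: "a \<in> V" "b \<in> V" "c \<in> V" "b \<noteq> a" "c \<noteq> a" for a b c
  proof -
    have "form1 (U0 b a) = form1 (U0 c a)" "form2 (s0 b a) = (form2 (s0 c a) :: 'v form)"
      using boundary_data_vertex[OF fg *] vertex_in_edge[OF *(1,4)] vertex_in_edge[OF *(1,5)]
      by (simp_all add: f * tr_def)
    then show "U0 b a = U0 c a" "s0 b a = s0 c a"
      by (auto dest: form_model_inj[OF form1_model] form_model_inj[OF form2_model])
  qed
  have sp: "Suc (p - 2) = p - 1" using p by simp
  obtain U where U: "\<And>c. c \<in> V \<Longrightarrow> vpoly (Suc (p - 2)) (U c)" "ray_cont U"
    "ray_cont (\<lambda>c. curl (U c))"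
    "\<And>c x. c \<in> V \<Longrightarrow> gam c x = 0 \<Longrightarrow> U c x = U0 c x"
    "\<And>c x. c \<in> V \<Longrightarrow> gam c x = 0 \<Longrightarrow> curl (U c) x = s0 c x"
  proof (rule curl_extension[of "p - 2" U0 s0])
    show "vpoly (Suc (p - 2)) (U0 c)" if "c \<in> V" for c using U0[OF that] by (simp only: sp)
    show "poly_deg_le (p - 2) (s0 c)" if "c \<in> V" for c using s0[OF that] by simp
    show "0 < p - 2" using p by simp
  qed (use v in blast)+
  let ?u = "glue form1 U"
  have d: "ext_deriv V W ?u = glue form2 (\<lambda>c. curl (U c))"
    by (rule ext_deriv_form1(2)[OF U(1,2,3)])
  have "h = res_bd_tri V W 1 ?u"
    unfolding h
  proof (rule boundary_data_eq_restriction[OF _ fg])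
    fix c x assume c: "c \<in> V" "x \<in> cell (V - {c})"
    then have z: "gam c x = 0" using edge_iff by blast
    show "?u x = fst (f (V - {c})) x"
      using c U(4)[OF c(1) z] by (simp add: glue_on_edge[OF U(2) c] f tr_def)
    show "ext_deriv V W ?u x = snd (f (V - {c})) x"
      using c U(5)[OF c(1) z] by (simp add: d glue_on_edge[OF U(3) c] f tr_def)
  qed simp
  moreover have "?u \<in> A_tri p V W 1"
    unfolding A_tri_1_iff sp[symmetric] by (intro exI[of _ U] conjI ballI U refl)
  ultimately show "h \<in> res_bd_tri V W 1 ` A_tri p V W 1" by blast
qed

lemma extension_2: "res_bd_tri V W 2 ` A_tri p V W 2 = A_bd_tri p V 2"
proof (intro set_eqI iffI)
  fix h assume "h \<in> res_bd_tri V W 2 ` A_tri p V W 2"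
  then obtain F where F: "\<And>c. c \<in> V \<Longrightarrow> poly_deg_le (p - 2) (F c)" "ray_cont F"
    and h: "h = res_bd_tri V W 2 (glue form2 F)"
    unfolding image_iff Bex_def A_tri_2_iff by blast
  show "h \<in> A_bd_tri p V 2"
    unfolding h
  proof (rule restriction_in_boundary_space)
    fix c assume c: "c \<in> V"
    have e: "res_tri_edge V W 2 (V - {c}) (glue form2 F) =
      (tr (cell (V - {c})) (\<lambda>x. form2 (F c x)), zero_field)"
      by (simp add: res_tri_edge_def tr_glue_edge[OF F(2) c])
    have "vpoly (p - 2) (F c)" using F(1)[OF c] by simp
    then show "res_tri_edge V W 2 (V - {c}) (glue form2 F) \<in> A_edge p (V - {c}) 2"
      unfolding e A_edge_2_iff mem_Times_iff fst_conv snd_conv poly_fields_iff[OF form2_model] by blast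
  qed simp
next
  fix h assume "h \<in> A_bd_tri p V 2"
  then obtain f g where h: "h = (f, g)" and fg: "(f, g) \<in> A_bd_tri p V 2" by (cases h) auto
  have "\<forall>c\<in>V. \<exists>s. vpoly (p - 2) s \<and> fst (f (V - {c})) = tr (cell (V - {c})) (\<lambda>x. form2 (s x))"
    using boundary_data_edge[OF fg]
    unfolding A_edge_2_iff mem_Times_iff poly_fields_iff[OF form2_model] by blast
  then obtain s0 where s0: "\<And>c. c \<in> V \<Longrightarrow> vpoly (p - 2) (s0 c)"
    and f: "\<And>c. c \<in> V \<Longrightarrow> fst (f (V - {c})) = tr (cell (V - {c})) (\<lambda>x. form2 (s0 c x))"
    by metis
  have v: "s0 b a = s0 c a" if *: "a \<in> V" "b \<in> V" "c \<in> V" "b \<noteq> a" "c \<noteq> a" for a b c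
  proof -
    have "form2 (s0 b a) = (form2 (s0 c a) :: 'v form)"
      using boundary_data_vertex(1)[OF fg *] vertex_in_edge[OF *(1,4)] vertex_in_edge[OF *(1,5)]
      by (simp add: f * tr_def)
    then show "s0 b a = s0 c a" by (rule form_model_inj[OF form2_model])
  qed
  obtain F where F: "\<And>c. c \<in> V \<Longrightarrow> vpoly (p - 2) (F c)" "ray_cont F"
    "\<And>c x. c \<in> V \<Longrightarrow> gam c x = 0 \<Longrightarrow> F c x = s0 c x"
    using homogeneous_family[where f = s0, OF s0 v] by blast
  let ?u = "glue form2 F"
  have "h = res_bd_tri V W 2 ?u"
    unfolding h
  proof (rule boundary_data_eq_restriction[OF _ fg])
    fix c x assume c: "c \<in> V" "x \<in> cell (V - {c})"
    then have z: "gam c x = 0" using edge_iff by blast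
    show "?u x = fst (f (V - {c})) x"
      using c F(3)[OF c(1) z] by (simp add: glue_on_edge[OF F(2) c] f tr_def)
  qed simp_all
  moreover have "?u \<in> A_tri p V W 2"
    unfolding A_tri_2_iff using F(1,2) by (intro exI[of _ F]) simp
  ultimately show "h \<in> res_bd_tri V W 2 ` A_tri p V W 2" by blast
qed

lemma extension_and_compatibility:
  assumes p: "3 \<le> p"
  shows "admits_extensions p V W \<and> compatible p V W"
proof -
  have ext: "\<forall>k\<in>{0, 1, 2}. res_bd_tri V W k ` A_tri p V W k = A_bd_tri p V k"
    using extension_0[of p] extension_1[OF p] extension_2[of p] p by auto
  have edge: "(\<forall>k\<in>{0, 1, 2}. res_bd_edge e ` A_edge p e k = A_bd_edge e k) \<and>
        exact_sequence (zero_field, zero_field) (incl_edge e) d_edge (A_edge p e)"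
    if "e \<in> edges V" for e
  proof -
    have "card e = 2" using that by (simp add: edges_def)
    then obtain a b where e: "e = {a, b}" "a \<noteq> b" by (meson card_2_iff)
    show ?thesis
      using edge_restriction_onto[OF dim e(2) p] exact_edge[OF e(2), of p] p unfolding e(1) by auto
  qed
  show ?thesis
    unfolding admits_extensions_def compatible_def
    by (intro conjI ballI ext[rule_format] exact_triangle edge[THEN conjunct1, rule_format]
        edge[THEN conjunct2] vertex_restriction_onto exact_vertex) (use p in auto)
qed

end

text \<open>Affine independence allows a linear functional to be prescribed on the differences \<open>x - z\<close> of the
  vertices; choosing it \<open>1 / w a\<close> on \<open>a - z\<close> and \<open>0\<close> on the others normalises it at \<open>W\<close> as required.\<close>

lemma split_triangle_exists:
  fixes V :: "'v::euclidean_space set"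
  assumes dim: "DIM('v) = 2" and card: "card V = 3" and ind: "\<not> affine_dependent V"
    and W: "W \<in> interior (convex hull V)"
  obtains w G where "split_triangle V W w G"
proof -
  have "\<exists>u. (\<forall>x\<in>V. 0 < u x) \<and> sum u V = 1 \<and> (\<Sum>x\<in>V. u x *\<^sub>R x) = W"
    using W unfolding interior_convex_hull_explicit_minimal[OF ind] by (auto split: if_splits)
  then obtain w where w: "\<And>x. x \<in> V \<Longrightarrow> 0 < w x" "sum w V = 1" "(\<Sum>x\<in>V. w x *\<^sub>R x) = W" by blast
  have fin: "finite V" using card by (metis card.infinite zero_neq_numeral)
  have "\<exists>g. \<forall>b\<in>V. 1 + g \<bullet> (b - W) = (if a = b then 1 / w a else 0)" if a: "a \<in> V" for a
  proof -
    have "card (V - {a}) = 2" using card a by simp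
    then have "V - {a} \<noteq> {}" by force
    then obtain z where z: "z \<in> V" "z \<noteq> a" by blast
    let ?B = "(\<lambda>x. - z + x) ` (V - {z})"
    have "independent ?B" using ind affine_dependent_iff_dependent2[OF z(1)] by blast
    from linear_independent_extend[OF this, of "\<lambda>y. if y = a - z then 1 / w a else 0 :: real"]
    obtain l :: "'v \<Rightarrow> real" where l: "linear l"
      "\<And>y. y \<in> ?B \<Longrightarrow> l y = (if y = a - z then 1 / w a else 0)" by blast
    then obtain g where g: "l = (\<lambda>x. g \<bullet> x)"
      using bounded_linear_eq_inner linear_conv_bounded_linear by blast
    have gv: "g \<bullet> (b - z) = (if a = b then 1 / w a else 0)" if "b \<in> V" for b
    proof (cases "b = z")
      case False
      then have "- z + b \<in> ?B" using that by blast
      from l(2)[OF this] show ?thesis by (auto simp: g)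
    qed (use z in auto)
    have "W - z = (\<Sum>x\<in>V. w x *\<^sub>R (x - z))"
      by (simp add: scaleR_right_diff_distrib sum_subtractf w(2,3) scaleR_left.sum[symmetric])
    then have "g \<bullet> (W - z) = (\<Sum>x\<in>V. w x * (if a = x then 1 / w a else 0))"
      using gv by (simp add: inner_sum_right)
    also have "\<dots> = (\<Sum>x\<in>V. if a = x then 1 else 0)"
      using w(1)[OF a] by (intro sum.cong) auto
    also have "\<dots> = 1" using fin a by simp
    finally have gW: "g \<bullet> (W - z) = 1" .
    have "1 + g \<bullet> (b - W) = (if a = b then 1 / w a else 0)" if "b \<in> V" for b
      using gv[OF that] gW by (simp add: inner_diff_right)
    then show ?thesis by blast
  qed
  then obtain G where G: "\<And>a b. a \<in> V \<Longrightarrow> b \<in> V \<Longrightarrow> 1 + G a \<bullet> (b - W) = (if a = b then 1 / w a else 0)"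
    by metis
  show thesis
    by (rule that[of w G], unfold_locales) (use dim card w G in auto)
qed

theorem theorem5p3:
  fixes V :: "'v::euclidean_space set" and W :: 'v and p :: nat
  assumes "DIM('v) = 2"
    and "card V = 3" and "\<not> affine_dependent V"
    and "W \<in> interior (convex hull V)"
    and "p \<ge> 3"
  shows "admits_extensions p V W \<and> compatible p V W"
proof -
  obtain w G where "split_triangle V W w G"
    using split_triangle_exists[OF assms(1-4)] .
  then show ?thesis using split_triangle.extension_and_compatibility assms(5) by blast
qed

end
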